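(* Let $\alpha$ be an ordinal, $\ell$ a nonzero (positive) integer, $\mu=\aleph_\alpha$ and $\lambda=\aleph_{\alpha+\ell}$. Let $\mathcal{D}$ be a $(\lambda,\mu)$-perfected ultrafilter on $\lambda$. Then for every integer $2\le k<\omega$: (a) if $k<\ell$, then $\mathcal{D}$-ultrapowers of models of $T_{k+1,k}$ are not $\lambda^+$-saturated; (b) if $\ell<k$, then $\mathcal{D}$-ultrapowers of models of $T_{k+1,k}$ are $\lambda^+$-saturated.
   Context: $T_{m,k}$ ($m>k\ge2$): the model completion of the theory with one symmetric irreflexive $(k+1)$-ary relation $R$ and no complete $R$-hypergraph on $m+1$ vertices. Boolean algebra: for a cardinal $\mu$ and ordinal $\alpha$, $\operatorname{FI}_\mu(\alpha)$ is the set of finite partial functions from $\alpha$ to $\mu$; $\mathfrak{B}^1_{\alpha,\mu}$ is the completion of the Boolean algebra freely generated by elements $\mathbf{x}_f$ ($f\in\operatorname{FI}_\mu(\alpha)$) subject to $\mathbf{x}_{f_2}\le\mathbf{x}_{f_1}$ when $f_1\subseteq f_2$ and $\mathbf{x}_f\cap\mathbf{x}_{f'}\neq0$ iff $f,f'$ are compatible (equivalently the completion of the poset $\operatorname{FI}_\mu(\alpha)$ ordered by reverse inclusion). For $\beta\le\alpha$, $\mathfrak{B}^1_{\beta,\mu}$ is identified with the complete subalgebra generated by $\{\mathbf{x}_f:\operatorname{dom}f\subseteq\beta\}$, and $\mathfrak{B}^+$ denotes nonzero elements. Built from: a regular ultrafilter $\mathcal{D}$ on $I$, $|I|=\lambda$,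 is built from $(\mathcal{D}_0,\mathfrak{B},\mathcal{D}_* )$ if $\mathcal{D}_0$ is a regular $|I|^+$-excellent filter on $I$ (e.g. regular and good suffices), $\mathfrak{B}$ is a Boolean algebra, $\mathcal{D}_*$ an ultrafilter on $\mathfrak{B}$, and there is a surjective homomorphism $\mathbf{j}:\mathcal{P}(I)\to\mathfrak{B}$ with $\mathcal{D}_0=\mathbf{j}^{-1}(\{1\})$ and $\mathcal{D}=\{A\subseteq I:\mathbf{j}(A)\in\mathcal{D}_*\}$. Support: for $\bar{\mathbf{b}}=\langle\mathbf{b}_u:u\in[\lambda]^{<\aleph_0}\rangle$ in $\mathfrak{B}=\mathfrak{B}^1_{2^\lambda,\mu}$, a set $X\subseteq\{\mathbf{x}_f\}$ is a support if for each $u$ there is a maximal antichain of $\mathfrak{B}$ consisting of elements of $X$ each $\le\mathbf{b}_u$ or $\le1-\mathbf{b}_u$. A sequence $\langle\mathbf{b}'_u\rangle$ is multiplicative if $\mathbf{b}'_{u_1\cup u_2}=\mathbf{b}'_{u_1}\cap\mathbf{b}'_{u_2}$, and monotonic if $u\subseteq v\Rightarrow \mathbf{b}_v\le\mathbf{b}_u$. Perfect: an ultrafilter $\mathcal{D}_*$ on $\mathfrak{B}^1_{2^\lambda,\mu}$ is $(\lambda,\mu)$-perfect if (A) implies (B): (A) $\bar{\mathbf{b}}$ is a monotonic sequence of elements of $\mathcal{D}_*$ with a support $\operatorname{supp}(\bar{\mathbf{b}})$ of cardinality $\le\lambda$ such that for every $\alpha<2^\lambda$ with $\bigcup\{\operatorname{dom}f:\mathbf{x}_f\in\operatorname{supp}(\bar{\mathbf{b}})\}\subseteq\alpha$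 there is a multiplicative sequence $\langle\mathbf{b}'_u\rangle$ of elements of $\mathfrak{B}^+$ with (a) $\mathbf{b}'_u\le\mathbf{b}_u$ for all $u$ and (b) for every $\mathbf{c}\in\mathfrak{B}^+_{\alpha,\mu}\cap\mathcal{D}_*$, no intersection of finitely many members of $\{\mathbf{b}'_{\{i\}}\cup(1-\mathbf{b}_{\{i\}}):i<\lambda\}$ is disjoint from $\mathbf{c}$; (B) there is a multiplicative sequence of elements of $\mathcal{D}_*$ refining $\bar{\mathbf{b}}$ (i.e. $\mathbf{b}'_u\le\mathbf{b}_u$). Perfected: an ultrafilter $\mathcal{D}$ on $I$, $|I|=\lambda$, is $(\lambda,\mu)$-perfected if it is built from $(\mathcal{D}_0,\mathfrak{B}^1_{2^\lambda,\mu},\mathcal{D}_* )$ with $\mathcal{D}_0$ a regular filter on $I$ and $\mathcal{D}_*$ a $(\lambda,\mu)$-perfect ultrafilter. *)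

theory Defs
  imports Complex_Main "HOL-Library.Finite_Map"
begin

unbundle cardinal_syntax and lattice_syntax

section \<open>Ordinals and alephs\<close>

definition ord_plus_nat :: "'o rel \<Rightarrow> nat \<Rightarrow> ('o + nat) rel" where
  "ord_plus_nat \<alpha> l =
     {(Inl x, Inl y) | x y. (x, y) \<in> \<alpha>} \<union>
     {(Inl x, Inr j) | x j. x \<in> Field \<alpha> \<and> j < l} \<union>
     {(Inr i, Inr j) | i j. i \<le> j \<and> j < l}"

text \<open>
  Ordinals are well-orders up to isomorphism. The ordinals below a cardinal \<open>\<kappa>\<close> are the initial
  segments \<open>underS \<kappa> a\<close>; \<open>\<kappa>\<close> is \<open>\<aleph>\<^sub>\<alpha>\<close> iff the infinite cardinals among them are ordered in type \<open>\<alpha>\<close>.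
\<close>

definition infinite_cardinals_below :: "'k rel \<Rightarrow> 'k set" where
  "infinite_cardinals_below \<kappa> =
     {a \<in> Field \<kappa>. infinite (underS \<kappa> a) \<and> Card_order (Restr \<kappa> (underS \<kappa> a))}"

definition is_aleph :: "'o rel \<Rightarrow> 'k rel \<Rightarrow> bool" where
  "is_aleph \<alpha> \<kappa> \<longleftrightarrow>
     Card_order \<kappa> \<and> infinite (Field \<kappa>) \<and> Restr \<kappa> (infinite_cardinals_below \<kappa>) =o \<alpha>"


section \<open>First-order logic with one relation symbol\<close>

datatype fm =
    FBot
  | FEq nat nat
  | FRel "nat list"
  | FImp fm fm
  | FAll nat fm

abbreviation FNeg :: "fm \<Rightarrow> fm" where
  "FNeg \<phi> \<equiv> FImp \<phi> FBot"

primrec fv :: "fm \<Rightarrow> nat set" where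
  "fv FBot = {}"
| "fv (FEq x y) = {x, y}"
| "fv (FRel xs) = set xs"
| "fv (FImp \<phi> \<psi>) = fv \<phi> \<union> fv \<psi>"
| "fv (FAll x \<phi>) = fv \<phi> - {x}"

primrec in_language :: "nat \<Rightarrow> fm \<Rightarrow> bool" where
  "in_language n FBot \<longleftrightarrow> True"
| "in_language n (FEq x y) \<longleftrightarrow> True"
| "in_language n (FRel xs) \<longleftrightarrow> length xs = n"
| "in_language n (FImp \<phi> \<psi>) \<longleftrightarrow> in_language n \<phi> \<and> in_language n \<psi>"
| "in_language n (FAll x \<phi>) \<longleftrightarrow> in_language n \<phi>"

definition sentences :: "nat \<Rightarrow> fm set" where
  "sentences n = {\<phi>. in_language n \<phi> \<and> fv \<phi> = {}}"

record 'a rstruct =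
  Univ :: "'a set"
  Rel :: "'a list set"

definition is_struct :: "nat \<Rightarrow> 'a rstruct \<Rightarrow> bool" where
  "is_struct n M \<longleftrightarrow> Univ M \<noteq> {} \<and> Rel M \<subseteq> {xs. length xs = n \<and> set xs \<subseteq> Univ M}"

primrec sat :: "'a rstruct \<Rightarrow> (nat \<Rightarrow> 'a) \<Rightarrow> fm \<Rightarrow> bool" where
  "sat M e FBot \<longleftrightarrow> False"
| "sat M e (FEq x y) \<longleftrightarrow> e x = e y"
| "sat M e (FRel xs) \<longleftrightarrow> map e xs \<in> Rel M"
| "sat M e (FImp \<phi> \<psi>) \<longleftrightarrow> (sat M e \<phi> \<longrightarrow> sat M e \<psi>)"
| "sat M e (FAll x \<phi>) \<longleftrightarrow> (\<forall>a\<in>Univ M. sat M (e(x := a)) \<phi>)"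

definition models :: "nat \<Rightarrow> 'a rstruct \<Rightarrow> fm set \<Rightarrow> bool" where
  "models n M T \<longleftrightarrow> is_struct n M \<and> (\<forall>\<phi>\<in>T. \<forall>e. sat M e \<phi>)"

definition embedding :: "('a \<Rightarrow> 'b) \<Rightarrow> 'a rstruct \<Rightarrow> 'b rstruct \<Rightarrow> bool" where
  "embedding f M N \<longleftrightarrow>
     f ` Univ M \<subseteq> Univ N \<and> inj_on f (Univ M) \<and>
     (\<forall>xs. set xs \<subseteq> Univ M \<longrightarrow> (xs \<in> Rel M \<longleftrightarrow> map f xs \<in> Rel N))"

text \<open>
  \<open>T\<close> is a model completion of \<open>T\<^sub>0\<close>: models of \<open>T\<close> are models of \<open>T\<^sub>0\<close>, every model of \<open>T\<^sub>0\<close> embeds in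
  a model of \<open>T\<close>, and \<open>T\<close> together with the diagram of any model of \<open>T\<^sub>0\<close> is complete.
  A HOL definition cannot quantify over structures of all types. The language is countable, so by
  Loewenheim-Skolem and compactness it is enough to let structures range over those with universe
  contained in \<open>nat\<close>.
\<close>

definition model_completion :: "nat \<Rightarrow> fm set \<Rightarrow> fm set \<Rightarrow> bool" where
  "model_completion n T\<^sub>0 T \<longleftrightarrow>
     T \<subseteq> sentences n \<and>
     (\<forall>N :: nat rstruct. models n N T \<longrightarrow> models n N T\<^sub>0) \<and>
     (\<forall>M :: nat rstruct. models n M T\<^sub>0 \<longrightarrow>
        (\<exists>(N :: nat rstruct) f. models n N T \<and> embedding f M N)) \<and>
     (\<forall>(M :: nat rstruct) (N\<^sub>1 :: nat rstruct) (N\<^sub>2 :: nat rstruct) f\<^sub>1 f\<^sub>2.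
        models n M T\<^sub>0 \<and> models n N\<^sub>1 T \<and> models n N\<^sub>2 T \<and> embedding f\<^sub>1 M N\<^sub>1 \<and> embedding f\<^sub>2 M N\<^sub>2 \<longrightarrow>
        (\<forall>\<phi> e. in_language n \<phi> \<and> (\<forall>x\<in>fv \<phi>. e x \<in> Univ M) \<longrightarrow>
           (sat N\<^sub>1 (f\<^sub>1 \<circ> e) \<phi> \<longleftrightarrow> sat N\<^sub>2 (f\<^sub>2 \<circ> e) \<phi>)))"

text \<open>
  The variable \<open>0\<close> is the variable of the type; an environment \<open>e\<close> supplies the parameters, i.e. the
  values of the remaining free variables.
\<close>

definition param_formulas :: "nat \<Rightarrow> 'a set \<Rightarrow> (fm \<times> (nat \<Rightarrow> 'a)) set" where
  "param_formulas n A = {(\<phi>, e). in_language n \<phi> \<and> (\<forall>x\<in>fv \<phi> - {0}. e x \<in> A)}"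

definition realizes :: "'a rstruct \<Rightarrow> 'a \<Rightarrow> (fm \<times> (nat \<Rightarrow> 'a)) set \<Rightarrow> bool" where
  "realizes M b p \<longleftrightarrow> (\<forall>(\<phi>, e)\<in>p. sat M (e(0 := b)) \<phi>)"

definition saturated :: "nat \<Rightarrow> 'k rel \<Rightarrow> 'a rstruct \<Rightarrow> bool" where
  "saturated n \<kappa> M \<longleftrightarrow>
     (\<forall>A p. A \<subseteq> Univ M \<and> |A| <o \<kappa> \<and> p \<subseteq> param_formulas n A \<and>
        (\<forall>q\<subseteq>p. finite q \<longrightarrow> (\<exists>b\<in>Univ M. realizes M b q)) \<longrightarrow>
        (\<exists>b\<in>Univ M. realizes M b p))"


section \<open>Hypergraphs\<close>

definition forall_closure :: "nat list \<Rightarrow> fm \<Rightarrow> fm" where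
  "forall_closure xs \<phi> = foldr FAll xs \<phi>"

definition hypergraph_theory :: "nat \<Rightarrow> nat \<Rightarrow> fm set" where
  "hypergraph_theory m k =
     {forall_closure [0..<k+1] (FImp (FRel [0..<k+1]) (FNeg (FEq i j))) | i j. i < j \<and> j < k+1} \<union>
     {forall_closure [0..<k+1] (FImp (FRel [0..<k+1]) (FRel (map p [0..<k+1]))) | p.
        bij_betw p {..<k+1} {..<k+1}} \<union>
     {forall_closure [0..<m+1]
        (foldr FImp
           ([FNeg (FEq i j). j \<leftarrow> [0..<m+1], i \<leftarrow> [0..<j]] @
            [FRel w. w \<leftarrow> subseqs [0..<m+1], length w = k+1])
           FBot)}"

text \<open>
  \<open>T\<^bsub>m,k\<^esub>\<close> is determined up to logical equivalence; this says that \<open>T\<close> is an axiomatization of it.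
\<close>

definition axiomatizes_Tmk :: "nat \<Rightarrow> nat \<Rightarrow> fm set \<Rightarrow> bool" where
  "axiomatizes_Tmk m k T \<longleftrightarrow> model_completion (k+1) (hypergraph_theory m k) T"


section \<open>Filters on a set and ultrapowers\<close>

definition ultrafilter :: "'i filter \<Rightarrow> bool" where
  "ultrafilter D \<longleftrightarrow>
     D \<noteq> bot \<and> (\<forall>P. eventually P D \<or> eventually (\<lambda>t. \<not> P t) D)"

text \<open>
  For a filter on the index set \<open>I = UNIV :: 'i set\<close>, the cardinal \<open>\<lambda> = |I|\<close> used to index
  families in regularity, goodness and excellence is represented by \<open>I\<close> itself.
\<close>

definition regular_filter :: "'i filter \<Rightarrow> bool" where
  "regular_filter D \<longleftrightarrow>
     (\<exists>X :: 'i \<Rightarrow> 'i set. (\<forall>i. eventually (\<lambda>t. t \<in> X i) D) \<and>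
        (\<forall>S. infinite S \<longrightarrow> (\<Inter>i\<in>S. X i) = {}))"

datatype 'v bterm =
    BVar 'v
  | BNot "'v bterm"
  | BAnd "'v bterm" "'v bterm"

primrec beval :: "('v \<Rightarrow> 'b::boolean_algebra) \<Rightarrow> 'v bterm \<Rightarrow> 'b" where
  "beval a (BVar v) = a v"
| "beval a (BNot s) = - beval a s"
| "beval a (BAnd s t) = beval a s \<sqinter> beval a t"

text \<open>
  The Boolean terms in the variables \<open>x\<^sub>v\<close>, \<open>v \<subseteq> u\<close>, which vanish modulo \<open>D\<close> at \<open>A\<close> and at all its
  truncations: for \<open>w \<subseteq> u\<close>, the term must vanish modulo \<open>D\<close> also when the variables \<open>x\<^sub>v\<close> with
  \<open>v\<close> not contained in \<open>w\<close> are replaced by \<open>0\<close>, and it must vanish at \<open>0\<close>.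
  Without the conditions on truncations no regular filter on an infinite set would be excellent.
\<close>

definition vanishing_terms :: "'i filter \<Rightarrow> ('i set \<Rightarrow> 'i set) \<Rightarrow> 'i set \<Rightarrow> 'i set bterm set" where
  "vanishing_terms D A u =
     {s. set_bterm s \<subseteq> Pow u \<and> beval (\<lambda>_. {}) s = ({} :: 'i set) \<and>
        (\<forall>w\<subseteq>u. eventually (\<lambda>t. t \<notin> beval (\<lambda>v. if v \<subseteq> w then A v else {}) s) D)}"

definition excellent_filter :: "'i filter \<Rightarrow> bool" where
  "excellent_filter D \<longleftrightarrow>
     (\<forall>A :: 'i set \<Rightarrow> 'i set. \<exists>B :: 'i set \<Rightarrow> 'i set.
        (\<forall>u. finite u \<longrightarrow> B u \<subseteq> A u \<and> eventually (\<lambda>t. t \<in> B u \<longleftrightarrow> t \<in> A u) D) \<and>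
        (\<forall>u. finite u \<longrightarrow> (\<forall>s\<in>vanishing_terms D A u. beval B s = {})))"

text \<open>Sequences indexed by \<open>[\<lambda>]\<^bsup><\<aleph>\<^sub>0\<^esup>\<close> are functions on sets, of which only the values at finite sets matter.\<close>

definition multiplicative :: "('l set \<Rightarrow> 'b::boolean_algebra) \<Rightarrow> bool" where
  "multiplicative b \<longleftrightarrow> (\<forall>u v. finite u \<and> finite v \<longrightarrow> b (u \<union> v) = b u \<sqinter> b v)"

definition monotonic :: "('l set \<Rightarrow> 'b::boolean_algebra) \<Rightarrow> bool" where
  "monotonic b \<longleftrightarrow> (\<forall>u v. finite v \<and> u \<subseteq> v \<longrightarrow> b v \<le> b u)"

definition good_filter :: "'i filter \<Rightarrow> bool" where
  "good_filter D \<longleftrightarrow>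
     (\<forall>A :: 'i set \<Rightarrow> 'i set.
        monotonic A \<and> (\<forall>u. finite u \<longrightarrow> eventually (\<lambda>t. t \<in> A u) D) \<longrightarrow>
        (\<exists>B. multiplicative B \<and> (\<forall>u. finite u \<longrightarrow> B u \<subseteq> A u \<and> eventually (\<lambda>t. t \<in> B u) D)))"

lemma beval_local:
  "(\<And>v. v \<in> set_bterm s \<Longrightarrow> t \<in> A v \<longleftrightarrow> t' \<in> A' v) \<Longrightarrow> t \<in> beval A s \<longleftrightarrow> t' \<in> beval A' s"
  by (induction s) auto

lemma excellent_imp_good:
  assumes ex: "excellent_filter (D :: 'i filter)"
  shows "good_filter D"
  unfolding good_filter_def
proof (intro allI impI, elim conjE)
  fix A :: "'i set \<Rightarrow> 'i set"
  assume A: "\<forall>u. finite u \<longrightarrow> eventually (\<lambda>t. t \<in> A u) D"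
  from ex have "\<exists>B :: 'i set \<Rightarrow> 'i set.
        (\<forall>u. finite u \<longrightarrow> B u \<subseteq> A u \<and> eventually (\<lambda>t. t \<in> B u \<longleftrightarrow> t \<in> A u) D) \<and>
        (\<forall>u. finite u \<longrightarrow> (\<forall>s\<in>vanishing_terms D A u. beval B s = {}))"
    unfolding excellent_filter_def by (rule spec)
  then obtain B where B: "\<forall>u. finite u \<longrightarrow> B u \<subseteq> A u \<and> eventually (\<lambda>t. t \<in> B u \<longleftrightarrow> t \<in> A u) D"
    and van: "\<forall>u. finite u \<longrightarrow> (\<forall>s\<in>vanishing_terms D A u. beval B s = {})"
    by (elim exE conjE)
  have "B (u \<union> v) = B u \<sqinter> B v" if fin: "finite u" "finite v" for u v
  proof -
    have fin': "finite (u \<union> v)"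
      using fin by simp
    let ?s = "BAnd (BAnd (BVar u) (BVar v)) (BNot (BVar (u \<union> v)))"
    let ?r = "BAnd (BVar (u \<union> v)) (BNot (BAnd (BVar u) (BVar v)))"
    let ?A = "\<lambda>w x. if x \<subseteq> w then A x else {}"
    have ev: "eventually (\<lambda>t. t \<in> A u \<and> t \<in> A v \<and> t \<in> A (u \<union> v)) D"
      using A fin fin' by (intro eventually_conj) simp_all
    have "eventually (\<lambda>t. t \<notin> beval (?A w) ?s) D" "eventually (\<lambda>t. t \<notin> beval (?A w) ?r) D" for w
      by (rule eventually_mono[OF ev], simp)+
    then have "?s \<in> vanishing_terms D A (u \<union> v)" "?r \<in> vanishing_terms D A (u \<union> v)"
      by (simp_all add: vanishing_terms_def)
    then have "beval B ?s = {}" "beval B ?r = {}"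
      using van[rule_format, OF fin'] by blast+
    then show ?thesis
      by auto
  qed
  moreover have "eventually (\<lambda>t. t \<in> B u) D" if fin: "finite u" for u
  proof -
    have "eventually (\<lambda>t. t \<in> A u) D" "eventually (\<lambda>t. t \<in> B u \<longleftrightarrow> t \<in> A u) D"
      using A B fin by simp_all
    then show ?thesis
      by (rule eventually_elim2) simp
  qed
  ultimately show "\<exists>B. multiplicative B \<and> (\<forall>u. finite u \<longrightarrow> B u \<subseteq> A u \<and> eventually (\<lambda>t. t \<in> B u) D)"
    using B by (intro exI[of _ B]) (simp add: multiplicative_def)
qed

lemma good_imp_excellent:
  assumes good: "good_filter (D :: 'i filter)"
  shows "excellent_filter D"
  unfolding excellent_filter_def
proof
  fix A :: "'i set \<Rightarrow> 'i set"
  define C where "C u = {t. \<forall>u'\<subseteq>u. \<forall>s\<in>vanishing_terms D A u'. t \<notin> beval A s}" for u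
  have evC: "eventually (\<lambda>t. t \<in> C u) D" if fin: "finite u" for u
  proof -
    let ?P = "\<lambda>t. {v. v \<subseteq> u \<and> t \<in> A v}"
    have "eventually (\<lambda>t. ?P t = S \<longrightarrow> t \<in> C u) D" for S
    proof (cases "\<exists>t0. ?P t0 = S \<and> t0 \<notin> C u")
      case True
      then obtain t0 where t0: "?P t0 = S" "t0 \<notin> C u"
        by (elim exE conjE)
      then obtain u' s where s: "u' \<subseteq> u" "s \<in> vanishing_terms D A u'" "t0 \<in> beval A s"
        unfolding C_def mem_Collect_eq by blast
      have su: "set_bterm s \<subseteq> Pow u'"
        and ev: "eventually (\<lambda>t. t \<notin> beval (\<lambda>v. if v \<subseteq> u' then A v else {}) s) D"
        using s(2) by (simp_all add: vanishing_terms_def)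
      from ev show ?thesis
      proof (rule eventually_mono, intro impI)
        fix t assume 1: "t \<notin> beval (\<lambda>v. if v \<subseteq> u' then A v else {}) s" and 2: "?P t = S"
        have "t \<in> beval (\<lambda>v. if v \<subseteq> u' then A v else {}) s \<longleftrightarrow> t0 \<in> beval A s"
        proof (rule beval_local)
          fix v assume "v \<in> set_bterm s"
          then have v: "v \<subseteq> u'" "v \<subseteq> u"
            using su s(1) by blast+
          have "v \<in> ?P t \<longleftrightarrow> v \<in> ?P t0"
            using 2 t0(1) by simp
          then show "t \<in> (if v \<subseteq> u' then A v else {}) \<longleftrightarrow> t0 \<in> A v"
            using v by simp
        qed
        then show "t \<in> C u"
          using 1 s(3) by blast
      qed
    next
      case False
      then show ?thesis
        by (intro always_eventually) blast
    qed
    then have "eventually (\<lambda>t. \<forall>S\<in>Pow (Pow u). ?P t = S \<longrightarrow> t \<in> C u) D"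
      using fin by (intro eventually_ball_finite) simp_all
    then show ?thesis
      by (rule eventually_mono) blast
  qed
  have "monotonic C"
    unfolding monotonic_def C_def by blast
  with good evC have "\<exists>B. multiplicative B \<and> (\<forall>u. finite u \<longrightarrow> B u \<subseteq> C u \<and> eventually (\<lambda>t. t \<in> B u) D)"
    by (simp add: good_filter_def)
  then obtain C' where mul: "multiplicative C'"
    and C': "\<forall>u. finite u \<longrightarrow> C' u \<subseteq> C u \<and> eventually (\<lambda>t. t \<in> C' u) D"
    by (elim exE conjE)
  have mulD: "C' (u \<union> v) = C' u \<inter> C' v" if "finite u" "finite v" for u v
    using mul that by (simp add: multiplicative_def)
  have mon: "C' v \<subseteq> C' u" if "finite v" "u \<subseteq> v" for u v
    using mulD[of u v] that finite_subset[OF that(2,1)] by (metis Int_lower1 Un_absorb1)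
  have sub: "t \<in> C' v" if "finite v" "t \<in> C' {}" "\<forall>i\<in>v. t \<in> C' {i}" for t v
    using that
  proof (induction v rule: finite_induct)
    case (insert i v)
    then show ?case
      using mulD[of "{i}" v] by simp
  qed simp
  let ?B = "\<lambda>u. A u \<inter> C' u"
  have van: "t \<notin> beval ?B s" if u: "finite u" and s: "s \<in> vanishing_terms D A u" for u s t
  proof (cases "t \<in> C' {}")
    case False
    have su: "set_bterm s \<subseteq> Pow u" and s0: "beval (\<lambda>_. {}) s = ({} :: 'i set)"
      using s by (simp_all add: vanishing_terms_def)
    have "t \<in> beval ?B s \<longleftrightarrow> t \<in> beval (\<lambda>_. {}) s"
    proof (rule beval_local)
      fix v assume "v \<in> set_bterm s"
      then have "finite v"
        using su u finite_subset by blast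
      then show "t \<in> ?B v \<longleftrightarrow> t \<in> {}"
        using mon[of v "{}"] False by blast
    qed
    then show ?thesis
      using s0 by simp
  next
    case True
    have su: "set_bterm s \<subseteq> Pow u"
      using s by (simp add: vanishing_terms_def)
    define w where "w = {i \<in> u. t \<in> C' {i}}"
    have w: "finite w" "w \<subseteq> u"
      using u by (simp_all add: w_def)
    have iff: "t \<in> C' v \<longleftrightarrow> v \<subseteq> w" if "v \<subseteq> u" for v
    proof
      assume "t \<in> C' v"
      show "v \<subseteq> w"
      proof
        fix i assume "i \<in> v"
        then show "i \<in> w"
          using mon[of v "{i}"] \<open>t \<in> C' v\<close> that finite_subset[OF that u] by (auto simp: w_def)
      qed
    next
      assume "v \<subseteq> w"
      then show "t \<in> C' v"
        using sub[OF finite_subset[OF that u] True] by (auto simp: w_def)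
    qed
    define cut where "cut v = (if v \<subseteq> w then BVar v else BAnd (BVar {}) (BNot (BVar ({} :: 'i set))))" for v
    let ?cut = "rec_bterm cut (\<lambda>_. BNot) (\<lambda>_ _. BAnd)"
    let ?r = "?cut s"
    have ev: "beval a (?cut q) = beval (\<lambda>v. if v \<subseteq> w then a v else {}) q"
      for a :: "'i set \<Rightarrow> 'i set" and q
      by (induction q) (simp_all add: cut_def)
    have vars: "set_bterm (?cut q) \<subseteq> Pow w" for q
      by (induction q) (simp_all add: cut_def)
    have "?r \<in> vanishing_terms D A w"
      unfolding vanishing_terms_def
    proof (intro CollectI conjI allI impI)
      show "set_bterm ?r \<subseteq> Pow w"
        by (rule vars)
      show "beval (\<lambda>_. {}) ?r = ({} :: 'i set)"
        using s unfolding ev by (simp add: vanishing_terms_def)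
      fix w' assume w': "w' \<subseteq> w"
      have eq: "(\<lambda>v. if v \<subseteq> w then if v \<subseteq> w' then A v else {} else {}) =
          (\<lambda>v. if v \<subseteq> w' then A v else {})"
        using w' by (intro ext) auto
      have "w' \<subseteq> u"
        using w' w(2) by (rule subset_trans)
      then show "eventually (\<lambda>t. t \<notin> beval (\<lambda>v. if v \<subseteq> w' then A v else {}) ?r) D"
        using s unfolding ev eq by (simp add: vanishing_terms_def)
    qed
    moreover have "t \<in> C w"
      using C' w iff[of w] by blast
    ultimately have "t \<notin> beval A ?r"
      unfolding C_def by blast
    moreover have "t \<in> beval ?B s \<longleftrightarrow> t \<in> beval (\<lambda>v. if v \<subseteq> w then A v else {}) s"
    proof (rule beval_local)
      fix v assume "v \<in> set_bterm s"
      then have "v \<subseteq> u"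
        using su by blast
      then show "t \<in> ?B v \<longleftrightarrow> t \<in> (if v \<subseteq> w then A v else {})"
        using iff[of v] by simp
    qed
    ultimately show ?thesis
      unfolding ev by simp
  qed
  have "eventually (\<lambda>t. t \<in> ?B u \<longleftrightarrow> t \<in> A u) D" if fin: "finite u" for u
  proof -
    have "eventually (\<lambda>t. t \<in> C' u) D"
      using C' fin by simp
    then show ?thesis
      by (rule eventually_mono) simp
  qed
  then show "\<exists>B. (\<forall>u. finite u \<longrightarrow> B u \<subseteq> A u \<and> eventually (\<lambda>t. t \<in> B u \<longleftrightarrow> t \<in> A u) D) \<and>
      (\<forall>u. finite u \<longrightarrow> (\<forall>s\<in>vanishing_terms D A u. beval B s = {}))"
    using van by (intro exI[of _ ?B] conjI allI impI ballI equals0I) auto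
qed

lemma excellent_iff_good: "excellent_filter D \<longleftrightarrow> good_filter D"
  using excellent_imp_good good_imp_excellent by blast

definition ultrapower :: "'i filter \<Rightarrow> 'a rstruct \<Rightarrow> ('i \<Rightarrow> 'a) set rstruct" where
  "ultrapower D M =
     (let F = {f. \<forall>t. f t \<in> Univ M};
          E = {(f, g). f \<in> F \<and> g \<in> F \<and> eventually (\<lambda>t. f t = g t) D}
      in \<lparr> Univ = F // E,
           Rel = {map (\<lambda>f. E `` {f}) fs | fs.
                    set fs \<subseteq> F \<and> eventually (\<lambda>t. map (\<lambda>f. f t) fs \<in> Rel M) D} \<rparr>)"


section \<open>The completion of the poset of finite partial functions\<close>

text \<open>
  The poset of finite partial functions from \<open>'d\<close> to \<open>'m\<close>, where a larger function is a stronger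
  condition. Its completion is the algebra of regular open sets, i.e. of the sets \<open>U\<close> with
  \<open>perp (perp U) = U\<close>, ordered by inclusion.
\<close>

definition compatible :: "('d, 'm) fmap \<Rightarrow> ('d, 'm) fmap \<Rightarrow> bool" where
  "compatible f g \<longleftrightarrow> (\<exists>h. f \<subseteq>\<^sub>f h \<and> g \<subseteq>\<^sub>f h)"

definition perp :: "('d, 'm) fmap set \<Rightarrow> ('d, 'm) fmap set" where
  "perp U = {f. \<forall>g\<in>U. \<not> compatible f g}"

lemma fmsubset_refl: "f \<subseteq>\<^sub>f f"
  by (simp add: fmsubset.rep_eq)

lemma fmsubset_trans: "f \<subseteq>\<^sub>f g \<Longrightarrow> g \<subseteq>\<^sub>f h \<Longrightarrow> f \<subseteq>\<^sub>f h"
  by (metis fmsubset.rep_eq map_le_trans)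

lemma compatible_refl: "compatible f f"
  unfolding compatible_def using fmsubset_refl by blast

lemma compatible_sym: "compatible f g \<Longrightarrow> compatible g f"
  unfolding compatible_def by blast

lemma compatible_mono: "f \<subseteq>\<^sub>f g \<Longrightarrow> compatible g h \<Longrightarrow> compatible f h"
  unfolding compatible_def using fmsubset_trans by blast

lemma perp_antimono: "U \<subseteq> V \<Longrightarrow> perp V \<subseteq> perp U"
  by (auto simp: perp_def)

lemma perp_perp_ge: "U \<subseteq> perp (perp U)"
  by (auto simp: perp_def dest: compatible_sym)

lemma perp_perp_perp [simp]: "perp (perp (perp U)) = perp U"
  by (simp add: perp_antimono perp_perp_ge subset_antisym)

lemma perp_disjoint: "U \<inter> perp U = {}"
  using compatible_refl by (auto simp: perp_def)

lemma perp_empty [simp]: "perp {} = UNIV"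
  by (simp add: perp_def)

lemma perp_UNIV [simp]: "perp UNIV = {}"
  using perp_disjoint[of UNIV] by simp

lemma perp_Un: "perp (U \<union> V) = perp U \<inter> perp V"
  by (auto simp: perp_def)

lemma perp_UN: "perp (\<Union>S) = (\<Inter>U\<in>S. perp U)"
  by (auto simp: perp_def)

lemma perp_upward: "f \<in> perp U \<Longrightarrow> f \<subseteq>\<^sub>f g \<Longrightarrow> g \<in> perp U"
  unfolding perp_def using compatible_mono by blast

typedef ('d, 'm) B1 = "{U :: ('d, 'm) fmap set. perp (perp U) = U}"
  by (rule exI[of _ UNIV]) simp

lemma Rep_B1_regular [simp]: "perp (perp (Rep_B1 b)) = Rep_B1 b"
  using Rep_B1 by blast

lemma Rep_Abs_B1: "perp (perp U) = U \<Longrightarrow> Rep_B1 (Abs_B1 U) = U"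
  by (simp add: Abs_B1_inverse)

lemma regular_Inter:
  assumes "\<And>U. U \<in> S \<Longrightarrow> perp (perp U) = U"
  shows "perp (perp (\<Inter>S)) = \<Inter>S"
proof -
  have "\<Inter>S = perp (\<Union>(perp ` S))"
    using assms by (simp add: perp_UN)
  then show ?thesis
    by simp
qed

lemma regular_Int:
  "perp (perp U) = U \<Longrightarrow> perp (perp V) = V \<Longrightarrow> perp (perp (U \<inter> V)) = U \<inter> V"
  using regular_Inter[of "{U, V}"] by auto

lemma regular_distrib:
  assumes X: "perp (perp X) = X" and Y: "perp (perp Y) = Y" and Z: "perp (perp Z) = Z"
  shows "perp (perp (X \<union> Y)) \<inter> perp (perp (X \<union> Z)) \<subseteq> perp (perp (X \<union> Y \<inter> Z))"
proof
  have up: "h \<in> U" if "perp (perp U) = U" "g \<in> U" "g \<subseteq>\<^sub>f h"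
    for g h and U :: "('d, 'm) fmap set"
    using that perp_upward by metis
  fix f assume f: "f \<in> perp (perp (X \<union> Y)) \<inter> perp (perp (X \<union> Z))"
  show "f \<in> perp (perp (X \<union> Y \<inter> Z))"
    unfolding perp_def[of "perp _"]
  proof (safe)
    fix g assume g: "g \<in> perp (X \<union> Y \<inter> Z)" and "compatible f g"
    then obtain h where h: "f \<subseteq>\<^sub>f h" "g \<subseteq>\<^sub>f h"
      by (auto simp: compatible_def)
    have hX: "h \<in> perp X" and hYZ: "h \<in> perp (Y \<inter> Z)"
      using perp_upward[OF g h(2)] by (auto simp: perp_Un)
    have hs: "h \<in> perp (perp (X \<union> Y))" "h \<in> perp (perp (X \<union> Z))"
      using f h(1) perp_upward by blast+
    have "h \<notin> perp Y"
      using hs(1) hX perp_disjoint[of "perp (X \<union> Y)"] by (auto simp: perp_Un)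
    then obtain y where y: "y \<in> Y" "compatible h y"
      by (auto simp: perp_def)
    then obtain q where q: "h \<subseteq>\<^sub>f q" "y \<subseteq>\<^sub>f q"
      by (auto simp: compatible_def)
    have "q \<in> Y" "q \<in> perp X" "q \<in> perp (perp (X \<union> Z))"
      using up[OF Y y(1) q(2)] perp_upward[OF hX q(1)] perp_upward[OF hs(2) q(1)] by auto
    then have "q \<notin> perp Z"
      using perp_disjoint[of "perp (X \<union> Z)"] by (auto simp: perp_Un)
    then obtain z where z: "z \<in> Z" "compatible q z"
      by (auto simp: perp_def)
    then obtain r where r: "q \<subseteq>\<^sub>f r" "z \<subseteq>\<^sub>f r"
      by (auto simp: compatible_def)
    have "r \<in> Y" "r \<in> Z" "r \<in> perp (Y \<inter> Z)"
      using up[OF Y \<open>q \<in> Y\<close> r(1)] up[OF Z z(1) r(2)] perp_upward[OF hYZ fmsubset_trans[OF q(1) r(1)]]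
      by auto
    then show False
      using perp_disjoint[of "Y \<inter> Z"] by auto
  qed
qed

instantiation B1 :: (type, type) boolean_algebra
begin

definition less_eq_B1 :: "('a, 'b) B1 \<Rightarrow> ('a, 'b) B1 \<Rightarrow> bool" where
  "x \<le> y \<longleftrightarrow> Rep_B1 x \<subseteq> Rep_B1 y"
definition less_B1 :: "('a, 'b) B1 \<Rightarrow> ('a, 'b) B1 \<Rightarrow> bool" where
  "x < y \<longleftrightarrow> Rep_B1 x \<subset> Rep_B1 y"
definition bot_B1 :: "('a, 'b) B1" where
  "bot = Abs_B1 {}"
definition top_B1 :: "('a, 'b) B1" where
  "top = Abs_B1 UNIV"
definition inf_B1 :: "('a, 'b) B1 \<Rightarrow> ('a, 'b) B1 \<Rightarrow> ('a, 'b) B1" where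
  "x \<sqinter> y = Abs_B1 (Rep_B1 x \<inter> Rep_B1 y)"
definition sup_B1 :: "('a, 'b) B1 \<Rightarrow> ('a, 'b) B1 \<Rightarrow> ('a, 'b) B1" where
  "x \<squnion> y = Abs_B1 (perp (perp (Rep_B1 x \<union> Rep_B1 y)))"
definition uminus_B1 :: "('a, 'b) B1 \<Rightarrow> ('a, 'b) B1" where
  "- x = Abs_B1 (perp (Rep_B1 x))"
definition minus_B1 :: "('a, 'b) B1 \<Rightarrow> ('a, 'b) B1 \<Rightarrow> ('a, 'b) B1" where
  "x - y = x \<sqinter> - (y :: ('a, 'b) B1)"

lemma Rep_B1_simps [simp]:
  "Rep_B1 (bot :: ('a, 'b) B1) = {}" "Rep_B1 (top :: ('a, 'b) B1) = UNIV"
  "Rep_B1 (x \<sqinter> y) = Rep_B1 x \<inter> Rep_B1 y" "Rep_B1 (x \<squnion> y) = perp (perp (Rep_B1 x \<union> Rep_B1 y))"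
  "Rep_B1 (- x) = perp (Rep_B1 x)"
  for x y :: "('a, 'b) B1"
  by (simp_all add: bot_B1_def top_B1_def inf_B1_def sup_B1_def uminus_B1_def Rep_Abs_B1 regular_Int)

instance
proof
  fix x y z :: "('a, 'b) B1"
  show "(x < y) = (x \<le> y \<and> \<not> y \<le> x)"
    by (auto simp: less_eq_B1_def less_B1_def)
  show "x \<le> x"
    by (simp add: less_eq_B1_def)
  show "x \<le> y \<Longrightarrow> y \<le> z \<Longrightarrow> x \<le> z"
    by (auto simp: less_eq_B1_def)
  show "x \<le> y \<Longrightarrow> y \<le> x \<Longrightarrow> x = y"
    by (auto simp: less_eq_B1_def simp flip: Rep_B1_inject)
  show "x \<sqinter> y \<le> x" "x \<sqinter> y \<le> y"
    by (auto simp: less_eq_B1_def)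
  show "x \<le> y \<Longrightarrow> x \<le> z \<Longrightarrow> x \<le> y \<sqinter> z"
    by (auto simp: less_eq_B1_def)
  show "x \<le> x \<squnion> y" "y \<le> x \<squnion> y"
    using perp_perp_ge[of "Rep_B1 x \<union> Rep_B1 y"] by (auto simp: less_eq_B1_def)
  show "y \<le> x \<Longrightarrow> z \<le> x \<Longrightarrow> y \<squnion> z \<le> x"
    using perp_antimono[OF perp_antimono, of "Rep_B1 y \<union> Rep_B1 z" "Rep_B1 x"]
    by (simp add: less_eq_B1_def)
  show "bot \<le> x" "x \<le> top"
    by (simp_all add: less_eq_B1_def)
  show "x \<squnion> y \<sqinter> z = (x \<squnion> y) \<sqinter> (x \<squnion> z)"
  proof -
    have "perp (perp (X \<union> Y \<inter> Z)) \<subseteq> perp (perp (X \<union> Y)) \<inter> perp (perp (X \<union> Z))"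
      for X Y Z :: "('a, 'b) fmap set"
      by (intro Int_greatest perp_antimono) auto
    then show ?thesis
      using regular_distrib[of "Rep_B1 x" "Rep_B1 y" "Rep_B1 z"]
      by (simp add: subset_antisym flip: Rep_B1_inject)
  qed
  show "x \<sqinter> - x = bot"
    by (simp add: perp_disjoint flip: Rep_B1_inject)
  show "x \<squnion> - x = top"
    by (simp add: perp_Un perp_disjoint Int_commute flip: Rep_B1_inject)
  show "x - y = x \<sqinter> - y"
    by (rule minus_B1_def)
qed

end

text \<open>
  The algebra is not an instance of \<^class>\<open>complete_boolean_algebra\<close>, which demands complete
  distributivity.
\<close>

instantiation B1 :: (type, type) complete_lattice
begin

definition Inf_B1 :: "('a, 'b) B1 set \<Rightarrow> ('a, 'b) B1" where
  "Inf S = Abs_B1 (\<Inter>(Rep_B1 ` S))"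
definition Sup_B1 :: "('a, 'b) B1 set \<Rightarrow> ('a, 'b) B1" where
  "Sup S = Abs_B1 (perp (perp (\<Union>(Rep_B1 ` S))))"

lemma Rep_B1_Inf_Sup [simp]:
  "Rep_B1 (Inf S) = \<Inter>(Rep_B1 ` S)" "Rep_B1 (Sup S) = perp (perp (\<Union>(Rep_B1 ` S)))"
  for S :: "('a, 'b) B1 set"
proof -
  have "perp (perp (\<Inter>(Rep_B1 ` S))) = \<Inter>(Rep_B1 ` S)"
    by (rule regular_Inter) auto
  then show "Rep_B1 (Inf S) = \<Inter>(Rep_B1 ` S)"
    by (simp add: Inf_B1_def Rep_Abs_B1)
qed (simp add: Sup_B1_def Rep_Abs_B1)

instance
proof
  fix x z :: "('a, 'b) B1" and A :: "('a, 'b) B1 set"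
  show "x \<in> A \<Longrightarrow> Inf A \<le> x"
    by (auto simp: less_eq_B1_def)
  show "(\<And>x. x \<in> A \<Longrightarrow> z \<le> x) \<Longrightarrow> z \<le> Inf A"
    by (auto simp: less_eq_B1_def)
  show "x \<in> A \<Longrightarrow> x \<le> Sup A"
    using perp_perp_ge[of "\<Union>(Rep_B1 ` A)"] by (auto simp: less_eq_B1_def)
  show "Sup A \<le> z" if "\<And>x. x \<in> A \<Longrightarrow> x \<le> z"
  proof -
    have "\<Union>(Rep_B1 ` A) \<subseteq> Rep_B1 z"
      using that by (auto simp: less_eq_B1_def)
    then show ?thesis
      using perp_antimono[OF perp_antimono, of "\<Union>(Rep_B1 ` A)" "Rep_B1 z"]
      by (simp add: less_eq_B1_def)
  qed
  show "Inf {} = (top :: ('a, 'b) B1)" "Sup {} = (bot :: ('a, 'b) B1)"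
    by (simp_all flip: Rep_B1_inject)
qed

end

text \<open>The element \<open>\<^bold>x\<^sub>f\<close>, the image of the condition \<open>f\<close> in the completion.\<close>

definition gen :: "('d, 'm) fmap \<Rightarrow> ('d, 'm) B1" where
  "gen f = Abs_B1 (perp (perp {f}))"

lemma Rep_B1_gen [simp]: "Rep_B1 (gen f) = perp (perp {f})"
  by (simp add: gen_def Rep_Abs_B1)

lemma gen_le_iff: "gen f \<le> b \<longleftrightarrow> f \<in> Rep_B1 b"
proof
  show "f \<in> Rep_B1 b" if "gen f \<le> b"
    using that perp_perp_ge[of "{f}"] by (auto simp: less_eq_B1_def)
  show "gen f \<le> b" if "f \<in> Rep_B1 b"
    using that perp_antimono[OF perp_antimono, of "{f}" "Rep_B1 b"] by (simp add: less_eq_B1_def)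
qed

lemma gen_antimono: "f \<subseteq>\<^sub>f g \<Longrightarrow> gen g \<le> gen f"
  using perp_upward[of f "perp {f}" g] perp_perp_ge[of "{f}"] by (simp add: gen_le_iff)

lemma gen_nonzero: "gen f \<noteq> bot"
  using perp_perp_ge[of "{f}"] by (auto simp flip: Rep_B1_inject)

lemma gen_dense: "b \<noteq> bot \<Longrightarrow> \<exists>f. gen f \<le> b"
  by (auto simp: gen_le_iff simp flip: Rep_B1_inject)

lemma gen_inf_nonzero_iff: "gen f \<sqinter> gen g \<noteq> bot \<longleftrightarrow> compatible f g"
proof
  assume "compatible f g"
  then obtain h where "f \<subseteq>\<^sub>f h" "g \<subseteq>\<^sub>f h"
    by (auto simp: compatible_def)
  then have "gen h \<le> gen f \<sqinter> gen g"
    by (simp add: gen_antimono)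
  then show "gen f \<sqinter> gen g \<noteq> bot"
    using gen_nonzero[of h] by (metis bot_unique)
next
  assume "gen f \<sqinter> gen g \<noteq> bot"
  then obtain h where h: "h \<in> perp (perp {f})" "h \<in> perp (perp {g})"
    using gen_dense[of "gen f \<sqinter> gen g"] by (auto simp: gen_le_iff)
  then have "h \<notin> perp {f}"
    using perp_disjoint[of "perp {f}"] by auto
  then obtain h' where h': "h \<subseteq>\<^sub>f h'" "f \<subseteq>\<^sub>f h'"
    by (auto simp: perp_def compatible_def)
  then have "h' \<notin> perp {g}"
    using perp_upward[OF h(2) h'(1)] perp_disjoint[of "perp {g}"] by auto
  then have "compatible h' g"
    by (auto simp: perp_def)
  with h'(2) show "compatible f g"
    using compatible_mono by blast
qed

definition complete_subalgebra :: "'b::{boolean_algebra, complete_lattice} set \<Rightarrow> bool" where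
  "complete_subalgebra C \<longleftrightarrow>
     (\<forall>x\<in>C. - x \<in> C) \<and> (\<forall>S\<subseteq>C. Sup S \<in> C \<and> Inf S \<in> C)"

definition subalgebra_on :: "'d set \<Rightarrow> ('d, 'm) B1 set" where
  "subalgebra_on \<beta> = complete_subalgebra hull {gen f | f. fmdom' f \<subseteq> \<beta>}"


section \<open>Perfected ultrafilters\<close>

definition ba_ultrafilter :: "'b::boolean_algebra set \<Rightarrow> bool" where
  "ba_ultrafilter U \<longleftrightarrow>
     top \<in> U \<and> bot \<notin> U \<and>
     (\<forall>x y. x \<in> U \<and> x \<le> y \<longrightarrow> y \<in> U) \<and>
     (\<forall>x y. x \<in> U \<and> y \<in> U \<longrightarrow> x \<sqinter> y \<in> U) \<and>
     (\<forall>x. x \<in> U \<or> - x \<in> U)"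

definition ba_hom :: "('a::boolean_algebra \<Rightarrow> 'b::boolean_algebra) \<Rightarrow> bool" where
  "ba_hom j \<longleftrightarrow>
     j bot = bot \<and> j top = top \<and> (\<forall>x. j (- x) = - j x) \<and>
     (\<forall>x y. j (x \<sqinter> y) = j x \<sqinter> j y) \<and> (\<forall>x y. j (x \<squnion> y) = j x \<squnion> j y)"

definition built_from :: "'i filter \<Rightarrow> 'i filter \<Rightarrow> 'b::boolean_algebra set \<Rightarrow> bool" where
  "built_from D D\<^sub>0 U \<longleftrightarrow>
     ultrafilter D \<and> regular_filter D \<and>
     D\<^sub>0 \<noteq> bot \<and> regular_filter D\<^sub>0 \<and> excellent_filter D\<^sub>0 \<and>
     ba_ultrafilter U \<and>
     (\<exists>j :: 'i set \<Rightarrow> 'b. ba_hom j \<and> surj j \<and>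
        (\<forall>A. eventually (\<lambda>t. t \<in> A) D\<^sub>0 \<longleftrightarrow> j A = top) \<and>
        (\<forall>A. eventually (\<lambda>t. t \<in> A) D \<longleftrightarrow> j A \<in> U))"

definition maximal_antichain :: "'b::boolean_algebra set \<Rightarrow> bool" where
  "maximal_antichain C \<longleftrightarrow>
     (\<forall>a\<in>C. a \<noteq> bot) \<and> (\<forall>a\<in>C. \<forall>b\<in>C. a \<noteq> b \<longrightarrow> a \<sqinter> b = bot) \<and>
     (\<forall>b. b \<noteq> bot \<longrightarrow> (\<exists>a\<in>C. a \<sqinter> b \<noteq> bot))"

definition is_support :: "('d, 'm) B1 set \<Rightarrow> ('l set \<Rightarrow> ('d, 'm) B1) \<Rightarrow> bool" where
  "is_support X b \<longleftrightarrow>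
     X \<subseteq> range gen \<and>
     (\<forall>u. finite u \<longrightarrow> (\<exists>C\<subseteq>X. maximal_antichain C \<and> (\<forall>a\<in>C. a \<le> b u \<or> a \<le> - b u)))"

text \<open>
  The type \<open>'l\<close> has cardinality \<open>\<lambda>\<close>, the type \<open>'m\<close> has cardinality \<open>\<mu>\<close>, and \<open>'l set\<close>, well-ordered by
  the cardinal \<open>|UNIV :: 'l set set|\<close>, is the ordinal \<open>2\<^sup>\<lambda>\<close>. Its elements \<open>\<alpha>\<close> stand for the
  ordinals \<open>underS |UNIV| \<alpha>\<close> below \<open>2\<^sup>\<lambda>\<close>.
\<close>

definition perfect :: "('l set, 'm) B1 set \<Rightarrow> bool" where
  "perfect U \<longleftrightarrow>
     ba_ultrafilter U \<and>
     (\<forall>b :: 'l set \<Rightarrow> ('l set, 'm) B1.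
        monotonic b \<and> (\<forall>u. finite u \<longrightarrow> b u \<in> U) \<and>
        (\<exists>X. is_support X b \<and> |X| \<le>o |UNIV :: 'l set| \<and>
           (\<forall>\<alpha> :: 'l set.
              (\<Union>{fmdom' f | f. gen f \<in> X}) \<subseteq> underS |UNIV :: 'l set set| \<alpha> \<longrightarrow>
              (\<exists>b'. multiplicative b' \<and>
                 (\<forall>u. finite u \<longrightarrow> b' u \<noteq> bot \<and> b' u \<le> b u) \<and>
                 (\<forall>c \<in> subalgebra_on (underS |UNIV :: 'l set set| \<alpha>) \<inter> U. c \<noteq> bot \<longrightarrow>
                    (\<forall>J. finite J \<longrightarrow> (INF i\<in>J. b' {i} \<squnion> - b {i}) \<sqinter> c \<noteq> bot))))) \<longrightarrow>
        (\<exists>b'. multiplicative b' \<and> (\<forall>u. finite u \<longrightarrow> b' u \<in> U \<and> b' u \<le> b u)))"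

definition perfected :: "'i rel \<Rightarrow> 'm rel \<Rightarrow> 'i filter \<Rightarrow> bool" where
  "perfected lam \<mu> D \<longleftrightarrow>
     card_order lam \<and> card_order \<mu> \<and>
     (\<exists>(D\<^sub>0 :: 'i filter) (U :: ('i set, 'm) B1 set). built_from D D\<^sub>0 U \<and> perfect U)"

end

theory Submission
  imports Defs "HOL-Library.Countable_Set"
begin

text \<open>
  Models of \<open>T\<^bsub>k+1,k\<^esub>\<close> are the generic hypergraphs without a complete sub-hypergraph on \<open>k + 2\<close>
  vertices, and they eliminate quantifiers; so only types of the form
  \<open>{R(x, a\<^sub>w) | w \<in> P} \<union> {\<not> R(x, a\<^sub>w) | w \<notin> P}\<close>, with \<open>w\<close> ranging over the \<open>k\<close>-element sets of
  parameters, matter.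

  If \<open>k < \<ell>\<close>, then \<open>\<lambda> \<ge> \<mu>\<^bsup>+(k+1)\<^esup>\<close>. Choose parameters such that the truth values in \<open>\<BB>\<close> of the
  relations between \<open>k + 1\<close> of them are independent generators outside \<open>\<D>\<^sub>*\<close>. A realization of the
  type \<open>{R(x, a\<^sub>w)}\<close> assigns to each \<open>w\<close> an element of \<open>\<BB>\<close>, which by the chain condition is
  supported by at most \<open>\<mu>\<close> generators. A free set for this assignment, which exists by Kuratowski's
  theorem, gives \<open>k + 1\<close> parameters whose generator is independent of the supports of all their
  \<open>k\<close>-subsets, so that at some index a complete hypergraph on \<open>k + 2\<close> vertices appears.

  If \<open>\<ell> < k\<close>, then \<open>\<lambda> \<le> \<mu>\<^bsup>+(k-1)\<^esup>\<close>, and by Sierpinski's theorem there is \<open>F\<close> with \<open>|F(z)| \<le> \<mu>\<close> such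
  that every \<open>(k+1)\<close>-set has a \<open>(k-1)\<close>-subset \<open>z\<close> whose \<open>F(z)\<close> contains the remaining two points. A
  fresh generic choice of finite subsets \<open>s\<^sub>z \<subseteq> F(z)\<close>, together with the promise to make \<open>R(x, a\<^sub>w)\<close>
  true for \<open>w = z \<union> {i}\<close> only if \<open>i \<in> s\<^sub>z\<close>, leaves finitely many conflicts to be avoided for each \<open>w\<close>.
  This defines the multiplicative refinement that perfection requires.
\<close>

section \<open>Finite partial functions and supports\<close>

text \<open>An element of \<BB> is a regular open set of finite functions, and membership of
  \<open>p\<close> in \<open>Rep_B1 b\<close> is read as: \<open>p\<close> forces \<open>b\<close>.
  Both halves are forcing arguments that end at an actual index: if some condition forces
  \<open>j A\<close>, then \<open>A\<close> is nonempty, so a contradiction need only be found at a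
  single \<open>t\<close>, inside the given model. The bounds on \<lambda> come from the two set
  mapping theorems. A free (k+1)-tuple for mappings of k-tuples into sets of size \<mu> is available
  from the (k+1)-st successor of \<mu> on; capturing two points by a (k-1)-set is possible up to the
  (k-1)-st successor. Two points are wanted because a clique over an edge v = z \<union> {x, y} has
  to be noticed at z \<union> {x}, which succeeds only if y is among the finitely many candidates
  attached to z. The case k = \<ell> falls between the two bounds.\<close>

lemma compatible_iff:
  "compatible f g \<longleftrightarrow> (\<forall>x a b. fmlookup f x = Some a \<longrightarrow> fmlookup g x = Some b \<longrightarrow> a = b)"
proof
  show "compatible f g \<Longrightarrow> \<forall>x a b. fmlookup f x = Some a \<longrightarrow> fmlookup g x = Some b \<longrightarrow> a = b"
    by (fastforce simp: compatible_def fmsubset_alt_def fmpred_iff)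
next
  assume *: "\<forall>x a b. fmlookup f x = Some a \<longrightarrow> fmlookup g x = Some b \<longrightarrow> a = b"
  have "f \<subseteq>\<^sub>f f ++\<^sub>f g" "g \<subseteq>\<^sub>f f ++\<^sub>f g"
    using * by (auto simp: fmsubset_alt_def fmpred_iff fmlookup_dom_iff)
  then show "compatible f g"
    by (auto simp: compatible_def)
qed

lemma fmsubset_lookup: "f \<subseteq>\<^sub>f g \<Longrightarrow> fmlookup f x = Some a \<Longrightarrow> fmlookup g x = Some a"
  by (auto simp: fmsubset_alt_def fmpred_iff)

lemma finite_map_fmap:
  assumes "finite (dom m)"
  obtains f where "fmlookup f = m"
  using assms fmlookup_cases by blast

text \<open>A condition in the double perp cannot lie in \<open>perp Q\<close>, hence is compatible
  with a member of \<open>Q\<close>, and upward closure puts a common extension into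
  \<open>Q\<close>. In this way membership in a regular closure is brought back to an explicit
  description of conditions.\<close>

lemma perp_perp_extend:
  assumes "p \<in> perp (perp Q)" and up: "\<And>f g. f \<in> Q \<Longrightarrow> f \<subseteq>\<^sub>f g \<Longrightarrow> g \<in> Q"
  shows "\<exists>q\<in>Q. p \<subseteq>\<^sub>f q"
proof -
  have "p \<notin> perp Q"
    using assms(1) perp_disjoint[of "perp Q"] by blast
  then obtain g h where "g \<in> Q" "p \<subseteq>\<^sub>f h" "g \<subseteq>\<^sub>f h"
    by (auto simp: perp_def compatible_def)
  then show ?thesis
    using up by blast
qed

lemma Rep_B1_upward: "p \<in> Rep_B1 b \<Longrightarrow> p \<subseteq>\<^sub>f q \<Longrightarrow> q \<in> Rep_B1 b"
  using perp_upward[of p "perp (Rep_B1 b)" q] by simp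

lemma Rep_B1_not_both: "p \<in> Rep_B1 b \<Longrightarrow> p \<notin> Rep_B1 (- b)"
  using perp_disjoint[of "Rep_B1 b"] by auto

text \<open>Regularity of \<open>b\<close> is the point: a condition outside the perp of the
  complement is compatible with one that forces the complement.\<close>

lemma Rep_B1_extend_compl:
  assumes "p \<notin> Rep_B1 b"
  shows "\<exists>q. p \<subseteq>\<^sub>f q \<and> q \<in> Rep_B1 (- b)"
proof -
  have "p \<notin> perp (Rep_B1 (- b))"
    using assms by simp
  then obtain g h where "g \<in> Rep_B1 (- b)" "p \<subseteq>\<^sub>f h" "g \<subseteq>\<^sub>f h"
    unfolding perp_def compatible_def by blast
  then show ?thesis
    using Rep_B1_upward by blast
qed

lemma Rep_B1_nonempty: "b \<noteq> bot \<Longrightarrow> \<exists>p. p \<in> Rep_B1 b"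
  using gen_dense gen_le_iff by blast

section \<open>Chain condition for finite partial functions\<close>

definition incompatible_family :: "('d, 'm) fmap set \<Rightarrow> bool" where
  "incompatible_family C \<longleftrightarrow> (\<forall>f\<in>C. \<forall>g\<in>C. f \<noteq> g \<longrightarrow> \<not> compatible f g)"

lemma finite_card_ordLeq: "finite A \<Longrightarrow> infinite B \<Longrightarrow> |A| \<le>o |B|"
  by (metis card_of_Well_order card_of_ordLeq_infinite ordLeq_total)

lemma card_Times_ordLeq: "infinite C \<Longrightarrow> |A| \<le>o |C| \<Longrightarrow> |B| \<le>o |C| \<Longrightarrow> |A \<times> B| \<le>o |C|"
  by (metis Field_card_of card_of_Card_order card_of_Times_ordLeq_infinite_Field)

lemma card_Un_ordLeq: "infinite C \<Longrightarrow> |A| \<le>o |C| \<Longrightarrow> |B| \<le>o |C| \<Longrightarrow> |A \<union> B| \<le>o |C|"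
  by (metis Field_card_of card_of_Card_order card_of_Un_ordLeq_infinite_Field)

text \<open>Fix \<open>f\<close> in the family: every other member takes at some point of the domain of \<open>f\<close> a value
  that conflicts with \<open>f\<close>. Grouping by that point and value, and deleting the point, gives at most
  \<open>\<mu>\<close> families of smaller functions.\<close>

lemma card_of_incompatible_bounded:
  fixes C :: "('d, 'm) fmap set"
  assumes inf: "infinite (UNIV :: 'm set)"
  shows "incompatible_family C \<Longrightarrow> \<forall>f\<in>C. card (fmdom' f) \<le> n \<Longrightarrow> |C| \<le>o |UNIV :: 'm set|"
proof (induction n arbitrary: C)
  case 0
  then have "\<forall>f\<in>C. f = fmempty"
    by (auto intro!: fmap_ext simp: fmdom'_notD)
  then have "finite C"
    by (intro finite_subset[of C "{fmempty}"]) auto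
  then show ?case
    using inf by (simp add: finite_card_ordLeq)
next
  case (Suc n)
  show ?case
  proof (cases "C = {}")
    case False
    then obtain f where f: "f \<in> C"
      by blast
    define B where "B = (\<lambda>(d, \<beta>). {g \<in> C. fmlookup g d = Some (\<beta> :: 'm)})"
    have small: "|B x| \<le>o |UNIV :: 'm set|" for x
    proof -
      obtain d \<beta> where x: "x = (d, \<beta>)"
        by fastforce
      \<comment> \<open>All members of \<open>B x\<close> have the value \<beta> at
        \<open>d\<close>, so deleting \<open>d\<close> changes neither equality nor compatibility
        among them.\<close>
      have upd: "fmupd d \<beta> (fmdrop d g) = g" if "g \<in> B x" for g
        using that by (intro fmap_ext) (auto simp: B_def x)
      then have inj: "inj_on (fmdrop d) (B x)"
        by (metis inj_onI)
      have "incompatible_family (fmdrop d ` B x)"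
      proof (clarsimp simp: incompatible_family_def)
        fix g h assume gh: "g \<in> B x" "h \<in> B x" "fmdrop d g \<noteq> fmdrop d h"
          and comp: "compatible (fmdrop d g) (fmdrop d h)"
        have "compatible g h"
          unfolding compatible_iff
        proof (intro allI impI)
          fix y a b assume "fmlookup g y = Some a" "fmlookup h y = Some b"
          then show "a = b"
            using gh comp[unfolded compatible_iff, rule_format, of y] by (cases "y = d") (auto simp: B_def x)
        qed
        then show False
          using gh Suc.prems(1) by (auto simp: B_def x incompatible_family_def)
      qed
      moreover have "card (fmdom' (fmdrop d g)) \<le> n" if "g \<in> B x" for g
      proof -
        have "d \<in> fmdom' g" "card (fmdom' g) \<le> Suc n"
          using that Suc.prems(2) by (auto simp: B_def x fmdom'I)
        then show ?thesis
          by simp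
      qed
      ultimately have "|fmdrop d ` B x| \<le>o |UNIV :: 'm set|"
        by (intro Suc.IH) blast+
      then show ?thesis
        using card_of_ordIsoI[OF bij_betw_imageI[OF inj refl]] ordIso_ordLeq_trans by blast
    qed
    have "C \<subseteq> insert f (\<Union>x\<in>fmdom' f \<times> UNIV. B x)"
    proof
      fix g assume g: "g \<in> C"
      show "g \<in> insert f (\<Union>x\<in>fmdom' f \<times> UNIV. B x)"
      proof (cases "g = f")
        case False
        then have "\<not> compatible f g"
          using f g Suc.prems(1) by (auto simp: incompatible_family_def)
        then obtain x a b where "fmlookup f x = Some a" "fmlookup g x = Some b"
          by (auto simp: compatible_iff)
        then show ?thesis
          using g by (auto simp: B_def intro: fmdom'I)
      qed simp
    qed
    moreover have "|fmdom' f \<times> (UNIV :: 'm set)| \<le>o |UNIV :: 'm set|"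
      using inf by (intro card_Times_ordLeq) (auto simp: finite_card_ordLeq intro: ordLeq_refl card_of_Card_order)
    then have "|\<Union>x\<in>fmdom' f \<times> UNIV. B x| \<le>o |UNIV :: 'm set|"
      using small inf by (intro card_of_UNION_ordLeq_infinite) auto
    then have "|insert f (\<Union>x\<in>fmdom' f \<times> UNIV. B x)| \<le>o |UNIV :: 'm set|"
      using inf card_Un_ordLeq[of "UNIV :: 'm set" "{f}"] by (simp add: finite_card_ordLeq)
    ultimately show ?thesis
      using card_of_mono1 ordLeq_transitive by blast
  qed (simp add: card_of_empty)
qed

text \<open>The \<open>\<mu>\<^sup>+\<close>-chain condition. Sorting by the size of the domain
  leaves countably many bounded families, and a countable union of sets of size at most \<mu> has
  size at most \<mu> because \<mu> is infinite.\<close>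

lemma card_of_incompatible:
  fixes C :: "('d, 'm) fmap set"
  assumes inf: "infinite (UNIV :: 'm set)" and C: "incompatible_family C"
  shows "|C| \<le>o |UNIV :: 'm set|"
proof -
  have "|{f \<in> C. card (fmdom' f) \<le> n}| \<le>o |UNIV :: 'm set|" for n
    using C by (intro card_of_incompatible_bounded[OF inf, of _ n]) (auto simp: incompatible_family_def)
  moreover have "C = (\<Union>n::nat. {f \<in> C. card (fmdom' f) \<le> n})"
    by auto
  moreover have "|UNIV :: nat set| \<le>o |UNIV :: 'm set|"
    using inf infinite_iff_card_of_nat by blast
  ultimately show ?thesis
    using card_of_UNION_ordLeq_infinite[OF inf, of "UNIV :: nat set" "\<lambda>n. {f \<in> C. card (fmdom' f) \<le> n}"]
    by simp
qed

section \<open>Antichains deciding an element, and supports\<close>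

definition decides :: "('d, 'm) fmap set \<Rightarrow> ('d, 'm) B1 \<Rightarrow> bool" where
  "decides C b \<longleftrightarrow> C \<subseteq> Rep_B1 b \<union> Rep_B1 (- b) \<and> incompatible_family C \<and> (\<forall>f. \<exists>g\<in>C. compatible f g)"

text \<open>Zorn's lemma for families of pairwise incompatible conditions that decide
  \<open>b\<close>: a condition incompatible with all of a maximal family could be strengthened to
  decide \<open>b\<close> and then be added. The family consists of conditions rather than of
  algebra elements so that domains can be read off from it.\<close>

lemma decides_exists:
  fixes b :: "('d, 'm) B1"
  obtains C where "decides C b"
proof -
  let ?A = "{C. C \<subseteq> Rep_B1 b \<union> Rep_B1 (- b) \<and> incompatible_family C}"
  have "\<exists>C\<in>?A. \<forall>X\<in>?A. C \<subseteq> X \<longrightarrow> X = C"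
  proof (rule subset_Zorn_nonempty)
    show "?A \<noteq> {}"
      by (auto simp: incompatible_family_def)
    fix \<C> assume c: "\<C> \<noteq> {}" "subset.chain ?A \<C>"
    have "incompatible_family (\<Union>\<C>)"
      unfolding incompatible_family_def
    proof (intro ballI impI)
      fix f g assume fg: "f \<in> \<Union>\<C>" "g \<in> \<Union>\<C>" "f \<noteq> g"
      then obtain X where "X \<in> \<C>" "f \<in> X" "g \<in> X"
        using subset.chain_total[OF c(2)] by blast
      then show "\<not> compatible f g"
        using c(2) fg(3) by (auto simp: subset.chain_def incompatible_family_def)
    qed
    then show "\<Union>\<C> \<in> ?A"
      using c by (auto simp: subset.chain_def)
  qed
  then obtain C where C: "C \<in> ?A" and "\<forall>X\<in>?A. C \<subseteq> X \<longrightarrow> X = C"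
    by (elim bexE)
  then have max: "X = C" if "X \<in> ?A" "C \<subseteq> X" for X
    using that by (metis (no_types, lifting))
  have "\<exists>g\<in>C. compatible f g" for f
  proof (rule ccontr)
    assume no: "\<not> (\<exists>g\<in>C. compatible f g)"
    obtain q where q: "f \<subseteq>\<^sub>f q" "q \<in> Rep_B1 b \<union> Rep_B1 (- b)"
      using Rep_B1_extend_compl[of f b] fmsubset_refl by blast
    then have *: "\<not> compatible q g" "\<not> compatible g q" if "g \<in> C" for g
      using no that compatible_mono compatible_sym by blast+
    have "insert q C \<in> ?A"
      using C q(2) * by (simp add: incompatible_family_def)
    then have "q \<in> C"
      using max[of "insert q C"] by blast
    then show False
      using * compatible_refl by blast
  qed
  then show ?thesis
    using C by (intro that[of C]) (auto simp: decides_def)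
qed

lemma decides_maximal_antichain:
  fixes b :: "('d, 'm) B1"
  assumes "decides C b"
  shows "maximal_antichain (gen ` C)" "\<forall>a\<in>gen ` C. a \<le> b \<or> a \<le> - b"
proof -
  show "\<forall>a\<in>gen ` C. a \<le> b \<or> a \<le> - b"
    using assms by (auto simp: decides_def gen_le_iff)
  show "maximal_antichain (gen ` C)"
    unfolding maximal_antichain_def
  proof (intro conjI ballI allI impI)
    fix a assume "a \<in> gen ` C" then show "a \<noteq> bot"
      using gen_nonzero by auto
  next
    fix a a' assume "a \<in> gen ` C" "a' \<in> gen ` C" "a \<noteq> a'"
    then show "a \<sqinter> a' = bot"
      using assms gen_inf_nonzero_iff by (fastforce simp: decides_def incompatible_family_def)
  next
    fix a :: "('d, 'm) B1" assume "a \<noteq> bot"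
    then obtain f where f: "gen f \<le> a"
      using gen_dense by blast
    obtain g where "g \<in> C" "compatible f g"
      using assms unfolding decides_def by blast
    then have "g \<in> C" "compatible g f"
      by (auto dest: compatible_sym)
    then show "\<exists>a'\<in>gen ` C. a' \<sqinter> a \<noteq> bot"
      using f gen_inf_nonzero_iff[of g f] by (metis imageI inf_mono order_refl bot_unique)
  qed
qed

text \<open>Forcing depends on the coordinates in \<open>S\<close> alone. In this form the property
  is inherited by perps, unions and intersections, hence by the whole complete subalgebra generated
  on \<open>S\<close>.\<close>

definition supported :: "'d set \<Rightarrow> ('d, 'm) fmap set \<Rightarrow> bool" where
  "supported S U \<longleftrightarrow> (\<forall>p\<in>U. fmrestrict_set S p \<in> U)"

lemma supported_mono:
  fixes b :: "('d, 'm) B1"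
  assumes "supported S (Rep_B1 b)" "S \<subseteq> S'"
  shows "supported S' (Rep_B1 b)"
proof -
  have "fmrestrict_set S p \<subseteq>\<^sub>f fmrestrict_set S' p" for p :: "('d, 'm) fmap"
    using assms(2) by (auto simp: fmsubset_alt_def fmpred_iff split: if_splits)
  then show ?thesis
    using assms Rep_B1_upward unfolding supported_def by blast
qed

text \<open>The restriction can be moved to the other side: \<open>p\<close> restricted to
  \<open>S\<close> conflicts with \<open>g\<close> exactly when \<open>p\<close> conflicts with
  \<open>g\<close> restricted to \<open>S\<close>.\<close>

lemma supported_perp: "supported S U \<Longrightarrow> supported S (perp U)"
  unfolding supported_def
proof (intro ballI)
  fix p assume U: "\<forall>p\<in>U. fmrestrict_set S p \<in> U" and p: "p \<in> perp U"
  show "fmrestrict_set S p \<in> perp U"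
    unfolding perp_def
  proof (clarify)
    fix g assume g: "g \<in> U" "compatible (fmrestrict_set S p) g"
    then have "compatible p (fmrestrict_set S g)"
      by (auto simp: compatible_iff split: if_splits)
    then show False
      using U g(1) p by (auto simp: perp_def)
  qed
qed

lemma supported_perp_dom:
  assumes "\<And>f. f \<in> U \<Longrightarrow> fmdom' f \<subseteq> S"
  shows "supported S (perp U)"
proof -
  have "fmrestrict_set S f = f" if "f \<in> U" for f
    using assms[OF that] by (intro fmap_ext) (use fmdom'_notD in fastforce)
  then show ?thesis
    by (intro supported_perp) (simp add: supported_def)
qed

text \<open>\<open>b\<close> is the perp of those antichain members that force its complement: by
  maximality of the antichain, a condition compatible with none of them has no extension forcing the
  complement. The perp of a set of conditions with domains in \<open>S\<close> is supported by
  \<open>S\<close>.\<close>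

lemma decides_supported:
  assumes C: "decides C b" and S: "\<And>f. f \<in> C \<Longrightarrow> fmdom' f \<subseteq> S"
  shows "supported S (Rep_B1 b)"
proof -
  have "Rep_B1 b = perp (C \<inter> Rep_B1 (- b))"
  proof
    show "Rep_B1 b \<subseteq> perp (C \<inter> Rep_B1 (- b))"
      using perp_antimono[of "C \<inter> Rep_B1 (- b)" "Rep_B1 (- b)"] by simp
    show "perp (C \<inter> Rep_B1 (- b)) \<subseteq> Rep_B1 b"
    proof
      fix p assume p: "p \<in> perp (C \<inter> Rep_B1 (- b))"
      have "p \<in> perp (Rep_B1 (- b))"
        unfolding perp_def
      proof clarify
        fix g assume "g \<in> Rep_B1 (- b)" "compatible p g"
        then obtain h where h: "p \<subseteq>\<^sub>f h" "h \<in> Rep_B1 (- b)"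
          using Rep_B1_upward by (auto simp: compatible_def simp del: Rep_B1_simps)
        obtain q where q: "q \<in> C" "compatible h q"
          using C by (auto simp: decides_def)
        then obtain r where r: "h \<subseteq>\<^sub>f r" "q \<subseteq>\<^sub>f r"
          by (auto simp: compatible_def)
        then have "q \<notin> Rep_B1 b"
          using h Rep_B1_not_both Rep_B1_upward by blast
        then have "q \<in> C \<inter> Rep_B1 (- b)"
          using C q(1) by (auto simp: decides_def)
        then show False
          using p compatible_mono[OF h(1) q(2)] by (auto simp: perp_def)
      qed
      then show "p \<in> Rep_B1 b"
        by simp
    qed
  qed
  then show ?thesis
    using supported_perp_dom[of "C \<inter> Rep_B1 (- b)" S] S by simp
qed

text \<open>The chain condition bounds a deciding antichain by \<mu>, and its members have finite
  domains.\<close>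

lemma small_support:
  fixes b :: "('d, 'm) B1"
  assumes inf: "infinite (UNIV :: 'm set)"
  obtains S where "|S| \<le>o |UNIV :: 'm set|" "supported S (Rep_B1 b)"
proof -
  obtain C where C: "decides C b"
    by (rule decides_exists)
  let ?S = "\<Union>f\<in>C. fmdom' f"
  have "|C| \<le>o |UNIV :: 'm set|"
    using C inf card_of_incompatible by (auto simp: decides_def)
  then have "|?S| \<le>o |UNIV :: 'm set|"
    using inf by (intro card_of_UNION_ordLeq_infinite)
      (auto simp: finite_card_ordLeq)
  then show ?thesis
    using that decides_supported[OF C, of ?S] by blast
qed

lemma subalgebra_on_supported:
  fixes c :: "('d, 'm) B1"
  assumes "c \<in> subalgebra_on S"
  shows "supported S (Rep_B1 c)"
proof -
  have *: "supported S (Rep_B1 (Inf A))" if "\<And>a. a \<in> A \<Longrightarrow> supported S (Rep_B1 a)"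
    for A :: "('d, 'm) B1 set"
    using that by (auto simp: supported_def)
  have "complete_subalgebra {c :: ('d, 'm) B1. supported S (Rep_B1 c)}"
    unfolding complete_subalgebra_def
  proof (intro conjI ballI allI impI)
    fix x :: "('d, 'm) B1" assume "x \<in> {c. supported S (Rep_B1 c)}"
    then show "- x \<in> {c. supported S (Rep_B1 c)}"
      by (simp add: supported_perp)
  next
    fix A :: "('d, 'm) B1 set" assume A: "A \<subseteq> {c. supported S (Rep_B1 c)}"
    then show "Inf A \<in> {c. supported S (Rep_B1 c)}"
      using *[of A] by blast
    have "supported S (\<Union>(Rep_B1 ` A))"
      using A by (auto simp: supported_def)
    then show "Sup A \<in> {c. supported S (Rep_B1 c)}"
      by (simp add: supported_perp)
  qed
  moreover have "{gen f | f :: ('d, 'm) fmap. fmdom' f \<subseteq> S} \<subseteq> {c :: ('d, 'm) B1. supported S (Rep_B1 c)}"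
    by (auto intro!: supported_perp[OF supported_perp_dom])
  ultimately have "complete_subalgebra hull {gen f | f :: ('d, 'm) fmap. fmdom' f \<subseteq> S} \<subseteq> {c :: ('d, 'm) B1. supported S (Rep_B1 c)}"
    by (intro hull_minimal)
  then show ?thesis
    using assms by (auto simp: subalgebra_on_def)
qed

section \<open>Combinatorics of infinite cardinals\<close>

primrec at_most_aleph :: "nat \<Rightarrow> 'm set \<Rightarrow> 'i set \<Rightarrow> bool" where
  "at_most_aleph 0 \<mu> X \<longleftrightarrow> |X| \<le>o |\<mu>|"
|"at_most_aleph (Suc n) \<mu> X \<longleftrightarrow> (\<exists>Y :: 'i set. at_most_aleph n \<mu> Y \<and> |X| \<le>o cardSuc |Y| )"

text \<open>Mind the shift: \<open>at_most_aleph n\<close> bounds \<open>X\<close> by the n-th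
  successor of \<mu>, whereas \<open>beyond_aleph n\<close> makes it at least the (n+1)-st. The
  iteration passes through sets \<open>Y\<close> of the type of \<open>X\<close> because
  \<open>cardSuc\<close> changes the type of its argument.\<close>

primrec beyond_aleph :: "nat \<Rightarrow> 'm set \<Rightarrow> 'i set \<Rightarrow> bool" where
  "beyond_aleph 0 \<mu> X \<longleftrightarrow> |\<mu>| <o |X|"
|"beyond_aleph (Suc n) \<mu> X \<longleftrightarrow> (\<exists>Y :: 'i set. beyond_aleph n \<mu> Y \<and> |Y| <o |X| )"

lemma at_most_aleph_mono:
  fixes X Y :: "'i set"
  shows "at_most_aleph n \<mu> X \<Longrightarrow> |Y| \<le>o |X| \<Longrightarrow> at_most_aleph n \<mu> Y"
  by (cases n) (auto, (blast intro: ordLeq_transitive)+)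

lemma at_most_aleph_le:
  assumes "m \<le> n" "at_most_aleph m \<mu> X"
  shows "at_most_aleph n \<mu> X"
  using assms
proof (induction n rule: dec_induct)
  case (step n)
  then have "at_most_aleph n \<mu> X" "|X| \<le>o cardSuc |X|"
    by (auto intro: cardSuc_ordLeq card_of_Card_order)
  then show ?case
    by auto
qed

lemma beyond_aleph_mono:
  fixes X Y :: "'i set"
  shows "beyond_aleph n \<mu> X \<Longrightarrow> |X| \<le>o |Y| \<Longrightarrow> beyond_aleph n \<mu> Y"
  by (cases n) (auto, (blast intro: ordLess_ordLeq_trans)+)

lemma beyond_aleph_imp_ordLess: "beyond_aleph n \<mu> X \<Longrightarrow> |\<mu>| <o |X|"
  by (induction n arbitrary: X) (auto intro: ordLess_transitive)

lemma finite_total_max: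
  assumes "Well_order r" "finite v" "v \<noteq> {}" "v \<subseteq> Field r"
  shows "\<exists>x\<in>v. v - {x} \<subseteq> underS r x"
  using assms(2-)
proof (induction v rule: finite_ne_induct)
  case (insert y v)
  have ord: "trans r" "antisym r" "Total r"
    using assms(1) by (simp_all add: order_on_defs)
  obtain x where x: "x \<in> v" "v - {x} \<subseteq> underS r x"
    using insert by auto
  have tr: "(a, c) \<in> r" if "(a, b) \<in> r" "(b, c) \<in> r" for a b c
    using ord(1) that by (auto simp: trans_def)
  have an: "a = b" if "(a, b) \<in> r" "(b, a) \<in> r" for a b
    using ord(2) that by (auto simp: antisym_def)
  have "(x, y) \<in> r \<or> (y, x) \<in> r"
    using ord(3) insert.prems insert.hyps x(1) by (auto simp: total_on_def)
  then show ?case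
  proof
    assume "(x, y) \<in> r"
    then have "insert y v - {y} \<subseteq> underS r y"
      using x insert.hyps tr an by (fastforce simp: underS_def)
    then show ?thesis
      by blast
  next
    assume "(y, x) \<in> r"
    then have "insert y v - {x} \<subseteq> underS r x"
      using x insert.hyps by (auto simp: underS_def)
    then show ?thesis
      using x(1) by blast
  qed
qed auto

text \<open>Well-order \<open>X\<close> in type \<open>|X|\<close>. Every proper initial segment
  falls under the induction hypothesis and has its own mapping. A finite set \<open>v\<close> is
  handled by the mapping of the segment below its maximum, and the maximum is then added to the
  chosen \<open>z\<close>; so each cardinal successor costs one more point in
  \<open>z\<close>.\<close>

lemma sierpinski_set_mapping:
  assumes "at_most_aleph n \<mu> (X :: 'i set)"
  shows "\<exists>F :: 'i set \<Rightarrow> 'i set. (\<forall>z. |F z| \<le>o |\<mu>| ) \<and>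
    (\<forall>v\<subseteq>X. finite v \<and> n \<le> card v \<longrightarrow> (\<exists>z\<subseteq>v. card z = n \<and> v - z \<subseteq> F z))"
  using assms
proof (induction n arbitrary: X)
  case 0
  then show ?case
    by (intro exI[of _ "\<lambda>_. X"]) (auto intro!: exI[of _ "{}"])
next
  case (Suc n)
  let ?r = "|X|"
  have wo: "Well_order ?r" and fld: "Field ?r = X"
    by (rule card_of_Well_order Field_card_of)+
  obtain Y :: "'i set" where Y: "at_most_aleph n \<mu> Y" "|X| \<le>o cardSuc |Y|"
    using Suc.prems by auto
  have "at_most_aleph n \<mu> (underS ?r x)" if "x \<in> X" for x
  proof -
    have "|underS ?r x| <o ?r"
      using that card_of_underS[OF card_of_Card_order, of x X] by (simp add: fld)
    then have "|underS ?r x| <o cardSuc |Y|"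
      using Y(2) ordLess_ordLeq_trans by blast
    then have "|underS ?r x| \<le>o |Y|"
      using cardSuc_ordLeq_ordLess[OF card_of_Card_order card_of_Card_order] by blast
    then show ?thesis
      using Y(1) at_most_aleph_mono by blast
  qed
  then have "\<forall>x. \<exists>F. x \<in> X \<longrightarrow> (\<forall>z. |F z| \<le>o |\<mu>| ) \<and>
      (\<forall>v\<subseteq>underS ?r x. finite v \<and> n \<le> card v \<longrightarrow> (\<exists>z\<subseteq>v. card z = n \<and> v - z \<subseteq> F z))"
    using Suc.IH by meson
  then obtain F where F: "\<forall>x. x \<in> X \<longrightarrow> (\<forall>z. |F x z| \<le>o |\<mu>| ) \<and>
      (\<forall>v\<subseteq>underS ?r x. finite v \<and> n \<le> card v \<longrightarrow> (\<exists>z\<subseteq>v. card z = n \<and> v - z \<subseteq> F x z))"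
    by metis
  \<comment> \<open>The value of the mapping may depend on \<open>z\<close> only, so the segment has
    to be recovered from \<open>z\<close>, as the one below the maximum of \<open>z\<close>.\<close>
  define top where "top z = (SOME x. x \<in> z \<and> z - {x} \<subseteq> underS ?r x)" for z
  have top: "top z = x" if "x \<in> z" "z - {x} \<subseteq> underS ?r x" for z x
    unfolding top_def
  proof (rule some_equality)
    show "x \<in> z \<and> z - {x} \<subseteq> underS ?r x"
      using that by blast
    fix y assume y: "y \<in> z \<and> z - {y} \<subseteq> underS ?r y"
    have "antisym ?r"
      using wo by (simp add: order_on_defs)
    show "y = x"
    proof (rule ccontr)
      assume "y \<noteq> x"
      then have "y \<in> underS ?r x" "x \<in> underS ?r y"
        using y that by auto
      then show False
        using \<open>antisym ?r\<close> by (auto simp: underS_def antisym_def)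
    qed
  qed
  define G where "G z = (if top z \<in> X then F (top z) (z - {top z}) else {})" for z
  have "|G z| \<le>o |\<mu>|" for z
    using F by (simp add: G_def card_of_empty)
  moreover have "\<exists>z\<subseteq>v. card z = Suc n \<and> v - z \<subseteq> G z" if v: "v \<subseteq> X" "finite v" "Suc n \<le> card v" for v
  proof -
    have "\<exists>x\<in>v. v - {x} \<subseteq> underS ?r x"
      using v by (intro finite_total_max[OF wo]) (auto simp: fld)
    then obtain x where x: "x \<in> v" "v - {x} \<subseteq> underS ?r x"
      by blast
    have "finite (v - {x})" "n \<le> card (v - {x})"
      using v x by auto
    then obtain z where z: "z \<subseteq> v - {x}" "card z = n" "v - {x} - z \<subseteq> F x z"
      using F x v(1) by (meson subsetD)
    have t: "top (insert x z) = x"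
      using z(1) x by (intro top) auto
    have "x \<notin> z" "finite z"
      using z(1) v(2) finite_subset by auto
    then have "card (insert x z) = Suc n" "insert x z - {x} = z"
      using z(2) by auto
    then show ?thesis
      using z x v(1) by (intro exI[of _ "insert x z"]) (auto simp: G_def t)
  qed
  ultimately show ?case
    by (intro exI[of _ G]) blast
qed

lemma card_of_lists_ordLeq:
  assumes "infinite (X :: 'i set)"
  shows "|lists X| \<le>o |X|"
proof -
  have "|{xs \<in> lists X. length xs = n}| \<le>o |X|" for n
  proof (induction n)
    case 0
    have "finite {xs \<in> lists X. length xs = 0}"
      by (rule finite_subset[of _ "{[]}"]) auto
    then show ?case
      using assms by (rule finite_card_ordLeq)
  next
    case (Suc n)
    have "{xs \<in> lists X. length xs = Suc n} \<subseteq> (\<lambda>(x, xs). x # xs) ` (X \<times> {xs \<in> lists X. length xs = n})"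
      by (auto simp: length_Suc_conv image_def)
    moreover have "|X \<times> {xs \<in> lists X. length xs = n}| \<le>o |X|"
      using assms Suc by (intro card_Times_ordLeq) (auto intro: ordLeq_refl card_of_Card_order)
    ultimately show ?case
      by (meson card_of_image card_of_mono1 ordLeq_transitive)
  qed
  moreover have "lists X = (\<Union>n::nat. {xs \<in> lists X. length xs = n})"
    by auto
  moreover have "|UNIV :: nat set| \<le>o |X|"
    using assms infinite_iff_card_of_nat by blast
  ultimately show ?thesis
    using card_of_UNION_ordLeq_infinite[OF assms, of "UNIV :: nat set" "\<lambda>n. {xs \<in> lists X. length xs = n}"]
    by simp
qed

lemma card_of_finite_subsets_ordLeq:
  assumes "infinite (X :: 'i set)"
  shows "|{A. finite A \<and> A \<subseteq> X}| \<le>o |X|"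
proof -
  have "{A. finite A \<and> A \<subseteq> X} \<subseteq> set ` lists X"
    by (auto simp: image_def lists_eq_set dest: finite_list)
  then show ?thesis
    by (meson assms card_of_image card_of_lists_ordLeq card_of_mono1 ordLeq_transitive)
qed

text \<open>Closure in countably many rounds; no round enlarges the cardinality, since an infinite
  set has no more finite lists than elements.\<close>

lemma set_mapping_closure:
  fixes F :: "'i list \<Rightarrow> 'i set"
  assumes Y: "infinite Y" and F: "\<And>ys. |F ys| \<le>o |Y|"
  obtains Z where "Y \<subseteq> Z" "|Z| \<le>o |Y|" "\<And>ys. set ys \<subseteq> Z \<Longrightarrow> F ys \<subseteq> Z"
proof -
  define Z where "Z = rec_nat Y (\<lambda>_ A. A \<union> (\<Union>ys\<in>lists A. F ys))"
  have Z: "Z 0 = Y" "Z (Suc n) = Z n \<union> (\<Union>ys\<in>lists (Z n). F ys)" for n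
    by (simp_all add: Z_def)
  have sub: "Y \<subseteq> Z n" for n
    by (induction n) (auto simp: Z)
  have card: "|Z n| \<le>o |Y|" for n
  proof (induction n)
    case (Suc n)
    have "infinite (Z n)"
      using sub[of n] Y finite_subset by blast
    then have "|lists (Z n)| \<le>o |Y|"
      using Suc card_of_lists_ordLeq ordLeq_transitive by blast
    then have "|\<Union>ys\<in>lists (Z n). F ys| \<le>o |Y|"
      using Y F by (intro card_of_UNION_ordLeq_infinite) auto
    then show ?case
      using Y Suc by (simp add: Z card_Un_ordLeq)
  qed (auto simp: Z intro: ordLeq_refl card_of_Card_order)
  have mono: "m \<le> n \<Longrightarrow> Z m \<subseteq> Z n" for m n
    by (rule lift_Suc_mono_le) (auto simp: Z)
  have fin: "\<exists>n. set ys \<subseteq> Z n" if "set ys \<subseteq> (\<Union>n. Z n)" for ys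
    using that
  proof (induction ys)
    case (Cons y ys)
    then obtain m n where "y \<in> Z m" "set ys \<subseteq> Z n"
      by auto
    then have "set (y # ys) \<subseteq> Z (max m n)"
      using mono[of m "max m n"] mono[of n "max m n"] by auto
    then show ?case
      by blast
  qed simp
  show ?thesis
  proof (rule that[of "\<Union>n. Z n"])
    show "Y \<subseteq> (\<Union>n. Z n)"
      using sub by blast
    have "|UNIV :: nat set| \<le>o |Y|"
      using Y infinite_iff_card_of_nat by blast
    then show "|\<Union>n. Z n| \<le>o |Y|"
      using card card_of_UNION_ordLeq_infinite[OF Y] by blast
    fix ys assume "set ys \<subseteq> (\<Union>n. Z n)"
    then obtain n where "set ys \<subseteq> Z n"
      using fin by blast
    then have "F ys \<subseteq> Z (Suc n)"
      by (auto simp: Z)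
    then show "F ys \<subseteq> (\<Union>n. Z n)"
      by blast
  qed
qed

text \<open>The last coordinate is chosen first. A set \<open>Y\<close> smaller than
  \<open>X\<close>, but still large enough for the induction, is closed under the mapping that
  guards the last coordinate; a point \<open>x\<close> outside the closure is free over every tuple
  from \<open>Y\<close>. The other coordinates are found inside \<open>Y\<close> by induction, with
  \<open>x\<close> frozen as last argument of their mappings. There is one mapping for each position
  \<open>c\<close> because the faces to which this is applied are coloured.\<close>

lemma kuratowski_free_tuple:
  fixes F :: "nat \<Rightarrow> 'i list \<Rightarrow> 'i set" and X :: "'i set" and \<mu> :: "'m set"
  assumes "infinite \<mu>" "beyond_aleph n \<mu> X" "\<And>c ys. |F c ys| \<le>o |\<mu>|"
  shows "\<exists>xs. set xs \<subseteq> X \<and> length xs = Suc n \<and> (\<forall>c\<le>n. xs ! c \<notin> F c (take c xs @ drop (Suc c) xs))"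
  using assms(2-)
proof (induction n arbitrary: X F)
  case 0
  have "\<not> X \<subseteq> F 0 []"
  proof
    assume "X \<subseteq> F 0 []"
    then have "|X| \<le>o |\<mu>|"
      using 0(2) card_of_mono1 ordLeq_transitive by blast
    then show False
      using 0(1) not_ordLeq_ordLess by auto
  qed
  then obtain x where "x \<in> X" "x \<notin> F 0 []"
    by blast
  then show ?case
    by (intro exI[of _ "[x]"]) auto
next
  case (Suc n)
  \<comment> \<open>The set supplied by \<open>beyond_aleph\<close> need not lie in
    \<open>X\<close>; an injective copy of it does.\<close>
  obtain Y0 :: "'i set" where Y0: "beyond_aleph n \<mu> Y0" "|Y0| <o |X|"
    using Suc.prems(1) by auto
  then obtain f where f: "inj_on f Y0" "f ` Y0 \<subseteq> X"
    using card_of_ordLeq[of Y0 X] ordLess_imp_ordLeq by blast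
  define Y where "Y = f ` Y0"
  have iso: "|Y0| =o |Y|"
    unfolding Y_def by (rule card_of_ordIsoI[OF bij_betw_imageI[OF f(1) refl]])
  have Y: "beyond_aleph n \<mu> Y" "|Y| <o |X|" "Y \<subseteq> X"
    using beyond_aleph_mono[OF Y0(1) ordIso_imp_ordLeq[OF iso]] f(2)
      ordIso_ordLess_trans[OF ordIso_symmetric[OF iso] Y0(2)] by (auto simp: Y_def)
  have \<mu>Y: "|\<mu>| \<le>o |Y|"
    using beyond_aleph_imp_ordLess[OF Y(1)] ordLess_imp_ordLeq by blast
  then have inf: "infinite Y"
    using assms(1) card_of_ordLeq_infinite by blast
  have "|F (Suc n) ys| \<le>o |Y|" for ys
    using Suc.prems(2) \<mu>Y ordLeq_transitive by blast
  then obtain Z where Z: "Y \<subseteq> Z" "|Z| \<le>o |Y|" "\<And>ys. set ys \<subseteq> Z \<Longrightarrow> F (Suc n) ys \<subseteq> Z"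
    using set_mapping_closure[OF inf, of "F (Suc n)"] by blast
  have "\<not> X \<subseteq> Z"
  proof
    assume "X \<subseteq> Z"
    then have "|X| \<le>o |Y|"
      using Z(2) card_of_mono1 ordLeq_transitive by blast
    then show False
      using Y(2) not_ordLeq_ordLess by blast
  qed
  then obtain x where x: "x \<in> X" "x \<notin> Z"
    by blast
  have "\<exists>xs. set xs \<subseteq> Y \<and> length xs = Suc n \<and>
      (\<forall>c\<le>n. xs ! c \<notin> F c ((take c xs @ drop (Suc c) xs) @ [x]))"
    using Y(1) Suc.prems(2) by (intro Suc.IH[of Y "\<lambda>c ys. F c (ys @ [x])"]) auto
  then obtain xs where xs: "set xs \<subseteq> Y" "length xs = Suc n"
    "\<And>c. c \<le> n \<Longrightarrow> xs ! c \<notin> F c ((take c xs @ drop (Suc c) xs) @ [x])"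
    by blast
  have "(xs @ [x]) ! c \<notin> F c (take c (xs @ [x]) @ drop (Suc c) (xs @ [x]))" if "c \<le> Suc n" for c
  proof (cases "c = Suc n")
    case True
    have "F (Suc n) xs \<subseteq> Z"
      using xs(1) Z by blast
    then show ?thesis
      using True xs(2) x by (auto simp: nth_append)
  next
    case False
    then show ?thesis
      using that xs(2) xs(3)[of c] by (simp add: nth_append)
  qed
  then show ?case
    using xs(1,2) x(1) Y(3) by (intro exI[of _ "xs @ [x]"]) auto
qed

section \<open>Initial segments and alephs\<close>

lemma iso_Restr:
  assumes "iso r r' f" "Refl r" "Refl r'" "A \<subseteq> Field r"
  shows "iso (Restr r A) (Restr r' (f ` A)) f"
proof -
  have b: "bij_betw f (Field r) (Field r')"
    and o: "\<forall>a\<in>Field r. \<forall>b\<in>Field r. (a, b) \<in> r \<longleftrightarrow> (f a, f b) \<in> r'"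
    using assms(1) by (auto simp: iso_iff2)
  have A': "f ` A \<subseteq> Field r'"
    using b assms(4) by (auto simp: bij_betw_def)
  have "Field (Restr r A) = A" "Field (Restr r' (f ` A)) = f ` A"
    using assms A' by (auto simp: Refl_Field_Restr2)
  moreover have "bij_betw f A (f ` A)"
    using b assms(4) by (meson bij_betw_def inj_on_subset)
  moreover have "(a, b) \<in> r \<longleftrightarrow> (f a, f b) \<in> r'" if "a \<in> A" "b \<in> A" for a b
    using o assms(4) that by blast
  ultimately show ?thesis
    by (simp add: iso_iff2)
qed

lemma Well_order_Refl: "Well_order r \<Longrightarrow> Refl r"
  by (simp add: order_on_defs)

lemma Field_Restr_underS: "Well_order r \<Longrightarrow> Field (Restr r (underS r a)) = underS r a"
  by (rule Refl_Field_Restr2[OF Well_order_Refl]) (auto dest: underS_Field)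

lemma underS_Restr_underS:
  assumes "Well_order r" "x \<in> underS r a"
  shows "underS (Restr r (underS r a)) x = underS r x"
proof -
  have "trans r" "antisym r"
    using assms(1) by (simp_all add: order_on_defs)
  then show ?thesis
    using assms(2) unfolding underS_def trans_def antisym_def by blast
qed

lemma underS_subset:
  assumes "Well_order r" "(x, y) \<in> r"
  shows "underS r x \<subseteq> underS r y"
proof -
  have "trans r" "antisym r"
    using assms(1) by (simp_all add: order_on_defs)
  then show ?thesis
    using assms(2) unfolding underS_def trans_def antisym_def by blast
qed

lemma infinite_cardinals_below_Restr:
  assumes "Well_order r"
  shows "infinite_cardinals_below (Restr r (underS r a)) = infinite_cardinals_below r \<inter> underS r a"
proof -
  have "Restr (Restr r (underS r a)) (underS r x) = Restr r (underS r x)" if "x \<in> underS r a" for x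
    using underS_subset[OF assms, of x a] that by (auto simp: underS_def)
  then show ?thesis
    using assms underS_Field[of _ r a]
    by (auto simp: infinite_cardinals_below_def Field_Restr_underS underS_Restr_underS)
qed

lemma infinite_cardinals_below_iso:
  assumes f: "iso r r' f" and wo: "Well_order r" "Well_order r'"
  shows "f ` infinite_cardinals_below r = infinite_cardinals_below r'"
proof -
  have rf: "Refl r" "Refl r'"
    using wo by (simp_all add: Well_order_Refl)
  have b: "bij_betw f (Field r) (Field r')"
    using f by (auto simp: iso_iff2)
  have mem: "f a \<in> infinite_cardinals_below r' \<longleftrightarrow> a \<in> infinite_cardinals_below r" if a: "a \<in> Field r" for a
  proof -
    have "embed r r' f"
      using f by (simp add: iso_def)
    then have u: "bij_betw f (underS r a) (underS r' (f a))"
      using embed_underS[OF wo(1)] a by blast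
    then have im: "f ` underS r a = underS r' (f a)"
      by (simp add: bij_betw_def)
    have "iso (Restr r (underS r a)) (Restr r' (underS r' (f a))) f"
      using iso_Restr[OF f rf, of "underS r a"] im underS_Field[of _ r a] by (metis subsetI)
    then have "Restr r (underS r a) =o Restr r' (underS r' (f a))"
      using wo by (auto simp: ordIso_def Well_order_Restr)
    then have "Card_order (Restr r (underS r a)) \<longleftrightarrow> Card_order (Restr r' (underS r' (f a)))"
      by (metis Card_order_ordIso ordIso_symmetric)
    moreover have "finite (underS r a) \<longleftrightarrow> finite (underS r' (f a))"
      using u by (rule bij_betw_finite)
    moreover have "f a \<in> Field r'"
      using b a by (auto simp: bij_betw_def)
    ultimately show ?thesis
      using a by (simp add: infinite_cardinals_below_def)
  qed
  have "infinite_cardinals_below r \<subseteq> Field r" "infinite_cardinals_below r' \<subseteq> f ` Field r"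
    using b by (auto simp: infinite_cardinals_below_def bij_betw_def)
  then show ?thesis
    using mem by blast
qed

text \<open>If \<kappa> were smaller, it would be the initial segment of \<kappa>' at some point
  \<open>a\<close>, and \<open>a\<close> would itself be an infinite cardinal below \<kappa>'. The
  infinite cardinals below \<kappa> would then form a proper initial segment of those below
  \<kappa>', although both have order type \<alpha>.\<close>

lemma is_aleph_not_less:
  assumes "is_aleph \<alpha> \<kappa>" "is_aleph \<alpha> \<kappa>'"
  shows "\<not> \<kappa> <o \<kappa>'"
proof
  assume less: "\<kappa> <o \<kappa>'"
  have c: "Card_order \<kappa>" "Card_order \<kappa>'" and inf: "infinite (Field \<kappa>)"
    and i: "Restr \<kappa> (infinite_cardinals_below \<kappa>) =o \<alpha>" "Restr \<kappa>' (infinite_cardinals_below \<kappa>') =o \<alpha>"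
    using assms by (auto simp: is_aleph_def)
  then have wo: "Well_order \<kappa>" "Well_order \<kappa>'"
    by (auto simp: card_order_on_def)
  obtain a where a: "a \<in> Field \<kappa>'" "\<kappa> =o Restr \<kappa>' (underS \<kappa>' a)"
    using less wo ordLess_iff_ordIso_Restr by blast
  let ?\<nu> = "Restr \<kappa>' (underS \<kappa>' a)" and ?r = "Restr \<kappa>' (infinite_cardinals_below \<kappa>')"
  have wo\<nu>: "Well_order ?\<nu>"
    using wo by (simp add: Well_order_Restr)
  obtain f where f: "iso \<kappa> ?\<nu> f"
    using a(2) by (auto simp: ordIso_def)
  have "Card_order ?\<nu>"
    using a(2) c(1) Card_order_ordIso ordIso_symmetric by blast
  moreover have "infinite (underS \<kappa>' a)"
    using f inf by (metis Field_Restr_underS bij_betw_finite iso_iff2 wo(2))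
  ultimately have aK: "a \<in> infinite_cardinals_below \<kappa>'"
    using a(1) by (simp add: infinite_cardinals_below_def)
  have sub: "infinite_cardinals_below \<kappa> \<subseteq> Field \<kappa>" "infinite_cardinals_below \<kappa>' \<subseteq> Field \<kappa>'"
    by (auto simp: infinite_cardinals_below_def)
  have wor: "Well_order ?r"
    using wo by (intro Well_order_Restr)
  have fr: "Field ?r = infinite_cardinals_below \<kappa>'"
    using wo sub by (intro Refl_Field_Restr2 Well_order_Refl)
  have "iso (Restr \<kappa> (infinite_cardinals_below \<kappa>)) (Restr ?\<nu> (infinite_cardinals_below ?\<nu>)) f"
    using iso_Restr[OF f Well_order_Refl[OF wo(1)] Well_order_Refl[OF wo\<nu>] sub(1)]
      infinite_cardinals_below_iso[OF f wo(1) wo\<nu>] by metis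
  then have "Restr \<kappa> (infinite_cardinals_below \<kappa>) =o Restr ?\<nu> (infinite_cardinals_below ?\<nu>)"
    using wo wo\<nu> by (auto simp: ordIso_def Well_order_Restr)
  also have "Restr ?\<nu> (infinite_cardinals_below ?\<nu>) = Restr ?r (underS ?r a)"
    using aK unfolding infinite_cardinals_below_Restr[OF wo(2)] by (auto simp: underS_def)
  also have "Restr ?r (underS ?r a) <o ?r"
    using underS_Restr_ordLess[OF wor] aK fr by blast
  finally have "Restr \<kappa> (infinite_cardinals_below \<kappa>) <o ?r" .
  moreover have "Restr \<kappa> (infinite_cardinals_below \<kappa>) =o ?r"
    using i ordIso_transitive ordIso_symmetric by blast
  ultimately show False
    using not_ordLess_ordIso by blast
qed

lemma is_aleph_unique:
  assumes "is_aleph \<alpha> \<kappa>" "is_aleph \<alpha> \<kappa>'"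
  shows "\<kappa> =o \<kappa>'"
proof -
  have "Well_order \<kappa>" "Well_order \<kappa>'"
    using assms by (auto simp: is_aleph_def card_order_on_def)
  then show ?thesis
    using is_aleph_not_less[OF assms] is_aleph_not_less[OF assms(2,1)]
    by (meson not_ordLess_iff_ordLeq ordIso_iff_ordLeq)
qed

lemma Field_ord_plus_nat:
  assumes "Refl \<alpha>"
  shows "Field (ord_plus_nat \<alpha> l) = Inl ` Field \<alpha> \<union> Inr ` {..<l}"
  using assms by (fastforce simp: ord_plus_nat_def Field_def refl_on_def)

text \<open>The infinite cardinals below \<open>lam\<close> have order type \<alpha> + l. The last l
  of them are \<mu> and its first l - 1 successors, and \<open>lam\<close> itself closes the chain
  as \<open>A l\<close>.\<close>

lemma aleph_chain:
  fixes \<mu> :: "'m rel" and lam :: "'i rel"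
  assumes \<alpha>: "Well_order \<alpha>" and l: "l > 0" and \<mu>: "card_order \<mu>" "is_aleph \<alpha> \<mu>"
    and lam: "card_order lam" "is_aleph (ord_plus_nat \<alpha> l) lam"
  obtains A :: "nat \<Rightarrow> 'i set" where "|A 0| =o |UNIV :: 'm set|" "A l = UNIV"
    "\<And>n. n < l \<Longrightarrow> |A n| <o |A (Suc n)|" "\<And>n. n < l \<Longrightarrow> |A (Suc n)| \<le>o cardSuc |A n|"
proof -
  let ?\<beta> = "ord_plus_nat \<alpha> l" and ?K = "infinite_cardinals_below lam"
  have wo: "Well_order lam" and co: "Card_order lam" and fl: "Field lam = UNIV"
    using lam Field_card_order by (auto simp: is_aleph_def card_order_on_def)
  have lamU: "lam =o |UNIV :: 'i set|"
    using lam(1) card_of_unique ordIso_symmetric by blast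
  have tr: "trans lam" and an: "antisym lam" and tot: "Total lam"
    using wo by (simp_all add: order_on_defs)
  have f\<beta>: "Field ?\<beta> = Inl ` Field \<alpha> \<union> Inr ` {..<l}"
    using \<alpha> by (simp add: Field_ord_plus_nat Well_order_Refl)
  have fK: "Field (Restr lam ?K) = ?K"
    by (rule Refl_Field_Restr2[OF Well_order_Refl[OF wo]]) (simp add: fl)
  have "?\<beta> =o Restr lam ?K"
    using lam(2) ordIso_symmetric by (auto simp: is_aleph_def)
  then obtain g where g: "iso ?\<beta> (Restr lam ?K) g"
    by (auto simp: ordIso_def)
  then have bij: "bij_betw g (Field ?\<beta>) ?K"
    and ord: "\<And>a b. a \<in> Field ?\<beta> \<Longrightarrow> b \<in> Field ?\<beta> \<Longrightarrow> (a, b) \<in> ?\<beta> \<longleftrightarrow> (g a, g b) \<in> Restr lam ?K"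
    using fK by (auto simp: iso_iff2)
  have gK: "g a \<in> ?K" if "a \<in> Field ?\<beta>" for a
    using bij that by (auto simp: bij_betw_def)
  have ord': "(a, b) \<in> ?\<beta> \<longleftrightarrow> (g a, g b) \<in> lam" if "a \<in> Field ?\<beta>" "b \<in> Field ?\<beta>" for a b
    using ord[OF that] gK that by auto
  have inj: "g a = g b \<longleftrightarrow> a = b" if "a \<in> Field ?\<beta>" "b \<in> Field ?\<beta>" for a b
    using bij that by (auto simp: bij_betw_def inj_on_def)
  define \<kappa> where "\<kappa> n = g (Inr n)" for n
  have \<kappa>K: "\<kappa> n \<in> ?K" if "n < l" for n
    using gK that by (auto simp: \<kappa>_def f\<beta>)
  have \<kappa>card: "Card_order (Restr lam (underS lam (\<kappa> n)))" "infinite (underS lam (\<kappa> n))" if "n < l" for n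
    using \<kappa>K[OF that] by (auto simp: infinite_cardinals_below_def)
  have \<kappa>less: "(\<kappa> m, \<kappa> n) \<in> lam \<longleftrightarrow> m \<le> n" if "m < l" "n < l" for m n
    using ord'[of "Inr m" "Inr n"] that by (simp add: \<kappa>_def f\<beta>) (auto simp: ord_plus_nat_def)
  have \<kappa>neq: "\<kappa> m = \<kappa> n \<longleftrightarrow> m = n" if "m < l" "n < l" for m n
    using inj[of "Inr m" "Inr n"] that by (simp add: \<kappa>_def f\<beta>)
  have above: "\<exists>m. n < m \<and> m < l \<and> y = \<kappa> m" if n: "n < l" and y: "y \<in> ?K" "(\<kappa> n, y) \<in> lam" "y \<noteq> \<kappa> n" for n y
  proof -
    obtain b where b: "b \<in> Field ?\<beta>" "y = g b"
      using y(1) bij by (auto simp: bij_betw_def)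
    then have "(Inr n, b) \<in> ?\<beta>"
      using ord'[of "Inr n" b] n y by (auto simp: \<kappa>_def f\<beta>)
    then obtain m where "b = Inr m" "n \<le> m" "m < l"
      by (auto simp: ord_plus_nat_def)
    then show ?thesis
      using b y(3) by (auto simp: \<kappa>_def le_less)
  qed
  define A where "A n = (if n < l then underS lam (\<kappa> n) else UNIV)" for n
  have cardA: "Restr lam (underS lam (\<kappa> n)) =o |A n|" if "n < l" for n
    using card_of_Field_ordIso[OF \<kappa>card(1)[OF that]] that ordIso_symmetric
    by (simp add: A_def Field_Restr_underS wo)
  \<comment> \<open>Exactly the copy of \<alpha> lies below the first added point, so the segment
    there is an aleph of index \<alpha>, and such alephs are unique.\<close>
  have "|A 0| =o |UNIV :: 'm set|"
  proof -
    let ?\<nu> = "Restr lam (underS lam (\<kappa> 0))"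
    have "?K \<inter> underS lam (\<kappa> 0) = (g \<circ> Inl) ` Field \<alpha>"
    proof (intro equalityI subsetI)
      fix y assume y: "y \<in> ?K \<inter> underS lam (\<kappa> 0)"
      then obtain b where b: "b \<in> Field ?\<beta>" "y = g b"
        using bij by (auto simp: bij_betw_def)
      have "b \<noteq> Inr n" for n
      proof
        assume n: "b = Inr n"
        then have "n < l" "(\<kappa> n, \<kappa> 0) \<in> lam" "\<kappa> n \<noteq> \<kappa> 0"
          using b y by (auto simp: f\<beta> underS_def \<kappa>_def)
        then show False
          using \<kappa>less[of n 0] l by auto
      qed
      then show "y \<in> (g \<circ> Inl) ` Field \<alpha>"
        using b by (auto simp: f\<beta>)
    next
      fix y assume "y \<in> (g \<circ> Inl) ` Field \<alpha>"
      then obtain x where x: "x \<in> Field \<alpha>" "y = g (Inl x)"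
        by auto
      have "(Inl x, Inr 0) \<in> ?\<beta>"
        using x l by (auto simp: ord_plus_nat_def)
      then show "y \<in> ?K \<inter> underS lam (\<kappa> 0)"
        using x l gK[of "Inl x"] ord'[of "Inl x" "Inr 0"] inj[of "Inl x" "Inr 0"]
        by (auto simp: f\<beta> underS_def \<kappa>_def)
    qed
    then have icb: "infinite_cardinals_below ?\<nu> = (g \<circ> Inl) ` Field \<alpha>"
      using infinite_cardinals_below_Restr[OF wo] by metis
    have sub: "(g \<circ> Inl) ` Field \<alpha> \<subseteq> underS lam (\<kappa> 0)"
      using icb infinite_cardinals_below_Restr[OF wo, of "\<kappa> 0"] by blast
    have "iso \<alpha> (Restr ?\<nu> (infinite_cardinals_below ?\<nu>)) (g \<circ> Inl)"
      unfolding iso_iff2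
    proof (intro conjI ballI)
      have "Field (Restr ?\<nu> (infinite_cardinals_below ?\<nu>)) = infinite_cardinals_below ?\<nu>"
        using sub icb Field_Restr_underS[OF wo, of "\<kappa> 0"]
        by (intro Refl_Field_Restr2[OF Well_order_Refl[OF Well_order_Restr[OF wo]]]) simp
      moreover have "inj_on (g \<circ> Inl) (Field \<alpha>)"
        using inj by (auto simp: inj_on_def f\<beta>)
      ultimately show "bij_betw (g \<circ> Inl) (Field \<alpha>) (Field (Restr ?\<nu> (infinite_cardinals_below ?\<nu>)))"
        by (simp add: icb bij_betw_def)
      fix a b assume ab: "a \<in> Field \<alpha>" "b \<in> Field \<alpha>"
      have "(a, b) \<in> \<alpha> \<longleftrightarrow> (Inl a, Inl b) \<in> ?\<beta>"
        by (auto simp: ord_plus_nat_def)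
      then show "(a, b) \<in> \<alpha> \<longleftrightarrow> ((g \<circ> Inl) a, (g \<circ> Inl) b) \<in> Restr ?\<nu> (infinite_cardinals_below ?\<nu>)"
        using ab sub ord'[of "Inl a" "Inl b"] unfolding icb by (auto simp: f\<beta>)
    qed
    then have "\<alpha> =o Restr ?\<nu> (infinite_cardinals_below ?\<nu>)"
      using \<alpha> wo by (auto simp: ordIso_def Well_order_Restr)
    then have "is_aleph \<alpha> ?\<nu>"
      using \<kappa>card[OF l] ordIso_symmetric by (auto simp: is_aleph_def Field_Restr_underS wo)
    then have "?\<nu> =o \<mu>"
      using \<mu>(2) by (rule is_aleph_unique)
    also have "\<mu> =o |UNIV :: 'm set|"
      using \<mu>(1) by (rule card_of_unique)
    finally show ?thesis
      using ordIso_transitive[OF ordIso_symmetric[OF cardA[OF l]]] by blast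
  qed
  moreover have "|A n| <o |A (Suc n)|" if n: "n < l" for n
  proof (cases "Suc n < l")
    case True
    let ?\<nu> = "Restr lam (underS lam (\<kappa> (Suc n)))"
    have u: "\<kappa> n \<in> underS lam (\<kappa> (Suc n))"
      using \<kappa>less[of n "Suc n"] \<kappa>neq[of n "Suc n"] True by (auto simp: underS_def)
    have "|underS ?\<nu> (\<kappa> n)| <o ?\<nu>"
      using u by (intro card_of_underS \<kappa>card True) (simp add: Field_Restr_underS wo)
    then have "|underS lam (\<kappa> n)| <o |A (Suc n)|"
      using ordLess_ordIso_trans[OF _ cardA[OF True]] by (simp add: underS_Restr_underS[OF wo u])
    then show ?thesis
      using n by (simp add: A_def)
  next
    case False
    have "|underS lam (\<kappa> n)| <o lam"
      using co by (intro card_of_underS) (auto simp: fl)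
    then show ?thesis
      using False n ordLess_ordIso_trans[OF _ lamU] by (simp add: A_def)
  qed
  \<comment> \<open>If the successor of \<open>|A n|\<close> were smaller than
    \<open>|A (Suc n)|\<close>, it would be an infinite cardinal below \<open>lam\<close> and beyond
    \<open>\<kappa> n\<close>, hence some \<open>\<kappa> m\<close> with m > n, whose segment
    already contains \<open>A (Suc n)\<close>.\<close>
  moreover have "|A (Suc n)| \<le>o cardSuc |A n|" if n: "n < l" for n
  proof (rule ccontr)
    let ?c = "cardSuc |A n|"
    have c: "Card_order ?c" "|A n| <o ?c"
      by (simp_all add: cardSuc_Card_order cardSuc_greater card_of_Card_order)
    assume "\<not> |A (Suc n)| \<le>o ?c"
    then have less: "?c <o |A (Suc n)|"
      using not_ordLeq_iff_ordLess[OF card_order_on_well_order_on[OF c(1)] card_of_Well_order] by blast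
    also have "|A (Suc n)| \<le>o |UNIV :: 'i set|"
      by (rule card_of_mono1) simp
    also have "|UNIV :: 'i set| =o lam"
      using lamU ordIso_symmetric by blast
    finally have "?c <o lam" .
    then obtain y where y: "?c =o Restr lam (underS lam y)"
      using ordLess_iff_ordIso_Restr[OF wo card_order_on_well_order_on[OF c(1)]] by blast
    have cy: "Card_order (Restr lam (underS lam y))"
      using Card_order_ordIso[OF c(1) ordIso_symmetric[OF y]] .
    have "|underS lam y| =o Restr lam (underS lam y)"
      using card_of_Field_ordIso[OF cy] by (simp add: Field_Restr_underS wo)
    then have cy': "|underS lam y| =o ?c"
      using ordIso_symmetric[OF y] by (rule ordIso_transitive)
    then have An: "|A n| <o |underS lam y|"
      using ordLess_ordIso_trans[OF c(2) ordIso_symmetric[OF cy']] by simp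
    have "infinite (underS lam y)"
      using card_of_ordLeq_infinite[OF ordLess_imp_ordLeq[OF An]] \<kappa>card(2)[OF n] n by (simp add: A_def)
    then have yK: "y \<in> ?K"
      using cy by (simp add: infinite_cardinals_below_def fl)
    have "(y, \<kappa> n) \<notin> lam"
    proof
      assume "(y, \<kappa> n) \<in> lam"
      then have "|underS lam y| \<le>o |A n|"
        using underS_subset[OF wo] n by (auto simp: A_def intro: card_of_mono1)
      then show False
        using An not_ordLeq_ordLess by blast
    qed
    moreover have "(\<kappa> n, \<kappa> n) \<in> lam"
      using \<kappa>less n by blast
    ultimately have y: "(\<kappa> n, y) \<in> lam" "y \<noteq> \<kappa> n"
      using tot fl unfolding total_on_def by (metis UNIV_I)+
    then obtain m where m: "n < m" "m < l" "y = \<kappa> m"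
      using above[OF n yK y] by blast
    then have "A (Suc n) \<subseteq> underS lam y"
      using underS_subset[OF wo, of "\<kappa> (Suc n)" "\<kappa> m"] \<kappa>less[of "Suc n" m] by (auto simp: A_def)
    then have "|A (Suc n)| \<le>o ?c"
      using ordLeq_ordIso_trans[OF card_of_mono1 cy'] by blast
    then show False
      using less not_ordLeq_ordLess by blast
  qed
  ultimately show ?thesis
    by (intro that[of A]) (auto simp: A_def)
qed

lemma aleph_bounds:
  fixes \<mu> :: "'m rel" and lam :: "'i rel"
  assumes "Well_order \<alpha>" "l > 0" "card_order \<mu>" "is_aleph \<alpha> \<mu>"
    and "card_order lam" "is_aleph (ord_plus_nat \<alpha> l) lam"
  shows "infinite (UNIV :: 'm set)" "infinite (UNIV :: 'i set)" "|UNIV :: 'm set| \<le>o |UNIV :: 'i set|"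
    "at_most_aleph l (UNIV :: 'm set) (UNIV :: 'i set)"
    "beyond_aleph (l - 1) (UNIV :: 'm set) (UNIV :: 'i set)"
proof -
  obtain A :: "nat \<Rightarrow> 'i set" where A: "|A 0| =o |UNIV :: 'm set|" "A l = UNIV"
    "\<And>n. n < l \<Longrightarrow> |A n| <o |A (Suc n)|" "\<And>n. n < l \<Longrightarrow> |A (Suc n)| \<le>o cardSuc |A n|"
    using aleph_chain[OF assms] by metis
  have "Field \<mu> = UNIV" "Field lam = UNIV"
    using assms by (auto simp: Field_card_order)
  then show "infinite (UNIV :: 'm set)" "infinite (UNIV :: 'i set)"
    using assms by (auto simp: is_aleph_def)
  have "at_most_aleph n (UNIV :: 'm set) (A n)" if "n \<le> l" for n
    using that
  proof (induction n)
    case 0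
    show ?case
      using A(1) by (simp add: ordIso_imp_ordLeq)
  next
    case (Suc n)
    then show ?case
      using A(4)[of n] by auto
  qed
  then show "at_most_aleph l (UNIV :: 'm set) (UNIV :: 'i set)"
    using A(2) by (metis order_refl)
  have "beyond_aleph n (UNIV :: 'm set) (A (Suc n))" if "n < l" for n
    using that
  proof (induction n)
    case 0
    then show ?case
      using A(1,3) ordIso_ordLess_trans ordIso_symmetric by fastforce
  next
    case (Suc n)
    then show ?case
      using A(3)[of "Suc n"] by auto
  qed
  from this[of "l - 1"] show b: "beyond_aleph (l - 1) (UNIV :: 'm set) (UNIV :: 'i set)"
    using A(2) assms(2) by simp
  have "|UNIV :: 'm set| <o |X|" if "beyond_aleph n (UNIV :: 'm set) X" for n and X :: "'i set"
    using that by (induction n arbitrary: X) (auto intro: ordLess_transitive)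
  then show "|UNIV :: 'm set| \<le>o |UNIV :: 'i set|"
    using b ordLess_imp_ordLeq by blast
qed

section \<open>Hypergraphs\<close>

text \<open>For a symmetric irreflexive relation the underlying sets of the tuples carry all the
  information (\<open>hypergraph_Rel\<close>); the later arguments are about these sets.\<close>

definition edges :: "'a rstruct \<Rightarrow> 'a set set" where
  "edges M = set ` Rel M"

text \<open>The forbidden cliques have m + 1 = k + 2 vertices, as m = k + 1 here.\<close>

definition hypergraph :: "nat \<Rightarrow> 'a rstruct \<Rightarrow> bool" where
  "hypergraph k M \<longleftrightarrow> is_struct (k+1) M \<and> (\<forall>xs\<in>Rel M. distinct xs) \<and>
     (\<forall>xs ys. xs \<in> Rel M \<longrightarrow> length ys = k+1 \<longrightarrow> set ys = set xs \<longrightarrow> ys \<in> Rel M) \<and>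
     \<not> (\<exists>y\<subseteq>Univ M. card y = k+2 \<and> (\<forall>e\<subseteq>y. card e = k+1 \<longrightarrow> e \<in> edges M))"

lemma hypergraph_edges:
  assumes "hypergraph k M" "e \<in> edges M"
  shows "e \<subseteq> Univ M" "card e = k+1" "finite e"
proof -
  obtain xs where xs: "xs \<in> Rel M" "e = set xs"
    using assms(2) by (auto simp: edges_def)
  then have "length xs = k+1" "set xs \<subseteq> Univ M" "distinct xs"
    using assms(1) by (auto simp: hypergraph_def is_struct_def)
  then show "e \<subseteq> Univ M" "card e = k+1" "finite e"
    by (simp_all add: xs(2) distinct_card)
qed

lemma hypergraph_Rel:
  assumes "hypergraph k M"
  shows "xs \<in> Rel M \<longleftrightarrow> length xs = k+1 \<and> set xs \<in> edges M"
proof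
  show "xs \<in> Rel M \<Longrightarrow> length xs = k+1 \<and> set xs \<in> edges M"
    using assms by (auto simp: hypergraph_def is_struct_def edges_def)
  show "length xs = k+1 \<and> set xs \<in> edges M \<Longrightarrow> xs \<in> Rel M"
    using assms unfolding hypergraph_def edges_def by (metis imageE)
qed

lemma hypergraph_no_clique:
  assumes "hypergraph k M" "y \<subseteq> Univ M" "card y = k+2"
  shows "\<exists>e\<subseteq>y. card e = k+1 \<and> e \<notin> edges M"
  using assms unfolding hypergraph_def by blast

section \<open>Formulas and the axioms of the hypergraph theory\<close>

lemma sat_cong: "(\<And>x. x \<in> fv \<phi> \<Longrightarrow> e x = e' x) \<Longrightarrow> sat M e \<phi> \<longleftrightarrow> sat M e' \<phi>"
proof (induction \<phi> arbitrary: e e')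
  case (FRel xs)
  then have "map e xs = map e' xs"
    by simp
  then show ?case
    by (simp del: map_eq_conv)
next
  case (FImp \<phi> \<psi>)
  have "sat M e \<phi> \<longleftrightarrow> sat M e' \<phi>" "sat M e \<psi> \<longleftrightarrow> sat M e' \<psi>"
    by (rule FImp.IH; rule FImp.prems; simp)+
  then show ?case
    by simp
next
  case (FAll x \<phi>)
  have "sat M (e(x := a)) \<phi> \<longleftrightarrow> sat M (e'(x := a)) \<phi>" for a
    by (rule FAll.IH) (use FAll.prems in simp)
  then show ?case
    by simp
qed simp_all

lemma finite_fv [simp]: "finite (fv \<phi>)"
  by (induction \<phi>) auto

lemma sat_forall_closure:
  "sat M e (forall_closure xs \<phi>) \<longleftrightarrow>
     (\<forall>e'. (\<forall>x. x \<notin> set xs \<longrightarrow> e' x = e x) \<and> (\<forall>x\<in>set xs. e' x \<in> Univ M) \<longrightarrow> sat M e' \<phi>)"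
proof (induction xs arbitrary: e)
  case Nil
  show ?case
    by (simp add: forall_closure_def fun_eq_iff[symmetric])
next
  case (Cons x xs)
  have "sat M e (forall_closure (x # xs) \<phi>) \<longleftrightarrow> (\<forall>a\<in>Univ M. sat M (e(x := a)) (forall_closure xs \<phi>))"
    by (simp add: forall_closure_def)
  also have "\<dots> \<longleftrightarrow> (\<forall>a\<in>Univ M. \<forall>e'. (\<forall>y. y \<notin> set xs \<longrightarrow> e' y = (e(x := a)) y) \<and>
      (\<forall>y\<in>set xs. e' y \<in> Univ M) \<longrightarrow> sat M e' \<phi>)"
    by (simp only: Cons.IH)
  also have "\<dots> \<longleftrightarrow> (\<forall>e'. (\<forall>y. y \<notin> set (x # xs) \<longrightarrow> e' y = e y) \<and> (\<forall>y\<in>set (x # xs). e' y \<in> Univ M) \<longrightarrow> sat M e' \<phi>)"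
  proof (intro iffI allI impI ballI)
    fix e' assume *: "\<forall>a\<in>Univ M. \<forall>e'. (\<forall>y. y \<notin> set xs \<longrightarrow> e' y = (e(x := a)) y) \<and>
      (\<forall>y\<in>set xs. e' y \<in> Univ M) \<longrightarrow> sat M e' \<phi>"
      and e': "(\<forall>y. y \<notin> set (x # xs) \<longrightarrow> e' y = e y) \<and> (\<forall>y\<in>set (x # xs). e' y \<in> Univ M)"
    show "sat M e' \<phi>"
    proof (rule mp[OF spec[OF bspec[OF *]]])
      show "e' x \<in> Univ M"
        using e' by simp
      show "(\<forall>y. y \<notin> set xs \<longrightarrow> e' y = (e(x := e' x)) y) \<and> (\<forall>y\<in>set xs. e' y \<in> Univ M)"
        using e' by (metis fun_upd_apply insert_iff list.simps(15))
    qed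
  next
    fix a e' assume *: "\<forall>e'. (\<forall>y. y \<notin> set (x # xs) \<longrightarrow> e' y = e y) \<and> (\<forall>y\<in>set (x # xs). e' y \<in> Univ M) \<longrightarrow> sat M e' \<phi>"
      and a: "a \<in> Univ M" and e': "(\<forall>y. y \<notin> set xs \<longrightarrow> e' y = (e(x := a)) y) \<and> (\<forall>y\<in>set xs. e' y \<in> Univ M)"
    have "e' x \<in> Univ M"
      using e' a by (cases "x \<in> set xs") auto
    show "sat M e' \<phi>"
    proof (rule mp[OF spec[OF *]])
      show "(\<forall>y. y \<notin> set (x # xs) \<longrightarrow> e' y = e y) \<and> (\<forall>y\<in>set (x # xs). e' y \<in> Univ M)"
        using e' \<open>e' x \<in> Univ M\<close> by (metis fun_upd_apply insert_iff list.simps(15))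
    qed
  qed
  finally show ?case .
qed

lemma sat_foldr_FImp: "sat M e (foldr FImp \<phi>s \<psi>) \<longleftrightarrow> ((\<forall>\<phi>\<in>set \<phi>s. sat M e \<phi>) \<longrightarrow> sat M e \<psi>)"
  by (induction \<phi>s) auto

text \<open>An environment on the variables bound by an axiom is an enumeration of vertices. Lists
  of vertices therefore enter as environments \<open>(!) xs\<close>, and in the clique axiom the
  subsequences of length k+1 stand for the (k+1)-subsets.\<close>

lemma models_hypergraph_theory:
  "models (k+1) M (hypergraph_theory (k+1) k) \<longleftrightarrow> hypergraph k M" (is "?L \<longleftrightarrow> ?R")
proof -
  let ?n = "[0..<k+1]" and ?n' = "[0..<k+2]"
  have env: "(\<forall>e. sat M e (forall_closure [0..<n] \<phi>)) \<longleftrightarrow>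
      (\<forall>e. (\<forall>x<n. e x \<in> Univ M) \<longrightarrow> sat M e \<phi>)" for n \<phi>
  proof (intro iffI allI impI)
    fix e assume *: "\<forall>e. sat M e (forall_closure [0..<n] \<phi>)" and e: "\<forall>x<n. e x \<in> Univ M"
    show "sat M e \<phi>"
      using *[rule_format, of e] e unfolding sat_forall_closure by (elim allE[of _ e]) simp
  next
    fix e assume "\<forall>e. (\<forall>x<n. e x \<in> Univ M) \<longrightarrow> sat M e \<phi>"
    then show "sat M e (forall_closure [0..<n] \<phi>)"
      unfolding sat_forall_closure by simp
  qed
  define irr where "irr \<longleftrightarrow> (\<forall>i j e. i < j \<longrightarrow> j < k+1 \<longrightarrow> (\<forall>x<k+1. e x \<in> Univ M) \<longrightarrow>
      map e ?n \<in> Rel M \<longrightarrow> e i \<noteq> e j)"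
  define sy where "sy \<longleftrightarrow> (\<forall>p e. bij_betw p {..<k+1} {..<k+1} \<longrightarrow> (\<forall>x<k+1. e x \<in> Univ M) \<longrightarrow>
      map e ?n \<in> Rel M \<longrightarrow> map e (map p ?n) \<in> Rel M)"
  define cl where "cl \<longleftrightarrow> (\<forall>e. (\<forall>x<k+2. e x \<in> Univ M) \<longrightarrow> (\<forall>j<k+2. \<forall>i<j. e i \<noteq> e j) \<longrightarrow>
      \<not> (\<forall>w\<in>set (subseqs ?n'). length w = k+1 \<longrightarrow> map e w \<in> Rel M))"
  have "?L \<longleftrightarrow> is_struct (k+1) M \<and> irr \<and> sy \<and> cl"
  proof -
    have 1: "(\<forall>\<phi>\<in>{forall_closure ?n (FImp (FRel ?n) (FNeg (FEq i j))) | i j. i < j \<and> j < k+1}.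
        \<forall>e. sat M e \<phi>) \<longleftrightarrow> irr"
    proof -
      have "(\<forall>\<phi>\<in>{forall_closure ?n (FImp (FRel ?n) (FNeg (FEq i j))) | i j. i < j \<and> j < k+1}. \<forall>e. sat M e \<phi>)
        \<longleftrightarrow> (\<forall>i j. i < j \<and> j < k+1 \<longrightarrow> (\<forall>e. sat M e (forall_closure ?n (FImp (FRel ?n) (FNeg (FEq i j))))))"
        by blast
      then show ?thesis
        unfolding env irr_def sat.simps by blast
    qed
    have 2: "(\<forall>\<phi>\<in>{forall_closure ?n (FImp (FRel ?n) (FRel (map p ?n))) | p. bij_betw p {..<k+1} {..<k+1}}.
        \<forall>e. sat M e \<phi>) \<longleftrightarrow> sy"
    proof -
      have "(\<forall>\<phi>\<in>{forall_closure ?n (FImp (FRel ?n) (FRel (map p ?n))) | p. bij_betw p {..<k+1} {..<k+1}}. \<forall>e. sat M e \<phi>)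
        \<longleftrightarrow> (\<forall>p. bij_betw p {..<k+1} {..<k+1} \<longrightarrow> (\<forall>e. sat M e (forall_closure ?n (FImp (FRel ?n) (FRel (map p ?n))))))"
        by blast
      then show ?thesis
        unfolding env sy_def sat.simps by blast
    qed
    have 3: "(\<forall>e. sat M e (forall_closure ?n' (foldr FImp ([FNeg (FEq i j). j \<leftarrow> ?n', i \<leftarrow> [0..<j]] @
        [FRel w. w \<leftarrow> subseqs ?n', length w = k+1]) FBot))) \<longleftrightarrow> cl"
    proof -
      have a: "(\<forall>\<phi>\<in>set [FNeg (FEq i j). j \<leftarrow> ?n', i \<leftarrow> [0..<j]]. sat M e \<phi>) \<longleftrightarrow>
          (\<forall>j<k+2. \<forall>i<j. e i \<noteq> e j)" for e
        by (auto simp del: upt_Suc)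
      have b: "(\<forall>\<phi>\<in>set [FRel w. w \<leftarrow> subseqs ?n', length w = k+1]. sat M e \<phi>) \<longleftrightarrow>
          (\<forall>w\<in>set (subseqs ?n'). length w = k+1 \<longrightarrow> map e w \<in> Rel M)" for e
        by (auto simp del: upt_Suc)
      show ?thesis
        unfolding env cl_def sat_foldr_FImp set_append ball_Un a b sat.simps by blast
    qed
    have e: "k + 1 + 1 = k + 2"
      by simp
    show ?thesis
      unfolding models_def hypergraph_theory_def ball_Un 1 2 e
      using 3 by (simp del: upt_Suc)
  qed
  also have "\<dots> \<longleftrightarrow> ?R"
  proof (cases "is_struct (k+1) M")
    case True
    then have Rel: "length xs = k+1" "set xs \<subseteq> Univ M" if "xs \<in> Rel M" for xs
      using that by (auto simp: is_struct_def)
    have nth: "map ((!) xs) ?n = xs" if "length xs = k+1" for xs :: "'a list"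
      using map_nth[of xs] that by simp
    have nthU: "\<forall>x<k+1. xs ! x \<in> Univ M" if "xs \<in> Rel M" for xs
      using Rel[OF that] by (metis nth_mem subsetD)
    have irr: "irr \<longleftrightarrow> (\<forall>xs\<in>Rel M. distinct xs)"
    proof
      assume irr
      show "\<forall>xs\<in>Rel M. distinct xs"
      proof
        fix xs assume xs: "xs \<in> Rel M"
        have "xs ! i \<noteq> xs ! j" if "i < j" "j < k+1" for i j
          using \<open>irr\<close>[unfolded irr_def, THEN spec[of _ i], THEN spec[of _ j], THEN spec[of _ "(!) xs"]]
            that nth[OF Rel(1)[OF xs]] nthU[OF xs] xs by simp
        then show "distinct xs"
          using Rel[OF xs] unfolding distinct_conv_nth by (metis nat_neq_iff)
      qed
    next
      assume d: "\<forall>xs\<in>Rel M. distinct xs"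
      show irr
        unfolding irr_def
      proof (intro allI impI)
        fix i j and e :: "nat \<Rightarrow> 'a" assume ij: "i < j" "j < k+1" and "map e ?n \<in> Rel M"
        then have "distinct (map e ?n)"
          using d by blast
        then show "e i \<noteq> e j"
          using ij by (metis (no_types) atLeast_upt distinct_map inj_on_eq_iff less_trans lessThan_iff less_irrefl)
      qed
    qed
    have sy: "sy \<longleftrightarrow> (\<forall>xs ys. xs \<in> Rel M \<longrightarrow> length ys = k+1 \<longrightarrow> set ys = set xs \<longrightarrow> ys \<in> Rel M)"
      if d: "\<forall>xs\<in>Rel M. distinct xs"
    proof
      assume sy
      show "\<forall>xs ys. xs \<in> Rel M \<longrightarrow> length ys = k+1 \<longrightarrow> set ys = set xs \<longrightarrow> ys \<in> Rel M"
      proof (intro allI impI)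
        fix xs ys assume xs: "xs \<in> Rel M" and ys: "length ys = k+1" "set ys = set xs"
        have dx: "distinct xs"
          using d xs by blast
        have dy: "distinct ys"
          using dx ys Rel(1)[OF xs] by (metis card_distinct distinct_card)
        have bx: "bij_betw ((!) xs) {..<k+1} (set xs)"
          using dx Rel(1)[OF xs] by (intro bij_betw_nth) auto
        have by': "bij_betw ((!) ys) {..<k+1} (set xs)"
          using dy ys by (intro bij_betw_nth) auto
        \<comment> \<open>The permutation of positions that turns the enumeration \<open>xs\<close>
          into \<open>ys\<close>.\<close>
        define p where "p = inv_into {..<k+1} ((!) xs) \<circ> (!) ys"
        have "bij_betw p {..<k+1} {..<k+1}"
          unfolding p_def using by' bij_betw_inv_into[OF bx] by (rule bij_betw_trans)
        then have "map ((!) xs) (map p ?n) \<in> Rel M"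
          using \<open>sy\<close>[unfolded sy_def, THEN spec[of _ p], THEN spec[of _ "(!) xs"]]
            nth[OF Rel(1)[OF xs]] nthU[OF xs] xs by metis
        moreover have "map ((!) xs) (map p ?n) = map ((!) ys) ?n"
        proof -
          have "xs ! p i = ys ! i" if "i < k+1" for i
            using that bij_betw_inv_into_right[OF bx, of "ys ! i"] by' by (auto simp: p_def bij_betw_def)
          then show ?thesis
            by (simp del: upt_Suc)
        qed
        ultimately show "ys \<in> Rel M"
          using nth[OF ys(1)] by metis
      qed
    next
      assume s: "\<forall>xs ys. xs \<in> Rel M \<longrightarrow> length ys = k+1 \<longrightarrow> set ys = set xs \<longrightarrow> ys \<in> Rel M"
      show sy
        unfolding sy_def
      proof (intro allI impI)
        fix p and e :: "nat \<Rightarrow> 'a" assume p: "bij_betw p {..<k+1} {..<k+1}" and m: "map e ?n \<in> Rel M"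
        have "p ` {..<k+1} = {..<k+1}"
          using p by (simp add: bij_betw_def)
        then have "set (map p ?n) = {..<k+1}"
          by (metis atLeast_upt set_map)
        then have "set (map e (map p ?n)) = e ` {..<k+1}"
          by (metis set_map)
        moreover have "set (map e ?n) = e ` {..<k+1}"
          by (metis atLeast_upt set_map)
        ultimately have "set (map e (map p ?n)) = set (map e ?n)"
          by simp
        then show "map e (map p ?n) \<in> Rel M"
          using s m by (metis length_map length_upt diff_zero)
      qed
    qed
    have cl: "cl \<longleftrightarrow> \<not> (\<exists>y\<subseteq>Univ M. card y = k+2 \<and> (\<forall>e\<subseteq>y. card e = k+1 \<longrightarrow> e \<in> edges M))"
      if d: "\<forall>xs\<in>Rel M. distinct xs"
        and s: "\<forall>xs ys. xs \<in> Rel M \<longrightarrow> length ys = k+1 \<longrightarrow> set ys = set xs \<longrightarrow> ys \<in> Rel M"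
    proof
      assume cl
      show "\<not> (\<exists>y\<subseteq>Univ M. card y = k+2 \<and> (\<forall>e\<subseteq>y. card e = k+1 \<longrightarrow> e \<in> edges M))"
      proof
        assume "\<exists>y\<subseteq>Univ M. card y = k+2 \<and> (\<forall>e\<subseteq>y. card e = k+1 \<longrightarrow> e \<in> edges M)"
        then obtain y where y: "y \<subseteq> Univ M" "card y = k+2" "\<And>e. e \<subseteq> y \<Longrightarrow> card e = k+1 \<Longrightarrow> e \<in> edges M"
          by blast
        have "finite y"
          using y(2) card.infinite by fastforce
        then obtain ys where ys: "set ys = y" "distinct ys"
          using finite_distinct_list by blast
        then have len: "length ys = k+2"
          using y(2) distinct_card by metis
        have "map ((!) ys) w \<in> Rel M" if w: "w \<in> set (subseqs ?n')" "length w = k+1" for w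
        proof -
          have dw: "distinct w"
            using w(1) by (metis distinct_upt subseqs_distinctD)
          have sw: "set w \<subseteq> {..<k+2}"
            using w(1) by (metis PowD atLeast_upt imageI subseqs_powset)
          have dm: "distinct (map ((!) ys) w)"
            using dw sw ys(2) len inj_on_nth[of ys "set w"] by (auto simp: distinct_map subset_iff)
          have "set (map ((!) ys) w) \<subseteq> y"
            using sw ys(1) len by (auto simp: subset_iff)
          then have "set (map ((!) ys) w) \<in> edges M"
            using dm w(2) by (intro y(3)) (metis distinct_card length_map)+
          then show ?thesis
            using s w(2) by (auto simp: edges_def)
        qed
        moreover have "\<forall>x<k+2. ys ! x \<in> Univ M" "\<forall>j<k+2. \<forall>i<j. ys ! i \<noteq> ys ! j"
          using ys y(1) len by (auto simp: nth_eq_iff_index_eq)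
        ultimately show False
          using \<open>cl\<close> unfolding cl_def by blast
      qed
    next
      assume n: "\<not> (\<exists>y\<subseteq>Univ M. card y = k+2 \<and> (\<forall>e\<subseteq>y. card e = k+1 \<longrightarrow> e \<in> edges M))"
      show cl
        unfolding cl_def
      proof (intro allI impI notI)
        fix e :: "nat \<Rightarrow> 'a"
        assume e: "\<forall>x<k+2. e x \<in> Univ M" "\<forall>j<k+2. \<forall>i<j. e i \<noteq> e j"
          and r: "\<forall>w\<in>set (subseqs ?n'). length w = k+1 \<longrightarrow> map e w \<in> Rel M"
        have inj: "inj_on e {..<k+2}"
          using e(2) unfolding inj_on_def by (metis lessThan_iff nat_neq_iff)
        have "f \<in> edges M" if f: "f \<subseteq> e ` {..<k+2}" "card f = k+1" for f
        proof -
          obtain A where A: "A \<subseteq> {..<k+2}" "f = e ` A"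
            using f(1) by (meson subset_imageE)
          have "A \<in> set ` set (subseqs ?n')"
            using A(1) by (metis PowI atLeast_upt subseqs_powset)
          then obtain w where w: "w \<in> set (subseqs ?n')" "A = set w"
            by blast
          have dw: "distinct w"
            using w(1) by (metis distinct_upt subseqs_distinctD)
          have "card A = k+1"
            using A f(2) inj card_image inj_on_subset by metis
          then have "map e w \<in> Rel M"
            using r w dw by (simp add: distinct_card del: upt_Suc)
          then show ?thesis
            unfolding edges_def A(2) w(2) by (metis imageI set_map)
        qed
        moreover have "card (e ` {..<k+2}) = k+2"
          using inj by (simp add: card_image)
        moreover have "e ` {..<k+2} \<subseteq> Univ M"
          using e(1) by auto
        ultimately show False
          using n by blast
      qed
    qed
    show ?thesis
      unfolding hypergraph_def irr using True sy cl by blast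
  next
    case False
    then show ?thesis
      by (simp add: hypergraph_def)
  qed
  finally show ?thesis .
qed

definition edge_struct :: "nat \<Rightarrow> 'a set \<Rightarrow> 'a set set \<Rightarrow> 'a rstruct" where
  "edge_struct k V E = \<lparr>Univ = V, Rel = {xs. length xs = k+1 \<and> set xs \<in> E}\<rparr>"

lemma edges_edge_struct:
  assumes "\<And>e. e \<in> E \<Longrightarrow> e \<subseteq> V \<and> card e = k+1"
  shows "edges (edge_struct k V E) = E"
proof -
  have "\<exists>xs. length xs = k+1 \<and> set xs = e" if "e \<in> E" for e
  proof -
    have "card e = k+1"
      using assms that by blast
    then have "finite e"
      using card.infinite by fastforce
    then show ?thesis
      using \<open>card e = k+1\<close> finite_distinct_list[of e] distinct_card by metis
  qed
  then show ?thesis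
    by (fastforce simp: edges_def edge_struct_def)
qed

lemma hypergraph_edge_struct:
  assumes "V \<noteq> {}" and E: "\<And>e. e \<in> E \<Longrightarrow> e \<subseteq> V \<and> card e = k+1"
    and "\<And>y. y \<subseteq> V \<Longrightarrow> card y = k+2 \<Longrightarrow> \<exists>e\<subseteq>y. card e = k+1 \<and> e \<notin> E"
  shows "hypergraph k (edge_struct k V E)"
proof -
  have edges: "edges (edge_struct k V E) = E"
    using E by (rule edges_edge_struct)
  show ?thesis
    unfolding hypergraph_def edges
  proof (intro conjI)
    show "is_struct (k+1) (edge_struct k V E)"
      using assms by (auto simp: is_struct_def edge_struct_def)
    show "\<forall>xs\<in>Rel (edge_struct k V E). distinct xs"
      using E by (auto simp: edge_struct_def intro!: card_distinct)
    show "\<forall>xs ys. xs \<in> Rel (edge_struct k V E) \<longrightarrow> length ys = k + 1 \<longrightarrow> set ys = set xs \<longrightarrow>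
        ys \<in> Rel (edge_struct k V E)"
      by (auto simp: edge_struct_def)
    show "\<not> (\<exists>y\<subseteq>Univ (edge_struct k V E). card y = k + 2 \<and> (\<forall>e\<subseteq>y. card e = k + 1 \<longrightarrow> e \<in> E))"
      using assms(3) by (auto simp: edge_struct_def)
  qed
qed

section \<open>Extension property and back-and-forth\<close>

definition extension_property :: "nat \<Rightarrow> 'a rstruct \<Rightarrow> bool" where
  "extension_property k M \<longleftrightarrow> hypergraph k M \<and>
     (\<forall>S W. finite S \<and> S \<subseteq> Univ M \<and> \<not> (\<exists>e\<in>edges M. e \<subseteq> S \<and> (\<forall>w\<subseteq>e. card w = k \<longrightarrow> w \<in> W)) \<longrightarrow>
        (\<exists>x\<in>Univ M - S. \<forall>w\<subseteq>S. card w = k \<longrightarrow> (insert x w \<in> edges M \<longleftrightarrow> w \<in> W)))"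

lemma extension_propertyD:
  assumes "extension_property k M" "finite S" "S \<subseteq> Univ M"
    and "\<And>e. e \<in> edges M \<Longrightarrow> e \<subseteq> S \<Longrightarrow> \<exists>w\<subseteq>e. card w = k \<and> w \<notin> W"
  shows "\<exists>x\<in>Univ M - S. \<forall>w\<subseteq>S. card w = k \<longrightarrow> (insert x w \<in> edges M \<longleftrightarrow> w \<in> W)"
proof -
  have "\<not> (\<exists>e\<in>edges M. e \<subseteq> S \<and> (\<forall>w\<subseteq>e. card w = k \<longrightarrow> w \<in> W))"
    using assms(4) by metis
  then show ?thesis
    using assms(1-3) unfolding extension_property_def by simp
qed

text \<open>The (k+1)-subsets of \<open>e\<close> with an apex \<open>a\<close> are \<open>e\<close>
  itself and the sets \<open>insert a w\<close> for the k-subsets \<open>w\<close> of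
  \<open>e\<close>; if all were edges, they would form a clique on k+2 vertices. This is the only
  obstruction to prescribing the edges at a new vertex, and the hypothesis on \<open>W\<close> in
  the extension property rules it out.\<close>

lemma hypergraph_cone:
  assumes "hypergraph k M" "e \<in> edges M" "a \<in> Univ M" "a \<notin> e"
  shows "\<exists>w\<subseteq>e. card w = k \<and> insert a w \<notin> edges M"
proof (rule ccontr)
  assume *: "\<not> ?thesis"
  have e: "e \<subseteq> Univ M" "card e = k+1" "finite e"
    using hypergraph_edges[OF assms(1,2)] by blast+
  obtain f where f: "f \<subseteq> insert a e" "card f = k+1" "f \<notin> edges M"
    using hypergraph_no_clique[OF assms(1), of "insert a e"] e assms(3,4) by auto
  have "finite f"
    using f(1) e(3) finite_subset by blast
  show False
  proof (cases "a \<in> f")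
    case True
    then have "card (f - {a}) = k" "f - {a} \<subseteq> e" "insert a (f - {a}) = f"
      using f \<open>finite f\<close> by auto
    then show False
      using * f(3) by metis
  next
    case False
    then have "f = e"
      using f e by (intro card_subset_eq) auto
    then show False
      using f(3) assms(2) by blast
  qed
qed

text \<open>The pattern of \<open>a\<close> over \<open>S\<close> is realized by \<open>a\<close>
  itself, so by the cone lemma no edge inside \<open>S\<close> obstructs it. The map
  \<open>f\<close> transports this to the image of \<open>S\<close>, where the extension property
  yields \<open>a'\<close>.\<close>

lemma partial_isomorphism_extend:
  assumes N: "extension_property k N" and S: "finite S" "S \<subseteq> Univ N" and f: "inj_on f S" "f ` S \<subseteq> Univ N"
    and iso: "\<And>v. v \<subseteq> S \<Longrightarrow> card v = k+1 \<Longrightarrow> v \<in> edges N \<longleftrightarrow> f ` v \<in> edges N"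
    and a: "a \<in> Univ N" "a \<notin> S"
  shows "\<exists>a'\<in>Univ N - f ` S. \<forall>w\<subseteq>S. card w = k \<longrightarrow> (insert a w \<in> edges N \<longleftrightarrow> insert a' (f ` w) \<in> edges N)"
proof -
  have hyp: "hypergraph k N"
    using N by (simp add: extension_property_def)
  let ?W = "{f ` w | w. w \<subseteq> S \<and> insert a w \<in> edges N}"
  have mem: "f ` w \<in> ?W \<longleftrightarrow> insert a w \<in> edges N" if "w \<subseteq> S" for w
    using that f(1) by (auto simp: inj_on_image_eq_iff)
  have "\<exists>w\<subseteq>e. card w = k \<and> w \<notin> ?W" if e: "e \<in> edges N" "e \<subseteq> f ` S" for e
  proof -
    obtain e0 where e0: "e0 \<subseteq> S" "e = f ` e0"
      using e(2) by (meson subset_imageE)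
    have inj: "inj_on f e0"
      using f(1) e0(1) inj_on_subset by blast
    have "card e0 = k+1"
      using hypergraph_edges(2)[OF hyp e(1)] card_image[OF inj] e0(2) by simp
    then have "e0 \<in> edges N"
      using iso e0 e(1) by blast
    then obtain w where w: "w \<subseteq> e0" "card w = k" "insert a w \<notin> edges N"
      using hypergraph_cone[OF hyp] a e0(1) by blast
    have "card (f ` w) = k"
      using w(1,2) inj by (metis card_image inj_on_subset)
    then show ?thesis
      using w e0 mem[of w] by (intro exI[of _ "f ` w"]) auto
  qed
  then obtain a' where a': "a' \<in> Univ N - f ` S"
    "\<forall>w\<subseteq>f ` S. card w = k \<longrightarrow> (insert a' w \<in> edges N \<longleftrightarrow> w \<in> ?W)"
    using extension_propertyD[OF N, of "f ` S" ?W] S(1) f(2) by blast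
  have "insert a w \<in> edges N \<longleftrightarrow> insert a' (f ` w) \<in> edges N" if w: "w \<subseteq> S" "card w = k" for w
  proof -
    have "card (f ` w) = k"
      using w f(1) by (metis card_image inj_on_subset)
    then have "insert a' (f ` w) \<in> edges N \<longleftrightarrow> f ` w \<in> ?W"
      using a'(2)[rule_format, OF image_mono[OF w(1)]] by blast
    then show ?thesis
      using mem[OF w(1)] by blast
  qed
  then show ?thesis
    using a'(1) by blast
qed

lemma partial_isomorphism_insert:
  assumes hyp: "hypergraph k N" and S: "finite S" "a \<notin> S"
    and iso: "\<And>v. v \<subseteq> S \<Longrightarrow> card v = k+1 \<Longrightarrow> v \<in> edges N \<longleftrightarrow> f ` v \<in> edges N"
    and a': "\<forall>w\<subseteq>S. card w = k \<longrightarrow> (insert a w \<in> edges N \<longleftrightarrow> insert a' (f ` w) \<in> edges N)"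
    and v: "v \<subseteq> insert a S" "card v = k+1"
  shows "v \<in> edges N \<longleftrightarrow> f(a := a') ` v \<in> edges N"
proof (cases "a \<in> v")
  case True
  have "finite v"
    using v(1) S(1) finite_subset by blast
  then have w: "v - {a} \<subseteq> S" "card (v - {a}) = k" "insert a (v - {a}) = v"
    using True v by auto
  have "f(a := a') ` v = insert a' (f ` (v - {a}))"
    using True by (auto simp: image_def)
  then show ?thesis
    using a' w by metis
next
  case False
  then have "v \<subseteq> S" "f(a := a') ` v = f ` v"
    using v(1) by auto
  then show ?thesis
    using iso v(2) by metis
qed

text \<open>Quantifier elimination by back and forth: a finite partial isomorphism can be extended
  to a further element on either side. The domain \<open>S\<close> is carried along instead of the
  values of the free variables, so that the map can grow under quantifiers.\<close>

lemma partial_isomorphism_sat: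
  assumes N: "extension_property k N"
  shows "in_language (k+1) \<phi> \<Longrightarrow> finite S \<Longrightarrow> S \<subseteq> Univ N \<Longrightarrow> inj_on f S \<Longrightarrow> f ` S \<subseteq> Univ N \<Longrightarrow>
    (\<And>v. v \<subseteq> S \<Longrightarrow> card v = k+1 \<Longrightarrow> v \<in> edges N \<longleftrightarrow> f ` v \<in> edges N) \<Longrightarrow>
    (\<forall>x\<in>fv \<phi>. e x \<in> S) \<Longrightarrow> sat N e \<phi> \<longleftrightarrow> sat N (f \<circ> e) \<phi>"
proof (induction \<phi> arbitrary: S f e)
  case (FEq x y)
  then show ?case
    by (auto simp: inj_on_def)
next
  case (FRel xs)
  have hyp: "hypergraph k N"
    using N by (simp add: extension_property_def)
  have sub: "e ` set xs \<subseteq> S"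
    using FRel.prems by auto
  have c: "card (f ` e ` set xs) = card (e ` set xs)"
    using FRel.prems(4) sub by (metis card_image inj_on_subset)
  have "e ` set xs \<in> edges N \<longleftrightarrow> f ` e ` set xs \<in> edges N"
  proof (cases "card (e ` set xs) = k+1")
    case True
    then show ?thesis
      using FRel.prems(6) sub by blast
  next
    case False
    then show ?thesis
      using hypergraph_edges(2)[OF hyp] c by metis
  qed
  moreover have "set (map e xs) = e ` set xs" "set (map (f \<circ> e) xs) = f ` e ` set xs"
    by auto
  ultimately show ?case
    using hypergraph_Rel[OF hyp] by simp
next
  case (FImp \<phi> \<psi>)
  have "sat N e \<phi> \<longleftrightarrow> sat N (f \<circ> e) \<phi>"
    using FImp.prems by (intro FImp.IH(1)[of S]) auto
  moreover have "sat N e \<psi> \<longleftrightarrow> sat N (f \<circ> e) \<psi>"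
    using FImp.prems by (intro FImp.IH(2)[of S]) auto
  ultimately show ?case
    unfolding sat.simps by blast
next
  case (FAll x \<phi>)
  note S = FAll.prems(2,3) and f = FAll.prems(4,5) and iso = FAll.prems(6)
  have hyp: "hypergraph k N"
    using N by (simp add: extension_property_def)
  have cong: "sat N (f' \<circ> e(x := a)) \<phi> \<longleftrightarrow> sat N ((f \<circ> e)(x := f' a)) \<phi>"
    if "\<And>s. s \<in> S \<Longrightarrow> f' s = f s" for f' a
    using that FAll.prems(7) by (intro sat_cong) auto
  have old: "sat N (e(x := a)) \<phi> \<longleftrightarrow> sat N ((f \<circ> e)(x := f a)) \<phi>" if "a \<in> S" for a
  proof -
    have "sat N (e(x := a)) \<phi> \<longleftrightarrow> sat N (f \<circ> e(x := a)) \<phi>"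
      using FAll.prems that by (intro FAll.IH[of S]) auto
    then show ?thesis
      using cong[of f a] by simp
  qed
  have new: "sat N (e(x := a)) \<phi> \<longleftrightarrow> sat N ((f \<circ> e)(x := a')) \<phi>"
    if a: "a \<in> Univ N" "a \<notin> S" "a' \<in> Univ N" "a' \<notin> f ` S"
      "\<forall>w\<subseteq>S. card w = k \<longrightarrow> (insert a w \<in> edges N \<longleftrightarrow> insert a' (f ` w) \<in> edges N)" for a a'
  proof -
    have "sat N (e(x := a)) \<phi> \<longleftrightarrow> sat N (f(a := a') \<circ> e(x := a)) \<phi>"
    proof (rule FAll.IH[of "insert a S"])
      show "in_language (k+1) \<phi>" "finite (insert a S)" "insert a S \<subseteq> Univ N"
        using FAll.prems a by auto
      show "inj_on (f(a := a')) (insert a S)"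
        using f(1) a by (auto simp: inj_on_def)
      show "f(a := a') ` insert a S \<subseteq> Univ N"
        using f(2) a by auto
      show "v \<in> edges N \<longleftrightarrow> f(a := a') ` v \<in> edges N" if "v \<subseteq> insert a S" "card v = k+1" for v
        using partial_isomorphism_insert[OF hyp S(1) a(2) iso a(5) that] .
      show "\<forall>y\<in>fv \<phi>. (e(x := a)) y \<in> insert a S"
        using FAll.prems(7) by auto
    qed
    moreover have "(f(a := a')) s = f s" if "s \<in> S" for s
      using a(2) that by auto
    ultimately show ?thesis
      using cong[of "f(a := a')" a] by simp
  qed
  \<comment> \<open>The back direction extends the inverse map and reads the result
    backwards.\<close>
  let ?g = "inv_into S f"
  have g: "inj_on ?g (f ` S)" "?g ` f ` S = S" "\<And>s. s \<in> S \<Longrightarrow> ?g (f s) = s"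
    using f(1) by (auto simp: inj_on_inv_into)
  have giso: "v \<in> edges N \<longleftrightarrow> ?g ` v \<in> edges N" if v: "v \<subseteq> f ` S" "card v = k+1" for v
  proof -
    obtain v0 where v0: "v0 \<subseteq> S" "v = f ` v0"
      using v(1) by (meson subset_imageE)
    have "card v0 = k+1"
      using v(2) v0 f(1) by (metis card_image inj_on_subset)
    moreover have "?g ` v = v0"
      using v0 f(1) by simp
    ultimately show ?thesis
      using iso v0 by metis
  qed
  have forth: "\<exists>a'\<in>Univ N. sat N (e(x := a)) \<phi> \<longleftrightarrow> sat N ((f \<circ> e)(x := a')) \<phi>" if a: "a \<in> Univ N" for a
  proof (cases "a \<in> S")
    case True
    then show ?thesis
      using old f(2) by blast
  next
    case False
    then show ?thesis
      using partial_isomorphism_extend[OF N S f iso a False] new[OF a False] by blast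
  qed
  have bk: "\<exists>a\<in>Univ N. sat N (e(x := a)) \<phi> \<longleftrightarrow> sat N ((f \<circ> e)(x := a')) \<phi>" if a: "a' \<in> Univ N" for a'
  proof (cases "a' \<in> f ` S")
    case True
    then show ?thesis
      using old S(2) by blast
  next
    case False
    have "\<exists>a\<in>Univ N - ?g ` f ` S. \<forall>w\<subseteq>f ` S. card w = k \<longrightarrow>
        (insert a' w \<in> edges N \<longleftrightarrow> insert a (?g ` w) \<in> edges N)"
      using S g(2) by (intro partial_isomorphism_extend[OF N _ f(2) g(1) _ giso a False]) auto
    then obtain b where b: "b \<in> Univ N - S"
      "\<forall>w\<subseteq>f ` S. card w = k \<longrightarrow> (insert a' w \<in> edges N \<longleftrightarrow> insert b (?g ` w) \<in> edges N)"
      unfolding g(2) by blast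
    have "insert b w \<in> edges N \<longleftrightarrow> insert a' (f ` w) \<in> edges N" if w: "w \<subseteq> S" "card w = k" for w
    proof -
      have "?g ` f ` w = w" "card (f ` w) = k"
        using w f(1) by (auto simp: card_image inj_on_subset)
      then show ?thesis
        using b(2)[rule_format, OF image_mono[OF w(1), of f]] by metis
    qed
    then show ?thesis
      using new[of b a'] b(1) a False by blast
  qed
  show ?case
    using forth bk unfolding sat.simps by blast
qed simp_all

section \<open>Models of the theory have the extension property\<close>

lemma embedding_comp:
  assumes "embedding f M N" "embedding g N P"
  shows "embedding (g \<circ> f) M P"
  unfolding embedding_def
proof (intro conjI allI impI)
  have f: "f ` Univ M \<subseteq> Univ N" "inj_on f (Univ M)"
    and g: "g ` Univ N \<subseteq> Univ P" "inj_on g (Univ N)"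
    using assms by (auto simp: embedding_def)
  show "(g \<circ> f) ` Univ M \<subseteq> Univ P"
    using f g by auto
  show "inj_on (g \<circ> f) (Univ M)"
    using f g by (metis comp_inj_on inj_on_subset)
  fix xs assume xs: "set xs \<subseteq> Univ M"
  then have "xs \<in> Rel M \<longleftrightarrow> map f xs \<in> Rel N"
    using assms(1) by (simp add: embedding_def)
  also have "\<dots> \<longleftrightarrow> map g (map f xs) \<in> Rel P"
  proof -
    have "set (map f xs) \<subseteq> Univ N"
      using xs f(1) by auto
    then show ?thesis
      using assms(2) by (auto simp: embedding_def)
  qed
  finally show "xs \<in> Rel M \<longleftrightarrow> map (g \<circ> f) xs \<in> Rel P"
    by simp
qed

lemma embedding_id: "embedding (\<lambda>x. x) M M"
  by (simp add: embedding_def)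

lemma nat_model_hypergraph:
  fixes N :: "nat rstruct"
  assumes T: "axiomatizes_Tmk (k+1) k T" and N: "models (k+1) N T"
  shows "hypergraph k N"
  using T N by (simp add: axiomatizes_Tmk_def model_completion_def flip: models_hypergraph_theory)

lemma nat_model_embeds:
  fixes N :: "nat rstruct"
  assumes T: "axiomatizes_Tmk (k+1) k T" and N: "hypergraph k N"
  obtains N' :: "nat rstruct" and f where "models (k+1) N' T" "embedding f N N'"
  using T N models_hypergraph_theory[of k N]
  unfolding axiomatizes_Tmk_def model_completion_def by blast

lemma nat_model_elementary:
  fixes N N' :: "nat rstruct"
  assumes T: "axiomatizes_Tmk (k+1) k T" and N: "models (k+1) N T" "models (k+1) N' T"
    and f: "embedding f N N'" and \<phi>: "in_language (k+1) \<phi>" "\<And>x. x \<in> fv \<phi> \<Longrightarrow> e x \<in> Univ N"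
  shows "sat N e \<phi> \<longleftrightarrow> sat N' (f \<circ> e) \<phi>"
proof -
  have "models (k+1) N (hypergraph_theory (k+1) k)"
    using nat_model_hypergraph[OF T N(1)] models_hypergraph_theory by blast
  then have "sat N ((\<lambda>x. x) \<circ> e) \<phi> \<longleftrightarrow> sat N' (f \<circ> e) \<phi>"
    using T N f \<phi> embedding_id[of N]
    unfolding axiomatizes_Tmk_def model_completion_def by blast
  then show ?thesis
    by (simp add: comp_def)
qed

text \<open>The new vertex is 0; the old ones are shifted by \<open>Suc\<close> to make room. A
  clique through 0 would contain an edge of \<open>N\<close> all of whose k-subsets are joined to 0.
  For an edge inside \<open>S\<close> this is excluded by the hypothesis on \<open>W\<close>, and
  any other edge has a k-subset that is not contained in \<open>S\<close>.\<close>

lemma add_vertex: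
  fixes N :: "nat rstruct"
  assumes k: "k > 0" and hyp: "hypergraph k N"
    and W: "\<And>e. e \<in> edges N \<Longrightarrow> e \<subseteq> S \<Longrightarrow> \<exists>w\<subseteq>e. card w = k \<and> w \<notin> W" and S: "S \<subseteq> Univ N"
  shows "\<exists>N' :: nat rstruct. hypergraph k N' \<and> 0 \<in> Univ N' \<and> embedding Suc N N' \<and>
    (\<forall>w\<subseteq>S. card w = k \<longrightarrow> (insert 0 (Suc ` w) \<in> edges N' \<longleftrightarrow> w \<in> W))"
proof -
  let ?V = "insert 0 (Suc ` Univ N)"
  let ?E = "(`) Suc ` edges N \<union> {insert 0 (Suc ` w) | w. w \<subseteq> S \<and> card w = k \<and> w \<in> W}"
  let ?N = "edge_struct k ?V ?E"
  have inj: "inj Suc"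
    by simp
  have fink: "finite w" if "card w = k" for w :: "nat set"
    using that k card.infinite by fastforce
  have E: "e \<subseteq> ?V \<and> card e = k+1" if "e \<in> ?E" for e
  proof -
    from that consider e0 where "e0 \<in> edges N" "e = Suc ` e0"
      | w where "w \<subseteq> S" "card w = k" "e = insert 0 (Suc ` w)"
      by blast
    then show ?thesis
    proof cases
      case 1
      then show ?thesis
        using hypergraph_edges[OF hyp 1(1)] by (auto simp: card_image)
    next
      case 2
      then show ?thesis
        using S fink by (auto simp: card_image)
    qed
  qed
  have E1: "Suc ` e0 \<in> ?E \<longleftrightarrow> e0 \<in> edges N" for e0
    by (auto simp: inj_image_eq_iff)
  have E2: "insert 0 (Suc ` w) \<in> ?E \<longleftrightarrow> w \<subseteq> S \<and> card w = k \<and> w \<in> W" for w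
  proof -
    have "insert 0 (Suc ` w) = insert 0 (Suc ` w') \<longleftrightarrow> w = w'" for w'
    proof -
      have "insert 0 (Suc ` w) = insert 0 (Suc ` w') \<longleftrightarrow> Suc ` w = Suc ` w'"
        by (intro insert_ident) auto
      then show ?thesis
        by (simp add: inj_image_eq_iff)
    qed
    moreover have "insert 0 (Suc ` w) \<noteq> Suc ` e0" for e0
      by blast
    ultimately show ?thesis
      by (auto simp: image_iff)
  qed
  have edges: "edges ?N = ?E"
    using E by (rule edges_edge_struct)
  have "hypergraph k ?N"
  proof (rule hypergraph_edge_struct)
    show "?V \<noteq> {}"
      by simp
    show "e \<subseteq> ?V \<and> card e = k+1" if "e \<in> ?E" for e
      using that by (rule E)
    fix y assume y: "y \<subseteq> ?V" "card y = k+2"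
    define y0 where "y0 = {n. Suc n \<in> y}"
    have finy: "finite y"
      using y(2) card.infinite by fastforce
    have y0: "y0 \<subseteq> Univ N" "y - {0} = Suc ` y0"
      using y(1) by (auto simp: y0_def image_iff Suc_le_D)
    then have fin0: "finite y0"
      using finy by (metis finite_Diff finite_imageD inj inj_on_subset subset_UNIV)
    show "\<exists>e\<subseteq>y. card e = k+1 \<and> e \<notin> ?E"
    proof (cases "0 \<in> y")
      case False
      then have ys: "y = Suc ` y0"
        using y0(2) by auto
      then have "card y0 = k+2"
        using y(2) by (simp add: card_image)
      then obtain e where e: "e \<subseteq> y0" "card e = k+1" "e \<notin> edges N"
        using hypergraph_no_clique[OF hyp y0(1)] by blast
      then show ?thesis
        using ys E1[of e] by (intro exI[of _ "Suc ` e"]) (auto simp: card_image)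
    next
      case True
      then have ys: "y = insert 0 (Suc ` y0)"
        using y0(2) by auto
      then have c: "card y0 = k+1"
        using y(2) fin0 by (simp add: card_image)
      show ?thesis
      proof (cases "y0 \<in> edges N")
        case False
        then show ?thesis
          using ys c E1[of y0] by (intro exI[of _ "Suc ` y0"]) (auto simp: card_image)
      next
        case True
        have "\<exists>w\<subseteq>y0. card w = k \<and> \<not> (w \<subseteq> S \<and> w \<in> W)"
        proof (cases "y0 \<subseteq> S")
          case True
          then show ?thesis
            using W[OF \<open>y0 \<in> edges N\<close>] by blast
        next
          case False
          \<comment> \<open>A k-set containing a vertex \<open>s\<close> outside \<open>S\<close> is
            not joined to 0. One arises by removing from \<open>y0\<close> some other vertex, which
            exists because k > 0.\<close>
          then obtain s where s: "s \<in> y0" "s \<notin> S"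
            by blast
          then obtain t where t: "t \<in> y0" "t \<noteq> s"
            using c k card_le_Suc0_iff_eq[OF fin0] by (metis Suc_eq_plus1 Suc_le_mono le_zero_eq less_numeral_extra(3))
          then have "card (y0 - {t}) = k"
            using c fin0 by simp
          then show ?thesis
            using s t by (intro exI[of _ "y0 - {t}"]) auto
        qed
        then obtain w where w: "w \<subseteq> y0" "card w = k" "\<not> (w \<subseteq> S \<and> w \<in> W)"
          by blast
        then have "insert 0 (Suc ` w) \<notin> ?E"
          unfolding E2 by blast
        moreover have "insert 0 (Suc ` w) \<subseteq> y" "card (insert 0 (Suc ` w)) = k+1"
          using w ys fink by (auto simp: card_image)
        ultimately show ?thesis
          by blast
      qed
    qed
  qed
  moreover have "0 \<in> Univ ?N"
    by (simp add: edge_struct_def)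
  moreover have "embedding Suc N ?N"
    unfolding embedding_def
  proof (intro conjI allI impI)
    show "Suc ` Univ N \<subseteq> Univ ?N"
      by (auto simp: edge_struct_def)
    fix xs
    show "xs \<in> Rel N \<longleftrightarrow> map Suc xs \<in> Rel ?N"
      unfolding hypergraph_Rel[OF hyp] using E1[of "set xs"] by (auto simp: edge_struct_def)
  qed simp
  moreover have "insert 0 (Suc ` w) \<in> edges ?N \<longleftrightarrow> w \<in> W" if "w \<subseteq> S" "card w = k" for w
    unfolding edges using E2[of w] that by blast
  ultimately show ?thesis
    by blast
qed

lemma set_nth_preimage:
  assumes "w \<subseteq> set ss" "finite w"
  obtains ws where "set ws \<subseteq> {..<length ss}" "length ws = card w" "(!) ss ` set ws = w"
proof -
  obtain us where us: "set us = w" "distinct us"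
    using finite_distinct_list[OF assms(2)] by blast
  have "\<forall>x\<in>w. \<exists>i<length ss. ss ! i = x"
    using assms(1) by (metis in_set_conv_nth subsetD)
  then obtain g where g: "\<And>x. x \<in> w \<Longrightarrow> g x < length ss \<and> ss ! g x = x"
    by metis
  show ?thesis
    using us g distinct_card[OF us(2)] by (intro that[of "map g us"]) (auto simp: image_image)
qed

text \<open>Existential closedness: a countable model of the model completion is elementary in every
  model that contains its extension by the desired vertex.\<close>

lemma nat_model_extension_property:
  fixes N :: "nat rstruct"
  assumes k: "k > 0" and T: "axiomatizes_Tmk (k+1) k T" and N: "models (k+1) N T"
  shows "extension_property k N"
proof -
  have hyp: "hypergraph k N"
    using nat_model_hypergraph[OF T N] .
  have "\<exists>x\<in>Univ N - S. \<forall>w\<subseteq>S. card w = k \<longrightarrow> (insert x w \<in> edges N \<longleftrightarrow> w \<in> W)"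
    if S: "finite S" "S \<subseteq> Univ N" and W: "\<not> (\<exists>e\<in>edges N. e \<subseteq> S \<and> (\<forall>w\<subseteq>e. card w = k \<longrightarrow> w \<in> W))" for S W
  proof -
    obtain N' :: "nat rstruct" where N': "hypergraph k N'" "0 \<in> Univ N'" "embedding Suc N N'"
      "\<And>w. w \<subseteq> S \<Longrightarrow> card w = k \<Longrightarrow> insert 0 (Suc ` w) \<in> edges N' \<longleftrightarrow> w \<in> W"
      using add_vertex[OF k hyp, of S W] W S(2) by blast
    obtain N'' :: "nat rstruct" and f where N'': "models (k+1) N'' T" "embedding f N' N''"
      using nat_model_embeds[OF T N'(1)] .
    have emb: "embedding (f \<circ> Suc) N N''"
      using N'(3) N''(2) by (rule embedding_comp)
    obtain ss where ss: "set ss = S"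
      using finite_list[OF S(1)] by blast
    let ?n = "length ss"
    \<comment> \<open>Variable 0 is reserved for the vertex sought; variable i+1 names the entry
      \<open>i\<close> of the list \<open>ss\<close>.\<close>
    define e where "e i = ss ! (i - 1)" for i
    have eS: "e (Suc i) \<in> S" if "i < ?n" for i
      using that ss by (auto simp: e_def)
    define lit where "lit ws = (if (!) ss ` set ws \<in> W then FRel (0 # map Suc ws) else FNeg (FRel (0 # map Suc ws)))" for ws
    \<comment> \<open>Lists that name fewer than k vertices are left out, since \<open>W\<close>
      prescribes nothing for them.\<close>
    define I where "I = {ws. set ws \<subseteq> {..<?n} \<and> length ws = k \<and> card ((!) ss ` set ws) = k}"
    define L where "L = (\<lambda>i. FNeg (FEq 0 (Suc i))) ` {..<?n} \<union> lit ` I"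
    have "finite I"
      by (rule finite_subset[OF _ finite_lists_length_eq[of "{..<?n}" k]]) (auto simp: I_def)
    then have "finite L"
      by (simp add: L_def)
    then obtain ls where ls: "set ls = L"
      using finite_list by blast
    \<comment> \<open>The nested implication into \<open>FBot\<close> negates the conjunction of the
      literals, so the formula says that some vertex satisfies them all.\<close>
    define \<phi> where "\<phi> = FNeg (FAll 0 (foldr FImp ls FBot))"
    have sat\<phi>: "sat P g \<phi> \<longleftrightarrow> (\<exists>a\<in>Univ P. \<forall>\<psi>\<in>L. sat P (g(0 := a)) \<psi>)" for P :: "nat rstruct" and g
      by (auto simp: \<phi>_def sat_foldr_FImp ls)
    have lang: "in_language (k+1) (foldr FImp ls' FBot) \<longleftrightarrow> (\<forall>\<psi>\<in>set ls'. in_language (k+1) \<psi>)" for ls'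
      by (induction ls') auto
    have fvs: "fv (foldr FImp ls' FBot) = (\<Union>\<psi>\<in>set ls'. fv \<psi>)" for ls'
      by (induction ls') auto
    have "in_language (k+1) \<phi>"
      using lang[of ls] by (auto simp: \<phi>_def ls L_def lit_def I_def)
    moreover have "e x \<in> Univ N" if "x \<in> fv \<phi>" for x
    proof -
      have "x \<in> Suc ` {..<?n}"
        using that by (auto simp: \<phi>_def fvs ls L_def lit_def I_def split: if_splits)
      then show ?thesis
        using eS S(2) by auto
    qed
    ultimately have eq: "sat N e \<phi> \<longleftrightarrow> sat N'' (f \<circ> Suc \<circ> e) \<phi>"
      by (intro nat_model_elementary[OF T N N''(1) emb]) auto
    have f: "f ` Univ N' \<subseteq> Univ N''" "inj_on f (Univ N')"
      "\<And>xs. set xs \<subseteq> Univ N' \<Longrightarrow> xs \<in> Rel N' \<longleftrightarrow> map f xs \<in> Rel N''"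
      using N''(2) by (auto simp: embedding_def)
    have SU: "Suc ` S \<subseteq> Univ N'"
      using N'(3) S(2) by (auto simp: embedding_def)
    have "sat N'' ((f \<circ> Suc \<circ> e)(0 := f 0)) \<psi>" if "\<psi> \<in> L" for \<psi>
    proof -
      from that consider i where "i < ?n" "\<psi> = FNeg (FEq 0 (Suc i))" | ws where "ws \<in> I" "\<psi> = lit ws"
        by (auto simp: L_def)
      then show ?thesis
      proof cases
        case 1
        have "Suc (e (Suc i)) \<in> Univ N'"
          using eS[OF 1(1)] SU by auto
        then have "f 0 \<noteq> f (Suc (e (Suc i)))"
          using f(2) N'(2) by (metis inj_onD nat.distinct(1))
        then show ?thesis
          using 1 by simp
      next
        case 2
        have ws: "set ws \<subseteq> {..<?n}" "length ws = k" "card ((!) ss ` set ws) = k"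
          using 2(1) by (auto simp: I_def)
        let ?xs = "0 # map (\<lambda>i. Suc (ss ! i)) ws"
        have sub: "(!) ss ` set ws \<subseteq> S"
          using ws(1) ss by auto
        then have "set ?xs \<subseteq> Univ N'"
          using SU N'(2) by auto
        then have "map f ?xs \<in> Rel N'' \<longleftrightarrow> ?xs \<in> Rel N'"
          using f(3) by blast
        also have "\<dots> \<longleftrightarrow> insert 0 (Suc ` (!) ss ` set ws) \<in> edges N'"
          using ws(2) by (simp add: hypergraph_Rel[OF N'(1)] image_image)
        also have "\<dots> \<longleftrightarrow> (!) ss ` set ws \<in> W"
          using N'(4)[OF sub ws(3)] .
        finally have "map f ?xs \<in> Rel N'' \<longleftrightarrow> (!) ss ` set ws \<in> W" .
        moreover have "map ((f \<circ> Suc \<circ> e)(0 := f 0)) (0 # map Suc ws) = map f ?xs"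
          by (simp add: e_def)
        ultimately show ?thesis
          unfolding 2(2) lit_def by (simp only: sat.simps split: if_split) blast
      qed
    qed
    then have "sat N'' (f \<circ> Suc \<circ> e) \<phi>"
      unfolding sat\<phi> using f(1) N'(2) by blast
    then obtain x where x: "x \<in> Univ N" "\<And>\<psi>. \<psi> \<in> L \<Longrightarrow> sat N (e(0 := x)) \<psi>"
      using eq sat\<phi> by blast
    have "x \<notin> S"
    proof
      assume "x \<in> S"
      then obtain i where i: "i < ?n" "ss ! i = x"
        using ss by (metis in_set_conv_nth)
      then have "sat N (e(0 := x)) (FNeg (FEq 0 (Suc i)))"
        by (intro x(2)) (auto simp: L_def)
      then show False
        using i(2) by (simp add: e_def)
    qed
    moreover have "insert x w \<in> edges N \<longleftrightarrow> w \<in> W" if w: "w \<subseteq> S" "card w = k" for w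
    proof -
      obtain ws where ws: "set ws \<subseteq> {..<?n}" "length ws = card w" "(!) ss ` set ws = w"
        using set_nth_preimage[of w ss] w(1) S(1) ss finite_subset by metis
      then have "sat N (e(0 := x)) (lit ws)"
        using w by (intro x(2)) (auto simp: L_def I_def)
      moreover have "map (e(0 := x)) (0 # map Suc ws) = x # map ((!) ss) ws"
        by (simp add: e_def)
      ultimately have "x # map ((!) ss) ws \<in> Rel N \<longleftrightarrow> w \<in> W"
        unfolding lit_def ws(3) by (cases "w \<in> W") (auto simp only: sat.simps if_True if_False)
      moreover have "length (x # map ((!) ss) ws) = k+1" "set (x # map ((!) ss) ws) = insert x w"
        using ws w by simp_all
      ultimately show ?thesis
        using hypergraph_Rel[OF hyp] by metis
    qed
    ultimately show ?thesis
      using x(1) by blast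
  qed
  then show ?thesis
    using hyp unfolding extension_property_def by blast
qed

section \<open>Countable elementary substructures\<close>

instance fm :: countable
  by countable_datatype

definition restrict_struct :: "'a rstruct \<Rightarrow> 'a set \<Rightarrow> 'a rstruct" where
  "restrict_struct M Z = \<lparr>Univ = Z, Rel = {xs \<in> Rel M. set xs \<subseteq> Z}\<rparr>"

text \<open>There are countably many formulas and, over a countable set, countably many lists, so
  countably many rounds of adding witnesses stay countable. The last clause, minimality, serves to
  keep the closure inside the universe.\<close>

lemma countable_witness_closure:
  fixes wit :: "fm \<Rightarrow> nat \<Rightarrow> 'a list \<Rightarrow> 'a"
  assumes "countable S"
  obtains Z where "countable Z" "S \<subseteq> Z" "\<And>\<phi> x xs. set xs \<subseteq> Z \<Longrightarrow> wit \<phi> x xs \<in> Z"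
    "\<And>V. S \<subseteq> V \<Longrightarrow> (\<And>\<phi> x xs. wit \<phi> x xs \<in> V) \<Longrightarrow> Z \<subseteq> V"
proof -
  define Z where "Z = rec_nat S (\<lambda>_ A. A \<union> (\<lambda>(\<phi>, x, xs). wit \<phi> x xs) ` (UNIV \<times> UNIV \<times> lists A))"
  have Z: "Z 0 = S" "Z (Suc n) = Z n \<union> (\<lambda>(\<phi>, x, xs). wit \<phi> x xs) ` (UNIV \<times> UNIV \<times> lists (Z n))" for n
    by (simp_all add: Z_def)
  have mono: "m \<le> n \<Longrightarrow> Z m \<subseteq> Z n" for m n
    by (rule lift_Suc_mono_le) (auto simp: Z)
  have "countable (Z n)" for n
    using assms by (induction n) (auto simp: Z)
  moreover have "S \<subseteq> (\<Union>n. Z n)"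
    using Z(1) by blast
  moreover have "wit \<phi> x xs \<in> (\<Union>n. Z n)" if xs: "set xs \<subseteq> (\<Union>n. Z n)" for \<phi> x xs
  proof -
    have "\<exists>n. set xs \<subseteq> Z n"
      using xs
    proof (induction xs)
      case (Cons y ys)
      then obtain m n where "y \<in> Z m" "set ys \<subseteq> Z n"
        by auto
      then have "set (y # ys) \<subseteq> Z (max m n)"
        using mono[of m "max m n"] mono[of n "max m n"] by auto
      then show ?case
        by blast
    qed simp
    then obtain n where "set xs \<subseteq> Z n"
      by blast
    then have "wit \<phi> x xs \<in> Z (Suc n)"
      unfolding Z by (intro UnI2 image_eqI[of _ _ "(\<phi>, x, xs)"]) auto
    then show ?thesis
      by blast
  qed
  moreover have "(\<Union>n. Z n) \<subseteq> V" if V: "S \<subseteq> V" "\<And>\<phi> x xs. wit \<phi> x xs \<in> V" for V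
  proof -
    have "Z n \<subseteq> V" for n
      using V by (induction n) (auto simp: Z)
    then show ?thesis
      by blast
  qed
  ultimately show ?thesis
    by (intro that[of "\<Union>n. Z n"]) auto
qed

text \<open>The Tarski-Vaught argument: the set is closed under chosen counterexamples to universal
  formulas with parameters in it, so a universal formula that fails in \<open>M\<close> already
  fails over the set.\<close>

lemma downward_loewenheim_skolem:
  fixes M :: "'a rstruct"
  assumes S: "countable S" "S \<subseteq> Univ M" "S \<noteq> {}"
  obtains Z where "countable Z" "S \<subseteq> Z" "Z \<subseteq> Univ M"
    "\<And>\<phi> e. (\<And>x. x \<in> fv \<phi> \<Longrightarrow> e x \<in> Z) \<Longrightarrow> sat (restrict_struct M Z) e \<phi> \<longleftrightarrow> sat M e \<phi>"
proof -
  obtain s where s: "s \<in> S"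
    using S(3) by blast
  \<comment> \<open>Parameters are coded as a list whose entry \<open>i\<close> is the value of
    variable \<open>i\<close>; the default \<open>s\<close> serves for all variables beyond
    it.\<close>
  define env where "env xs i = (if i < length xs then xs ! i else s)" for xs and i :: nat
  define wit where "wit \<phi> x xs = (if \<exists>a\<in>Univ M. \<not> sat M ((env xs)(x := a)) \<phi>
      then SOME a. a \<in> Univ M \<and> \<not> sat M ((env xs)(x := a)) \<phi> else s)" for \<phi> x xs
  have witM: "wit \<phi> x xs \<in> Univ M" for \<phi> x xs
  proof (cases "\<exists>a\<in>Univ M. \<not> sat M ((env xs)(x := a)) \<phi>")
    case True
    then have "\<exists>a. a \<in> Univ M \<and> \<not> sat M ((env xs)(x := a)) \<phi>"
      by blast
    then show ?thesis
      unfolding wit_def using True someI_ex[of "\<lambda>a. a \<in> Univ M \<and> \<not> sat M ((env xs)(x := a)) \<phi>"] by simp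
  next
    case False
    then show ?thesis
      using s S(2) by (auto simp: wit_def)
  qed
  have wit: "\<not> sat M ((env xs)(x := wit \<phi> x xs)) \<phi>" if "\<exists>a\<in>Univ M. \<not> sat M ((env xs)(x := a)) \<phi>" for \<phi> x xs
  proof -
    have "\<exists>a. a \<in> Univ M \<and> \<not> sat M ((env xs)(x := a)) \<phi>"
      using that by blast
    then show ?thesis
      unfolding wit_def using that someI_ex[of "\<lambda>a. a \<in> Univ M \<and> \<not> sat M ((env xs)(x := a)) \<phi>"] by simp
  qed
  obtain Z where Z: "countable Z" "S \<subseteq> Z" "\<And>\<phi> x xs. set xs \<subseteq> Z \<Longrightarrow> wit \<phi> x xs \<in> Z"
    "\<And>V. S \<subseteq> V \<Longrightarrow> (\<And>\<phi> x xs. wit \<phi> x xs \<in> V) \<Longrightarrow> Z \<subseteq> V"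
    using countable_witness_closure[OF S(1), of wit] by blast
  have ZM: "Z \<subseteq> Univ M"
    using Z(4)[OF S(2)] witM by blast
  have "sat (restrict_struct M Z) e \<phi> \<longleftrightarrow> sat M e \<phi>" if "\<And>x. x \<in> fv \<phi> \<Longrightarrow> e x \<in> Z" for \<phi> e
    using that
  proof (induction \<phi> arbitrary: e)
    case (FRel xs)
    then have "set (map e xs) \<subseteq> Z"
      by auto
    then show ?case
      by (simp add: restrict_struct_def)
  next
    case (FImp \<phi> \<psi>)
    have "sat (restrict_struct M Z) e \<phi> \<longleftrightarrow> sat M e \<phi>" "sat (restrict_struct M Z) e \<psi> \<longleftrightarrow> sat M e \<psi>"
      by (rule FImp.IH; rule FImp.prems; simp)+
    then show ?case
      by simp
  next
    case (FAll x \<phi>)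
    have IH: "sat (restrict_struct M Z) (e(x := a)) \<phi> \<longleftrightarrow> sat M (e(x := a)) \<phi>" if "a \<in> Z" for a
      by (rule FAll.IH) (use FAll.prems that in auto)
    have "\<exists>a\<in>Z. \<not> sat M (e(x := a)) \<phi>" if ex: "\<exists>a\<in>Univ M. \<not> sat M (e(x := a)) \<phi>"
    proof -
      obtain n where n: "\<And>y. y \<in> fv \<phi> \<Longrightarrow> y < n"
        using finite_nat_set_iff_bounded[of "fv \<phi>"] by auto
      define xs where "xs = map (\<lambda>y. if y \<in> fv \<phi> - {x} then e y else s) [0..<n]"
      have xsZ: "set xs \<subseteq> Z"
        using FAll.prems s Z(2) by (auto simp: xs_def)
      have cong: "sat M ((env xs)(x := a)) \<phi> \<longleftrightarrow> sat M (e(x := a)) \<phi>" for a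
        using n by (intro sat_cong) (auto simp: env_def xs_def)
      have "\<not> sat M ((env xs)(x := wit \<phi> x xs)) \<phi>"
        using ex cong by (intro wit) simp
      then show ?thesis
        using cong Z(3)[OF xsZ] by blast
    qed
    then show ?case
      using IH ZM by (auto simp: restrict_struct_def)
  qed simp_all
  then show ?thesis
    using Z(1,2) ZM that by blast
qed

lemma isomorphism_sat:
  assumes f: "embedding f M N" "f ` Univ M = Univ N"
  shows "(\<And>x. x \<in> fv \<phi> \<Longrightarrow> e x \<in> Univ M) \<Longrightarrow> sat N (f \<circ> e) \<phi> \<longleftrightarrow> sat M e \<phi>"
proof (induction \<phi> arbitrary: e)
  case (FEq x y)
  then show ?case
    using f(1) by (auto simp: embedding_def inj_on_def)
next
  case (FRel xs)
  then have "set (map e xs) \<subseteq> Univ M"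
    by auto
  then have "map e xs \<in> Rel M \<longleftrightarrow> map f (map e xs) \<in> Rel N"
    using f(1) unfolding embedding_def by blast
  then show ?case
    unfolding sat.simps map_map by blast
next
  case (FImp \<phi> \<psi>)
  have "sat N (f \<circ> e) \<phi> \<longleftrightarrow> sat M e \<phi>" "sat N (f \<circ> e) \<psi> \<longleftrightarrow> sat M e \<psi>"
    by (rule FImp.IH; rule FImp.prems; simp)+
  then show ?case
    unfolding sat.simps by blast
next
  case (FAll x \<phi>)
  have "sat N (f \<circ> e(x := a)) \<phi> \<longleftrightarrow> sat M (e(x := a)) \<phi>" if "a \<in> Univ M" for a
    by (rule FAll.IH) (use FAll.prems that in auto)
  then have "sat N ((f \<circ> e)(x := f a)) \<phi> \<longleftrightarrow> sat M (e(x := a)) \<phi>" if "a \<in> Univ M" for a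
    using that by (simp add: fun_upd_comp)
  then show ?case
    unfolding sat.simps f(2)[symmetric] by blast
qed simp

lemma edges_restrict_struct: "edges (restrict_struct M Z) = {e \<in> edges M. e \<subseteq> Z}"
  by (auto simp: edges_def restrict_struct_def)

lemma extension_property_iso:
  assumes f: "embedding f M N" "f ` Univ M = Univ N" and M: "is_struct (k+1) M" and N: "extension_property k N"
  shows "extension_property k M"
proof -
  have hypN: "hypergraph k N"
    using N by (simp add: extension_property_def)
  have inj: "inj_on f (Univ M)"
    using f(1) by (simp add: embedding_def)
  have fR: "xs \<in> Rel M \<longleftrightarrow> length xs = k+1 \<and> f ` set xs \<in> edges N" if "set xs \<subseteq> Univ M" for xs
    using f(1) that hypergraph_Rel[OF hypN, of "map f xs"] by (simp add: embedding_def)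
  have MR: "set xs \<subseteq> Univ M" "length xs = k+1" if "xs \<in> Rel M" for xs
    using M that by (auto simp: is_struct_def)
  have fE: "e \<in> edges M \<longleftrightarrow> f ` e \<in> edges N" if "e \<subseteq> Univ M" for e
  proof
    assume "e \<in> edges M"
    then obtain xs where "xs \<in> Rel M" "e = set xs"
      by (auto simp: edges_def)
    then show "f ` e \<in> edges N"
      using fR[of xs] MR[of xs] by blast
  next
    assume fe: "f ` e \<in> edges N"
    have inje: "inj_on f e"
      using inj that inj_on_subset by blast
    have "finite e" "card e = k+1"
      using hypergraph_edges[OF hypN fe] inje by (auto simp: card_image finite_image_iff)
    then obtain xs where "set xs = e" "length xs = k+1"
      using finite_distinct_list distinct_card by metis
    then show "e \<in> edges M"
      using fR[of xs] that fe by (auto simp: edges_def)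
  qed
  have cardf: "card (f ` e) = card e" if "e \<subseteq> Univ M" for e
    using inj that by (metis card_image inj_on_subset)
  have sub: "\<exists>e0\<subseteq>y. e = f ` e0" if "e \<subseteq> f ` y" for e y
    using that by (meson subset_imageE)
  have edge: "e \<subseteq> Univ M" if "e \<in> edges M" for e
    using MR that by (auto simp: edges_def)
  have "hypergraph k M"
    unfolding hypergraph_def
  proof (intro conjI M ballI allI impI notI)
    fix xs assume xs: "xs \<in> Rel M"
    then have "map f xs \<in> Rel N"
      using f(1) MR[OF xs] unfolding embedding_def by blast
    then have "distinct (map f xs)"
      using hypN by (simp add: hypergraph_def)
    then show "distinct xs"
      by (simp add: distinct_map)
  next
    fix xs ys assume xs: "xs \<in> Rel M" "length ys = k+1" "set ys = set xs"
    then show "ys \<in> Rel M"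
      using fR[of xs] fR[of ys] MR by auto
  next
    assume "\<exists>y\<subseteq>Univ M. card y = k + 2 \<and> (\<forall>e\<subseteq>y. card e = k + 1 \<longrightarrow> e \<in> edges M)"
    then obtain y where y: "y \<subseteq> Univ M" "card y = k+2" "\<forall>e\<subseteq>y. card e = k+1 \<longrightarrow> e \<in> edges M"
      by blast
    have "f ` y \<subseteq> Univ N" "card (f ` y) = k+2"
      using y f(2) cardf by auto
    then obtain e where e: "e \<subseteq> f ` y" "card e = k+1" "e \<notin> edges N"
      using hypergraph_no_clique[OF hypN] by blast
    then obtain e0 where e0: "e0 \<subseteq> y" "e = f ` e0"
      using sub by blast
    then have "e0 \<subseteq> Univ M"
      using y(1) by blast
    then show False
      using e e0 y(3) cardf fE by metis
  qed
  moreover have "\<exists>x\<in>Univ M - S. \<forall>w\<subseteq>S. card w = k \<longrightarrow> (insert x w \<in> edges M \<longleftrightarrow> w \<in> W)"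
    if S: "finite S" "S \<subseteq> Univ M" and W: "\<not> (\<exists>e\<in>edges M. e \<subseteq> S \<and> (\<forall>w\<subseteq>e. card w = k \<longrightarrow> w \<in> W))" for S W
  proof -
    let ?W = "{f ` w | w. w \<subseteq> S \<and> w \<in> W}"
    have mem: "f ` w \<in> ?W \<longleftrightarrow> w \<in> W" if w: "w \<subseteq> S" for w
    proof -
      have "f ` w = f ` w' \<longleftrightarrow> w = w'" if "w' \<subseteq> S" for w'
        using inj S(2) w that by (intro inj_on_image_eq_iff[of f "Univ M"]) auto
      then show ?thesis
        using w by auto
    qed
    have key: "\<exists>w\<subseteq>e. card w = k \<and> w \<notin> ?W" if e: "e \<in> edges N" "e \<subseteq> f ` S" for e
    proof -
      obtain e0 where e0: "e0 \<subseteq> S" "e = f ` e0"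
        using e(2) sub by blast
      then have "e0 \<in> edges M"
        using e(1) fE[of e0] S(2) by blast
      then obtain w where w: "w \<subseteq> e0" "card w = k" "w \<notin> W"
        using W e0(1) by blast
      then have "f ` w \<notin> ?W" "card (f ` w) = k" "f ` w \<subseteq> e"
        using e0 mem[of w] cardf[of w] S(2) by auto
      then show ?thesis
        by blast
    qed
    have "\<exists>x\<in>Univ N - f ` S. \<forall>w\<subseteq>f ` S. card w = k \<longrightarrow> (insert x w \<in> edges N \<longleftrightarrow> w \<in> ?W)"
    proof (rule extension_propertyD[OF N _ _ key])
      show "finite (f ` S)" "f ` S \<subseteq> Univ N"
        using S f(2) by auto
    qed
    then obtain x where x: "x \<in> Univ N - f ` S" "\<forall>w\<subseteq>f ` S. card w = k \<longrightarrow> (insert x w \<in> edges N \<longleftrightarrow> w \<in> ?W)"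
      by (elim bexE)
    obtain x0 where x0: "x0 \<in> Univ M" "x = f x0"
      using x(1) f(2) by blast
    have "insert x0 w \<in> edges M \<longleftrightarrow> w \<in> W" if w: "w \<subseteq> S" "card w = k" for w
    proof -
      have "insert x0 w \<subseteq> Univ M"
        using x0 w S(2) by blast
      then have "insert x0 w \<in> edges M \<longleftrightarrow> insert x (f ` w) \<in> edges N"
        using fE x0(2) by simp
      also have "\<dots> \<longleftrightarrow> f ` w \<in> ?W"
        using x(2)[rule_format, OF image_mono[OF w(1)]] cardf[of w] w S(2) by auto
      finally show ?thesis
        using mem[OF w(1)] by simp
    qed
    then show ?thesis
      using x0 x(1) by blast
  qed
  ultimately show ?thesis
    unfolding extension_property_def by blast
qed

text \<open>Each clause of the extension property concerns finitely many vertices, so it may be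
  checked in an induced substructure that contains them.\<close>

lemma extension_property_local:
  assumes M: "is_struct (k+1) M"
    and loc: "\<And>S. finite S \<Longrightarrow> S \<subseteq> Univ M \<Longrightarrow>
      \<exists>Z. S \<subseteq> Z \<and> Z \<subseteq> Univ M \<and> extension_property k (restrict_struct M Z)"
  shows "extension_property k M"
proof -
  have MR: "set xs \<subseteq> Univ M" "length xs = k+1" if "xs \<in> Rel M" for xs
    using M that by (auto simp: is_struct_def)
  have "hypergraph k M"
    unfolding hypergraph_def
  proof (intro conjI M ballI allI impI notI)
    fix xs assume xs: "xs \<in> Rel M"
    then obtain Z where Z: "set xs \<subseteq> Z" "extension_property k (restrict_struct M Z)"
      using loc[of "set xs"] MR by auto
    then have "xs \<in> Rel (restrict_struct M Z)"
      using xs by (simp add: restrict_struct_def)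
    then show "distinct xs"
      using Z(2) by (simp add: extension_property_def hypergraph_def)
  next
    fix xs ys assume xs: "xs \<in> Rel M" "length ys = k+1" "set ys = set xs"
    then obtain Z where Z: "set xs \<subseteq> Z" "extension_property k (restrict_struct M Z)"
      using loc[of "set xs"] MR by auto
    then have "xs \<in> Rel (restrict_struct M Z)"
      using xs by (simp add: restrict_struct_def)
    then have "ys \<in> Rel (restrict_struct M Z)"
      using Z(2) xs(2,3) unfolding extension_property_def hypergraph_def by blast
    then show "ys \<in> Rel M"
      by (simp add: restrict_struct_def)
  next
    assume "\<exists>y\<subseteq>Univ M. card y = k + 2 \<and> (\<forall>e\<subseteq>y. card e = k + 1 \<longrightarrow> e \<in> edges M)"
    then obtain y where y: "y \<subseteq> Univ M" "card y = k+2" "\<forall>e\<subseteq>y. card e = k+1 \<longrightarrow> e \<in> edges M"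
      by blast
    then have "finite y"
      using card.infinite by fastforce
    then obtain Z where Z: "y \<subseteq> Z" "extension_property k (restrict_struct M Z)"
      using loc[of y] y(1) by auto
    have hyp: "hypergraph k (restrict_struct M Z)"
      using Z(2) by (simp add: extension_property_def)
    have "Univ (restrict_struct M Z) = Z"
      by (simp add: restrict_struct_def)
    then obtain e where "e \<subseteq> y" "card e = k+1" "e \<notin> edges (restrict_struct M Z)"
      using hypergraph_no_clique[OF hyp, of y] Z(1) y(2) by auto
    then show False
      using y(3) Z(1) by (auto simp: edges_restrict_struct)
  qed
  moreover have "\<exists>x\<in>Univ M - S. \<forall>w\<subseteq>S. card w = k \<longrightarrow> (insert x w \<in> edges M \<longleftrightarrow> w \<in> W)"
    if S: "finite S" "S \<subseteq> Univ M" and W: "\<not> (\<exists>e\<in>edges M. e \<subseteq> S \<and> (\<forall>w\<subseteq>e. card w = k \<longrightarrow> w \<in> W))" for S W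
  proof -
    obtain Z where Z: "S \<subseteq> Z" "Z \<subseteq> Univ M" "extension_property k (restrict_struct M Z)"
      using loc[OF S] by blast
    have U: "Univ (restrict_struct M Z) = Z"
      by (simp add: restrict_struct_def)
    have "\<exists>x\<in>Univ (restrict_struct M Z) - S. \<forall>w\<subseteq>S. card w = k \<longrightarrow>
        (insert x w \<in> edges (restrict_struct M Z) \<longleftrightarrow> w \<in> W)"
      using W Z(1) S(1) by (intro extension_propertyD[OF Z(3)]) (auto simp: U edges_restrict_struct)
    then obtain x where x: "x \<in> Z - S"
      "\<forall>w\<subseteq>S. card w = k \<longrightarrow> (insert x w \<in> edges (restrict_struct M Z) \<longleftrightarrow> w \<in> W)"
      unfolding U by blast
    have "insert x w \<in> edges M \<longleftrightarrow> w \<in> W" if "w \<subseteq> S" "card w = k" for w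
    proof -
      have "insert x w \<subseteq> Z"
        using that x(1) Z(1) by blast
      then show ?thesis
        using x(2) that by (auto simp: edges_restrict_struct)
    qed
    then show ?thesis
      using x(1) Z(2) by blast
  qed
  ultimately show ?thesis
    unfolding extension_property_def by blast
qed

text \<open>The notion of model completion quantifies over structures on \<open>nat\<close> only. A
  countable elementary substructure around a given finite set is therefore copied to
  \<open>nat\<close>, where the extension property is known, and the local criterion gathers the
  results.\<close>

theorem model_extension_property:
  fixes M :: "'a rstruct"
  assumes k: "k > 0" and T: "axiomatizes_Tmk (k+1) k T" and M: "models (k+1) M T"
  shows "extension_property k M"
proof (rule extension_property_local)
  show struct: "is_struct (k+1) M"
    using M by (simp add: models_def)
  fix S assume S: "finite S" "S \<subseteq> Univ M"
  obtain s where s: "s \<in> Univ M"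
    using struct by (auto simp: is_struct_def)
  obtain Z where Z: "countable Z" "insert s S \<subseteq> Z" "Z \<subseteq> Univ M"
    "\<And>\<phi> e. (\<And>x. x \<in> fv \<phi> \<Longrightarrow> e x \<in> Z) \<Longrightarrow> sat (restrict_struct M Z) e \<phi> \<longleftrightarrow> sat M e \<phi>"
    using downward_loewenheim_skolem[of "insert s S" M] S s by (auto simp: countable_finite)
  let ?M = "restrict_struct M Z"
  have str: "is_struct (k+1) ?M"
    using struct Z(2) by (auto simp: is_struct_def restrict_struct_def)
  define h where "h = to_nat_on Z"
  define N where "N = \<lparr>Univ = h ` Z, Rel = map h ` Rel ?M\<rparr>"
  have inj: "inj_on h Z"
    unfolding h_def by (rule inj_on_to_nat_on[OF Z(1)])
  have ZR: "set xs \<subseteq> Z" if "xs \<in> Rel ?M" for xs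
    using that by (simp add: restrict_struct_def)
  have emb: "embedding h ?M N"
    unfolding embedding_def
  proof (intro conjI allI impI)
    show "inj_on h (Univ ?M)"
      using inj by (simp add: restrict_struct_def)
    show "h ` Univ ?M \<subseteq> Univ N"
      by (simp add: N_def restrict_struct_def)
    fix xs assume xs: "set xs \<subseteq> Univ ?M"
    have "xs = ys" if "map h xs = map h ys" "ys \<in> Rel ?M" for ys
      using that xs ZR[OF that(2)] inj by (intro map_inj_on[of h xs ys]) (auto simp: restrict_struct_def intro: inj_on_subset)
    then show "xs \<in> Rel ?M \<longleftrightarrow> map h xs \<in> Rel N"
      by (auto simp: N_def)
  qed
  have onto: "h ` Univ ?M = Univ N"
    by (simp add: N_def restrict_struct_def)
  have sent: "fv \<phi> = {}" if "\<phi> \<in> T" for \<phi>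
    using T that by (auto simp: axiomatizes_Tmk_def model_completion_def sentences_def)
  have "models (k+1) N T"
    unfolding models_def
  proof (intro conjI ballI allI)
    show "is_struct (k+1) N"
      using str by (force simp: is_struct_def N_def restrict_struct_def)
    fix \<phi> and e :: "nat \<Rightarrow> nat" assume \<phi>: "\<phi> \<in> T"
    \<comment> \<open>Sentences ignore the environment, so it may be exchanged for one with values
      in the substructure.\<close>
    have "sat N e \<phi> \<longleftrightarrow> sat N (h \<circ> (\<lambda>_. s)) \<phi>"
      using sent[OF \<phi>] by (intro sat_cong) simp
    also have "\<dots> \<longleftrightarrow> sat ?M (\<lambda>_. s) \<phi>"
      using sent[OF \<phi>] by (intro isomorphism_sat[OF emb onto]) simp
    also have "\<dots> \<longleftrightarrow> sat M (\<lambda>_. s) \<phi>"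
      using sent[OF \<phi>] by (intro Z(4)) simp
    finally show "sat N e \<phi>"
      using M \<phi> by (simp add: models_def)
  qed
  then have "extension_property k ?M"
    using extension_property_iso[OF emb onto str] nat_model_extension_property[OF k T] by blast
  then show "\<exists>Z. S \<subseteq> Z \<and> Z \<subseteq> Univ M \<and> extension_property k (restrict_struct M Z)"
    using Z(2,3) by blast
qed

section \<open>Ultrapowers and types\<close>

text \<open>Vertices are added one at a time. An obstruction to the next step would be an edge over
  which the new vertex completes a clique of \<open>E\<close> on k+2 vertices.\<close>

lemma finite_hypergraph_embeds:
  assumes M: "extension_property k M"
    and cl: "\<And>y. y \<subseteq> V \<Longrightarrow> card y = k+2 \<Longrightarrow> \<exists>e\<subseteq>y. card e = k+1 \<and> e \<notin> E"
    and V: "finite V"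
  shows "\<exists>f. inj_on f V \<and> f ` V \<subseteq> Univ M \<and> (\<forall>e\<subseteq>V. card e = k+1 \<longrightarrow> (f ` e \<in> edges M \<longleftrightarrow> e \<in> E))"
  using V cl
proof (induction V rule: finite_induct)
  case empty
  have "Univ M \<noteq> {}"
    using M by (auto simp: extension_property_def hypergraph_def is_struct_def)
  then show ?case
    by auto
next
  case (insert v V)
  have hyp: "hypergraph k M"
    using M by (simp add: extension_property_def)
  have "\<exists>f. inj_on f V \<and> f ` V \<subseteq> Univ M \<and> (\<forall>e\<subseteq>V. card e = k+1 \<longrightarrow> (f ` e \<in> edges M \<longleftrightarrow> e \<in> E))"
    using insert.prems by (intro insert.IH) blast
  then obtain f where f: "inj_on f V" "f ` V \<subseteq> Univ M"
    "\<And>e. e \<subseteq> V \<Longrightarrow> card e = k+1 \<Longrightarrow> f ` e \<in> edges M \<longleftrightarrow> e \<in> E"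
    by blast
  let ?W = "{f ` w | w. w \<subseteq> V \<and> insert v w \<in> E}"
  have mem: "f ` w \<in> ?W \<longleftrightarrow> insert v w \<in> E" if w: "w \<subseteq> V" for w
  proof -
    have "f ` w = f ` w' \<longleftrightarrow> w = w'" if "w' \<subseteq> V" for w'
      using f(1) w that by (intro inj_on_image_eq_iff)
    then show ?thesis
      using w by auto
  qed
  have cardf: "card (f ` w) = card w" if "w \<subseteq> V" for w
    using f(1) that by (metis card_image inj_on_subset)
  have "\<exists>w\<subseteq>e. card w = k \<and> w \<notin> ?W" if e: "e \<in> edges M" "e \<subseteq> f ` V" for e
  proof -
    obtain e0 where e0: "e0 \<subseteq> V" "e = f ` e0"
      using e(2) by (meson subset_imageE)
    have c: "card e0 = k+1"
      using hypergraph_edges(2)[OF hyp e(1)] cardf e0 by simp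
    then have "e0 \<in> E"
      using f(3) e0 e(1) by blast
    have fin: "finite e0" "v \<notin> e0"
      using e0(1) insert.hyps finite_subset by auto
    have "insert v e0 \<subseteq> insert v V" "card (insert v e0) = k+2"
      using e0(1) c fin by auto
    then obtain g where g: "g \<subseteq> insert v e0" "card g = k+1" "g \<notin> E"
      using insert.prems by blast
    have "finite g"
      using g(1) fin(1) finite_subset by blast
    have "v \<in> g"
    proof (rule ccontr)
      assume "v \<notin> g"
      then have "g = e0"
        using g c fin by (intro card_subset_eq) auto
      then show False
        using g(3) \<open>e0 \<in> E\<close> by blast
    qed
    then have "card (g - {v}) = k" "g - {v} \<subseteq> e0" "insert v (g - {v}) = g"
      using g \<open>finite g\<close> by auto
    then show ?thesis
      using e0 g(3) mem[of "g - {v}"] cardf[of "g - {v}"] by (intro exI[of _ "f ` (g - {v})"]) auto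
  qed
  then obtain x where x: "x \<in> Univ M - f ` V" "\<forall>w\<subseteq>f ` V. card w = k \<longrightarrow> (insert x w \<in> edges M \<longleftrightarrow> w \<in> ?W)"
    using extension_propertyD[OF M, of "f ` V" ?W] insert.hyps(1) f(2) by blast
  let ?f = "f(v := x)"
  have "?f ` e \<in> edges M \<longleftrightarrow> e \<in> E" if e: "e \<subseteq> insert v V" "card e = k+1" for e
  proof (cases "v \<in> e")
    case False
    then have "e \<subseteq> V" "?f ` e = f ` e"
      using e(1) by auto
    then show ?thesis
      using f(3) e(2) by simp
  next
    case True
    have "finite e"
      using e(1) insert.hyps(1) finite_subset by blast
    then have w: "e - {v} \<subseteq> V" "card (e - {v}) = k" "insert v (e - {v}) = e"
      using e True by auto
    have "?f ` e = insert x (f ` (e - {v}))"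
      using True by (auto simp: image_def)
    moreover have "insert x (f ` (e - {v})) \<in> edges M \<longleftrightarrow> f ` (e - {v}) \<in> ?W"
      using x(2)[rule_format, OF image_mono[OF w(1)]] cardf[OF w(1)] w(2) by simp
    ultimately show ?thesis
      using mem[OF w(1)] w(3) by simp
  qed
  moreover have "inj_on ?f (insert v V)"
    using f(1) x(1) insert.hyps(2) by (auto simp: inj_on_def)
  moreover have "?f ` insert v V \<subseteq> Univ M"
    using f(2) x(1) by auto
  ultimately show ?case
    by blast
qed

section \<open>Los's theorem for edges\<close>

definition ultra_rel :: "'i filter \<Rightarrow> 'a rstruct \<Rightarrow> (('i \<Rightarrow> 'a) \<times> ('i \<Rightarrow> 'a)) set" where
  "ultra_rel D M = {(f, g). (\<forall>t. f t \<in> Univ M) \<and> (\<forall>t. g t \<in> Univ M) \<and> eventually (\<lambda>t. f t = g t) D}"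

definition ultra_class :: "'i filter \<Rightarrow> 'a rstruct \<Rightarrow> ('i \<Rightarrow> 'a) \<Rightarrow> ('i \<Rightarrow> 'a) set" where
  "ultra_class D M f = ultra_rel D M `` {f}"

lemma ultrapower_simps:
  "Univ (ultrapower D M) = ultra_class D M ` {f. \<forall>t. f t \<in> Univ M}"
  "Rel (ultrapower D M) = {map (ultra_class D M) fs | fs.
     set fs \<subseteq> {f. \<forall>t. f t \<in> Univ M} \<and> eventually (\<lambda>t. map (\<lambda>f. f t) fs \<in> Rel M) D}"
proof -
  have 1: "{(f, g). f \<in> {f. \<forall>t. f t \<in> Univ M} \<and> g \<in> {f. \<forall>t. f t \<in> Univ M} \<and>
      eventually (\<lambda>t. f t = g t) D} = ultra_rel D M"
    by (auto simp: ultra_rel_def)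
  have 2: "(\<lambda>f. ultra_rel D M `` {f}) = ultra_class D M"
    by (simp add: ultra_class_def fun_eq_iff)
  show "Univ (ultrapower D M) = ultra_class D M ` {f. \<forall>t. f t \<in> Univ M}"
    unfolding ultrapower_def Let_def 1 2 quotient_def by (auto simp: ultra_class_def)
  show "Rel (ultrapower D M) = {map (ultra_class D M) fs | fs.
     set fs \<subseteq> {f. \<forall>t. f t \<in> Univ M} \<and> eventually (\<lambda>t. map (\<lambda>f. f t) fs \<in> Rel M) D}"
    unfolding ultrapower_def Let_def 1 2 by simp
qed

lemma ultra_class_eq_iff:
  assumes "\<And>t. f t \<in> Univ M" "\<And>t. g t \<in> Univ M"
  shows "ultra_class D M f = ultra_class D M g \<longleftrightarrow> eventually (\<lambda>t. f t = g t) D"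
proof
  assume "ultra_class D M f = ultra_class D M g"
  moreover have "g \<in> ultra_class D M g"
    using assms(2) by (simp add: ultra_rel_def ultra_class_def)
  ultimately have "g \<in> ultra_class D M f"
    by simp
  then show "eventually (\<lambda>t. f t = g t) D"
    by (simp add: ultra_rel_def ultra_class_def)
next
  assume *: "eventually (\<lambda>t. f t = g t) D"
  have "h \<in> ultra_class D M f \<longleftrightarrow> h \<in> ultra_class D M g" for h
  proof -
    have "eventually (\<lambda>t. f t = h t) D \<longleftrightarrow> eventually (\<lambda>t. g t = h t) D"
      by (rule eventually_subst) (use * in \<open>rule eventually_mono\<close>, simp)
    then show ?thesis
      using assms by (simp add: ultra_rel_def ultra_class_def)
  qed
  then show "ultra_class D M f = ultra_class D M g"
    by blast
qed

lemma ultrapower_Rel_iff: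
  assumes fs: "\<And>f t. f \<in> set fs \<Longrightarrow> f t \<in> Univ M"
  shows "map (ultra_class D M) fs \<in> Rel (ultrapower D M) \<longleftrightarrow> eventually (\<lambda>t. map (\<lambda>f. f t) fs \<in> Rel M) D"
proof
  assume "map (ultra_class D M) fs \<in> Rel (ultrapower D M)"
  then obtain gs where gs: "map (ultra_class D M) fs = map (ultra_class D M) gs"
    "set gs \<subseteq> {f. \<forall>t. f t \<in> Univ M}" "eventually (\<lambda>t. map (\<lambda>f. f t) gs \<in> Rel M) D"
    unfolding ultrapower_simps by blast
  have len: "length fs = length gs"
    using gs(1) by (metis length_map)
  have "eventually (\<lambda>t. (fs ! i) t = (gs ! i) t) D" if i: "i < length fs" for i
  proof -
    have "ultra_class D M (fs ! i) = ultra_class D M (gs ! i)"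
      using gs(1) i len by (metis nth_map)
    moreover have "fs ! i \<in> set fs" "gs ! i \<in> set gs"
      using i len by auto
    then have "(fs ! i) t \<in> Univ M" "(gs ! i) t \<in> Univ M" for t
      using fs gs(2) by blast+
    ultimately show ?thesis
      using ultra_class_eq_iff[of "fs ! i" M "gs ! i" D] by blast
  qed
  then have "eventually (\<lambda>t. \<forall>i\<in>{..<length fs}. (fs ! i) t = (gs ! i) t) D"
    by (intro eventually_ball_finite) auto
  then show "eventually (\<lambda>t. map (\<lambda>f. f t) fs \<in> Rel M) D"
    using gs(3)
  proof (rule eventually_elim2)
    fix t assume "\<forall>i\<in>{..<length fs}. (fs ! i) t = (gs ! i) t" "map (\<lambda>f. f t) gs \<in> Rel M"
    moreover from this(1) have "map (\<lambda>f. f t) fs = map (\<lambda>f. f t) gs"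
      using len by (intro nth_equalityI) auto
    ultimately show "map (\<lambda>f. f t) fs \<in> Rel M"
      by simp
  qed
next
  assume "eventually (\<lambda>t. map (\<lambda>f. f t) fs \<in> Rel M) D"
  then show "map (ultra_class D M) fs \<in> Rel (ultrapower D M)"
    using fs unfolding ultrapower_simps by blast
qed

lemma ultrapower_hypergraph_aux:
  fixes D :: "'i filter" and M :: "'a rstruct"
  assumes D: "ultrafilter D" and M: "hypergraph k M"
  shows "is_struct (k+1) (ultrapower D M)"
    "xs \<in> Rel (ultrapower D M) \<Longrightarrow> distinct xs"
    "xs \<in> Rel (ultrapower D M) \<Longrightarrow> length ys = k+1 \<Longrightarrow> set ys = set xs \<Longrightarrow> ys \<in> Rel (ultrapower D M)"
proof -
  have bot: "D \<noteq> bot"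
    using D by (simp add: ultrafilter_def)
  have rep: "\<exists>fs. xs = map (ultra_class D M) fs \<and> (\<forall>f\<in>set fs. \<forall>t. f t \<in> Univ M) \<and>
      eventually (\<lambda>t. map (\<lambda>f. f t) fs \<in> Rel M) D \<and> length fs = k+1 \<and> distinct xs"
    if xs: "xs \<in> Rel (ultrapower D M)" for xs
  proof -
    obtain fs where fs: "xs = map (ultra_class D M) fs" "\<forall>f\<in>set fs. \<forall>t. f t \<in> Univ M"
      "eventually (\<lambda>t. map (\<lambda>f. f t) fs \<in> Rel M) D"
      using xs unfolding ultrapower_simps by blast
    obtain t where "map (\<lambda>f. f t) fs \<in> Rel M"
      using eventually_happens'[OF bot fs(3)] by blast
    then have "length fs = k+1"
      using hypergraph_Rel[OF M] by fastforce
    moreover have "distinct xs"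
      unfolding distinct_conv_nth
    proof (intro allI impI notI)
      fix i j assume ij: "i < length xs" "j < length xs" "i \<noteq> j" "xs ! i = xs ! j"
      then have "i < length fs" "j < length fs" "ultra_class D M (fs ! i) = ultra_class D M (fs ! j)"
        by (auto simp: fs(1))
      moreover from this have "(fs ! i) t \<in> Univ M" "(fs ! j) t \<in> Univ M" for t
        using fs(2) by simp_all
      ultimately have "eventually (\<lambda>t. (fs ! i) t = (fs ! j) t) D"
        using ultra_class_eq_iff[of "fs ! i" M "fs ! j" D] by blast
      then have "eventually (\<lambda>t. (fs ! i) t = (fs ! j) t \<and> map (\<lambda>f. f t) fs \<in> Rel M) D"
        using fs(3) by (rule eventually_conj)
      then obtain t where t: "(fs ! i) t = (fs ! j) t" "map (\<lambda>f. f t) fs \<in> Rel M"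
        using eventually_happens'[OF bot] by blast
      then have "distinct (map (\<lambda>f. f t) fs)"
        using M by (simp add: hypergraph_def)
      then show False
        using t(1) ij(1-3) unfolding distinct_conv_nth fs(1) by simp
    qed
    ultimately show ?thesis
      using fs by blast
  qed
  show "distinct xs" if "xs \<in> Rel (ultrapower D M)"
    using rep[OF that] by blast
  obtain a where "a \<in> Univ M"
    using M by (auto simp: hypergraph_def is_struct_def)
  then have "(\<lambda>_. a) \<in> {f :: 'i \<Rightarrow> 'a. \<forall>t. f t \<in> Univ M}"
    by simp
  then have "Univ (ultrapower D M) \<noteq> {}"
    unfolding ultrapower_simps by (metis empty_iff image_is_empty)
  moreover have "length xs = k+1 \<and> set xs \<subseteq> Univ (ultrapower D M)" if "xs \<in> Rel (ultrapower D M)" for xs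
    using rep[OF that] by (auto simp: ultrapower_simps)
  ultimately show "is_struct (k+1) (ultrapower D M)"
    by (auto simp: is_struct_def)
  assume xs: "xs \<in> Rel (ultrapower D M)" and ys: "length ys = k+1" "set ys = set xs"
  obtain fs where fs: "xs = map (ultra_class D M) fs" "\<forall>f\<in>set fs. \<forall>t. f t \<in> Univ M"
    "eventually (\<lambda>t. map (\<lambda>f. f t) fs \<in> Rel M) D" "length fs = k+1"
    using rep[OF xs] by blast
  have dy: "distinct ys"
    using rep[OF xs] ys fs(4) by (metis card_distinct distinct_card length_map)
  have inj: "inj_on (ultra_class D M) (set fs)"
    using rep[OF xs] fs(1) by (metis distinct_map)
  \<comment> \<open>The representatives of \<open>xs\<close>, listed in the order of
    \<open>ys\<close>; symmetry of the relation in \<open>M\<close> can then be used at each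
    index.\<close>
  define gs where "gs = map (inv_into (set fs) (ultra_class D M)) ys"
  have sx: "set xs = ultra_class D M ` set fs"
    using fs(1) by simp
  have gs: "map (ultra_class D M) gs = ys"
    using ys(2) sx by (auto simp: gs_def f_inv_into_f intro!: map_idI)
  have sg: "set gs = set fs"
    using ys(2) sx inj by (simp add: gs_def)
  have "eventually (\<lambda>t. map (\<lambda>f. f t) gs \<in> Rel M) D"
    using fs(3)
  proof (rule eventually_mono)
    fix t assume t: "map (\<lambda>f. f t) fs \<in> Rel M"
    have "length (map (\<lambda>f. f t) gs) = k+1" "set (map (\<lambda>f. f t) gs) = set (map (\<lambda>f. f t) fs)"
      using ys(1) by (simp add: gs_def) (simp only: set_map sg)
    then show "map (\<lambda>f. f t) gs \<in> Rel M"
      using t hypergraph_Rel[OF M] by metis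
  qed
  then have "map (ultra_class D M) gs \<in> Rel (ultrapower D M)"
    using fs(2) sg by (subst ultrapower_Rel_iff) auto
  then show "ys \<in> Rel (ultrapower D M)"
    using gs by simp
qed

text \<open>Los's theorem for the atomic formula. The vertices form a family over an arbitrary type,
  so that a new vertex can be adjoined to an old family.\<close>

lemma ultrapower_edges_iff:
  fixes a :: "'v \<Rightarrow> 'i \<Rightarrow> 'a"
  assumes D: "ultrafilter D" and M: "hypergraph k M" and a: "\<And>v t. a v t \<in> Univ M"
    and w: "card w = k+1"
  shows "(\<lambda>v. ultra_class D M (a v)) ` w \<in> edges (ultrapower D M) \<longleftrightarrow>
    eventually (\<lambda>t. (\<lambda>v. a v t) ` w \<in> edges M) D"
proof -
  have "finite w"
    using w card.infinite by fastforce
  then obtain ws where ws: "set ws = w" "length ws = k+1"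
    using w finite_distinct_list distinct_card by metis
  let ?fs = "map a ws"
  have "(\<lambda>v. ultra_class D M (a v)) ` w = set (map (ultra_class D M) ?fs)"
    unfolding ws(1)[symmetric] by (simp add: image_image)
  moreover have "set ys \<in> edges (ultrapower D M) \<longleftrightarrow> ys \<in> Rel (ultrapower D M)" if "length ys = k+1" for ys
  proof
    assume "set ys \<in> edges (ultrapower D M)"
    then obtain xs where "xs \<in> Rel (ultrapower D M)" "set ys = set xs"
      unfolding edges_def by blast
    then show "ys \<in> Rel (ultrapower D M)"
      using ultrapower_hypergraph_aux(3)[OF D M _ that] by blast
  qed (simp add: edges_def)
  ultimately have "(\<lambda>v. ultra_class D M (a v)) ` w \<in> edges (ultrapower D M) \<longleftrightarrow>
      map (ultra_class D M) ?fs \<in> Rel (ultrapower D M)"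
    using ws(2) by (metis length_map)
  also have "\<dots> \<longleftrightarrow> eventually (\<lambda>t. map (\<lambda>f. f t) ?fs \<in> Rel M) D"
    by (rule ultrapower_Rel_iff) (use a in auto)
  also have "\<dots> \<longleftrightarrow> eventually (\<lambda>t. (\<lambda>v. a v t) ` w \<in> edges M) D"
  proof -
    have "map (\<lambda>f. f t) ?fs \<in> Rel M \<longleftrightarrow> (\<lambda>v. a v t) ` w \<in> edges M" for t
      using ws by (simp add: hypergraph_Rel[OF M] image_image)
    then show ?thesis
      by simp
  qed
  finally show ?thesis .
qed

lemma ultrafilter_not:
  "ultrafilter D \<Longrightarrow> eventually (\<lambda>t. \<not> P t) D \<longleftrightarrow> \<not> eventually P D"
  unfolding ultrafilter_def using eventually_conj[of P D "\<lambda>t. \<not> P t"] by (auto simp: trivial_limit_def)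

lemma ultrapower_reps:
  assumes "S \<subseteq> Univ (ultrapower D M)" "Univ M \<noteq> {}"
  obtains a where "\<And>v t. a v t \<in> Univ M" "\<And>v. v \<in> S \<Longrightarrow> ultra_class D M (a v) = v"
proof -
  obtain c where c: "c \<in> Univ M"
    using assms(2) by blast
  have "\<forall>v\<in>S. \<exists>f. (\<forall>t. f t \<in> Univ M) \<and> ultra_class D M f = v"
    using assms(1) unfolding ultrapower_simps by blast
  then obtain a where "\<forall>v\<in>S. (\<forall>t. a v t \<in> Univ M) \<and> ultra_class D M (a v) = v"
    by metis
  then show ?thesis
    using c by (intro that[of "\<lambda>v. if v \<in> S then a v else (\<lambda>_. c)"]) (simp_all split: if_split)
qed

text \<open>Each instance depends on finitely many relations, which can be read off in
  \<open>M\<close> at almost every index: a clique of the ultrapower would appear in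
  \<open>M\<close>, and a consistent pattern is consistent in \<open>M\<close> at almost every
  index, where a vertex is then chosen.\<close>

theorem ultrapower_extension_property:
  assumes D: "ultrafilter D" and k: "k > 0" and M: "extension_property k M"
  shows "extension_property k (ultrapower D M)"
proof -
  let ?N = "ultrapower D M"
  have bot: "D \<noteq> bot"
    using D by (simp add: ultrafilter_def)
  have hypM: "hypergraph k M"
    using M by (simp add: extension_property_def)
  have ne: "Univ M \<noteq> {}"
    using hypM by (auto simp: hypergraph_def is_struct_def)
  note edge = ultrapower_edges_iff[OF D hypM]
  have noclique: "\<not> (\<exists>y\<subseteq>Univ ?N. card y = k+2 \<and> (\<forall>e\<subseteq>y. card e = k+1 \<longrightarrow> e \<in> edges ?N))"
  proof
    assume "\<exists>y\<subseteq>Univ ?N. card y = k+2 \<and> (\<forall>e\<subseteq>y. card e = k+1 \<longrightarrow> e \<in> edges ?N)"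
    then obtain y where y: "y \<subseteq> Univ ?N" "card y = k+2" "\<forall>e\<subseteq>y. card e = k+1 \<longrightarrow> e \<in> edges ?N"
      by (elim exE conjE)
    have fin: "finite y"
      using y(2) card.infinite by fastforce
    obtain a where a: "\<And>v t. a v t \<in> Univ M" "\<And>v. v \<in> y \<Longrightarrow> ultra_class D M (a v) = v"
      using ultrapower_reps[OF y(1) ne] by metis
    have "eventually (\<lambda>t. (\<lambda>v. a v t) ` e \<in> edges M) D" if e: "e \<in> {e. e \<subseteq> y \<and> card e = k+1}" for e
    proof -
      have "(\<lambda>v. ultra_class D M (a v)) ` e = (\<lambda>v. v) ` e"
        using a(2) e by (intro image_cong) auto
      then have "(\<lambda>v. ultra_class D M (a v)) ` e \<in> edges ?N"
        using y(3) e by simp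
      then show ?thesis
        using edge[of a e] a(1) e by simp
    qed
    then have "eventually (\<lambda>t. \<forall>e\<in>{e. e \<subseteq> y \<and> card e = k+1}. (\<lambda>v. a v t) ` e \<in> edges M) D"
      using fin by (intro eventually_ball_finite) auto
    then obtain t where t': "\<forall>e\<in>{e. e \<subseteq> y \<and> card e = k+1}. (\<lambda>v. a v t) ` e \<in> edges M"
      by (rule exE[OF eventually_happens'[OF bot]])
    then have t: "(\<lambda>v. a v t) ` e \<in> edges M" if "e \<subseteq> y" "card e = k+1" for e
      using that by simp
    \<comment> \<open>Two coinciding vertices would lie together in the (k+1)-set that omits some
      third one, and its image would be too small to be an edge; k > 0 provides the third
      vertex.\<close>
    have inj: "inj_on (\<lambda>v. a v t) y"
    proof (rule inj_onI, rule ccontr)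
      fix u v assume uv: "u \<in> y" "v \<in> y" "a u t = a v t" "u \<noteq> v"
      have "card (y - {u, v}) = k"
        using uv fin y(2) by (subst card_Diff_subset) auto
      then obtain z where z: "z \<in> y" "z \<noteq> u" "z \<noteq> v"
        using k card_gt_0_iff[of "y - {u, v}"] by auto
      have e: "card (y - {z}) = k+1"
        using z(1) fin y(2) by simp
      have "card ((\<lambda>v. a v t) ` (y - {z})) = card (y - {z})"
        using hypergraph_edges(2)[OF hypM t[OF _ e]] e by auto
      then have "inj_on (\<lambda>v. a v t) (y - {z})"
        using fin by (simp add: eq_card_imp_inj_on)
      then show False
        using uv z unfolding inj_on_def by blast
    qed
    have "(\<lambda>v. a v t) ` y \<subseteq> Univ M" "card ((\<lambda>v. a v t) ` y) = k+2"
      using a(1) y(2) inj by (auto simp: card_image)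
    then obtain e where e: "e \<subseteq> (\<lambda>v. a v t) ` y" "card e = k+1" "e \<notin> edges M"
      using hypergraph_no_clique[OF hypM] by blast
    obtain e0 where e0: "e0 \<subseteq> y" "e = (\<lambda>v. a v t) ` e0"
      using e(1) by (meson subset_imageE)
    then have "card e0 = k+1"
      using e(2) inj by (metis card_image inj_on_subset)
    then show False
      using t[OF e0(1)] e0(2) e(3) by simp
  qed
  have hypN: "hypergraph k ?N"
    unfolding hypergraph_def using ultrapower_hypergraph_aux[OF D hypM] noclique by blast
  have "\<exists>x\<in>Univ ?N - S. \<forall>w\<subseteq>S. card w = k \<longrightarrow> (insert x w \<in> edges ?N \<longleftrightarrow> w \<in> W)"
    if S: "finite S" "S \<subseteq> Univ ?N" and W: "\<not> (\<exists>e\<in>edges ?N. e \<subseteq> S \<and> (\<forall>w\<subseteq>e. card w = k \<longrightarrow> w \<in> W))" for S W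
  proof -
    obtain a where a: "\<And>v t. a v t \<in> Univ M" "\<And>v. v \<in> S \<Longrightarrow> ultra_class D M (a v) = v"
      using ultrapower_reps[OF S(2) ne] by metis
    have id: "(\<lambda>v. ultra_class D M (a v)) ` e = e" if "e \<subseteq> S" for e
    proof -
      have "(\<lambda>v. ultra_class D M (a v)) ` e = (\<lambda>v. v) ` e"
        using a(2) that by (intro image_cong) auto
      then show ?thesis
        by simp
    qed
    \<comment> \<open>Collapses and additional edges inside \<open>S\<close> are what could obstruct
      the pattern at \<open>t\<close>, so these are excluded.\<close>
    define good where "good t \<longleftrightarrow> inj_on (\<lambda>v. a v t) S \<and>
      (\<forall>e\<subseteq>S. card e = k+1 \<longrightarrow> e \<notin> edges ?N \<longrightarrow> (\<lambda>v. a v t) ` e \<notin> edges M)" for t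
    have "eventually (\<lambda>t. \<forall>(u, v)\<in>{(u, v). u \<in> S \<and> v \<in> S \<and> u \<noteq> v}. a u t \<noteq> a v t) D"
    proof (rule eventually_ball_finite)
      show "finite {(u, v). u \<in> S \<and> v \<in> S \<and> u \<noteq> v}"
        by (rule finite_subset[of _ "S \<times> S"]) (use S(1) in auto)
      have "eventually (\<lambda>t. a u t \<noteq> a v t) D" if "u \<in> S" "v \<in> S" "u \<noteq> v" for u v
        using ultra_class_eq_iff[of "a u" M "a v" D] a that by (simp add: ultrafilter_not[OF D])
      then show "\<forall>x\<in>{(u, v). u \<in> S \<and> v \<in> S \<and> u \<noteq> v}. eventually (\<lambda>t. case x of (u, v) \<Rightarrow> a u t \<noteq> a v t) D"
        by auto
    qed
    moreover have "eventually (\<lambda>t. \<forall>e\<in>{e. e \<subseteq> S \<and> card e = k+1 \<and> e \<notin> edges ?N}. (\<lambda>v. a v t) ` e \<notin> edges M) D"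
    proof (rule eventually_ball_finite)
      show "finite {e. e \<subseteq> S \<and> card e = k+1 \<and> e \<notin> edges ?N}"
        by (rule finite_subset[of _ "Pow S"]) (use S(1) in auto)
      show "\<forall>e\<in>{e. e \<subseteq> S \<and> card e = k+1 \<and> e \<notin> edges ?N}. eventually (\<lambda>t. (\<lambda>v. a v t) ` e \<notin> edges M) D"
      proof
        fix e assume e: "e \<in> {e. e \<subseteq> S \<and> card e = k+1 \<and> e \<notin> edges ?N}"
        then have "(\<lambda>v. ultra_class D M (a v)) ` e \<notin> edges ?N"
          using id by simp
        then show "eventually (\<lambda>t. (\<lambda>v. a v t) ` e \<notin> edges M) D"
          using edge[of a e] a(1) e by (simp add: ultrafilter_not[OF D])
      qed
    qed
    ultimately have "eventually good D"
      by (rule eventually_elim2) (auto simp: good_def inj_on_def)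
    define P where "P t x \<longleftrightarrow> x \<in> Univ M \<and> (\<forall>v\<in>S. x \<noteq> a v t) \<and>
      (\<forall>w\<subseteq>S. card w = k \<longrightarrow> (insert x ((\<lambda>v. a v t) ` w) \<in> edges M \<longleftrightarrow> w \<in> W))" for t x
    have ex: "\<exists>x. P t x" if good: "good t" for t
    proof -
      let ?f = "\<lambda>v. a v t" and ?W = "{(\<lambda>v. a v t) ` w | w. w \<subseteq> S \<and> w \<in> W}"
      have inj: "inj_on ?f S"
        using good by (simp add: good_def)
      have cardf: "card (?f ` w) = card w" if "w \<subseteq> S" for w
        using inj that by (metis card_image inj_on_subset)
      have mem: "?f ` w \<in> ?W \<longleftrightarrow> w \<in> W" if w: "w \<subseteq> S" for w
      proof -
        have "?f ` w = ?f ` w' \<longleftrightarrow> w = w'" if "w' \<subseteq> S" for w'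
          using inj w that by (intro inj_on_image_eq_iff)
        then show ?thesis
          using w by auto
      qed
      have key: "\<exists>w\<subseteq>e. card w = k \<and> w \<notin> ?W" if e: "e \<in> edges M" "e \<subseteq> ?f ` S" for e
      proof -
        obtain e0 where e0: "e0 \<subseteq> S" "e = ?f ` e0"
          using e(2) by (meson subset_imageE)
        have "card e0 = k+1"
          using hypergraph_edges(2)[OF hypM e(1)] cardf e0 by simp
        then have "e0 \<in> edges ?N"
          using good e0 e(1) unfolding good_def by blast
        then obtain w where w: "w \<subseteq> e0" "card w = k" "w \<notin> W"
          using W e0(1) by blast
        then have "w \<subseteq> S"
          using e0(1) by blast
        then have "?f ` w \<subseteq> e" "card (?f ` w) = k" "?f ` w \<notin> ?W"
          using w e0 mem[of w] cardf[of w] by auto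
        then show ?thesis
          by blast
      qed
      have "\<exists>x\<in>Univ M - ?f ` S. \<forall>w\<subseteq>?f ` S. card w = k \<longrightarrow> (insert x w \<in> edges M \<longleftrightarrow> w \<in> ?W)"
      proof (rule extension_propertyD[OF M _ _ key])
        show "finite (?f ` S)" "?f ` S \<subseteq> Univ M"
          using S(1) a(1) by auto
      qed
      then obtain x where x: "x \<in> Univ M - ?f ` S" "\<forall>w\<subseteq>?f ` S. card w = k \<longrightarrow> (insert x w \<in> edges M \<longleftrightarrow> w \<in> ?W)"
        by (elim bexE)
      have "insert x (?f ` w) \<in> edges M \<longleftrightarrow> w \<in> W" if "w \<subseteq> S" "card w = k" for w
        using x(2)[rule_format, OF image_mono[OF that(1)]] cardf[OF that(1)] that(2) mem[OF that(1)] by simp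
      then show ?thesis
        using x(1) unfolding P_def by blast
    qed
    obtain c where c: "c \<in> Univ M"
      using ne by blast
    define b where "b t = (if good t then SOME x. P t x else c)" for t
    have P: "P t (b t)" if "good t" for t
      using someI_ex[OF ex[OF that]] that by (simp add: b_def)
    have bU: "b t \<in> Univ M" for t
      using P[of t] c by (cases "good t") (auto simp: P_def b_def)
    let ?b = "ultra_class D M b"
    have "?b \<in> Univ ?N"
      using bU unfolding ultrapower_simps by blast
    moreover have "?b \<noteq> v" if v: "v \<in> S" for v
    proof
      assume "?b = v"
      then have "eventually (\<lambda>t. b t = a v t) D"
        using ultra_class_eq_iff[of b M "a v" D] a v bU by metis
      then have "eventually (\<lambda>t. b t = a v t \<and> good t) D"
        using \<open>eventually good D\<close> by (rule eventually_conj)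
      then obtain t where "b t = a v t" "good t"
        using eventually_happens'[OF bot] by blast
      then show False
        using P[of t] v by (auto simp: P_def)
    qed
    moreover have "insert ?b w \<in> edges ?N \<longleftrightarrow> w \<in> W" if w: "w \<subseteq> S" "card w = k" for w
    proof -
      have finw: "finite w"
        using w(1) S(1) finite_subset by blast
      have bw: "?b \<notin> w"
        using calculation(2) w(1) by blast
      define a' where "a' v = (if v = ?b then b else a v)" for v
      have a': "a' v t \<in> Univ M" for v t
        using a(1) bU by (simp add: a'_def)
      have im: "(\<lambda>v. a' v t) ` insert ?b w = insert (b t) ((\<lambda>v. a v t) ` w)" for t
      proof -
        have "(\<lambda>v. a' v t) ` w = (\<lambda>v. a v t) ` w"
          using bw by (intro image_cong) (auto simp: a'_def)
        then show ?thesis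
          by (simp add: a'_def)
      qed
      have c': "card (insert ?b w) = k+1"
        using bw finw w(2) by simp
      have "(\<lambda>v. ultra_class D M (a' v)) ` insert ?b w = (\<lambda>v. v) ` insert ?b w"
        using a(2) w(1) by (intro image_cong) (auto simp: a'_def)
      then have "insert ?b w \<in> edges ?N \<longleftrightarrow> eventually (\<lambda>t. (\<lambda>v. a' v t) ` insert ?b w \<in> edges M) D"
        using edge[where a = a', OF a' c'] by simp
      also have "\<dots> \<longleftrightarrow> eventually (\<lambda>t. insert (b t) ((\<lambda>v. a v t) ` w) \<in> edges M) D"
        by (simp only: im)
      also have "\<dots> \<longleftrightarrow> eventually (\<lambda>t. w \<in> W) D"
      proof (rule eventually_subst, rule eventually_mono[OF \<open>eventually good D\<close>])
        fix t assume "good t"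
        then show "insert (b t) ((\<lambda>v. a v t) ` w) \<in> edges M \<longleftrightarrow> w \<in> W"
          using P[of t] w unfolding P_def by blast
      qed
      finally show ?thesis
        using bot by (simp add: eventually_const)
    qed
    ultimately show ?thesis
      by blast
  qed
  then show ?thesis
    unfolding extension_property_def using hypN by blast
qed

section \<open>Types over a parameter set\<close>

definition edge_types_realized :: "nat \<Rightarrow> 'a rstruct \<Rightarrow> 'a set \<Rightarrow> bool" where
  "edge_types_realized k N A \<longleftrightarrow>
     (\<forall>P. (\<forall>u. finite u \<and> (\<forall>w\<in>u. w \<subseteq> A \<and> card w = k) \<longrightarrow>
              (\<exists>b\<in>Univ N. \<forall>w\<in>u. insert b w \<in> edges N \<longleftrightarrow> w \<in> P)) \<longrightarrow>
          (\<exists>b\<in>Univ N - A. \<forall>w\<subseteq>A. card w = k \<longrightarrow> (insert b w \<in> edges N \<longleftrightarrow> w \<in> P)))"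

definition finitely_satisfiable :: "'a rstruct \<Rightarrow> (fm \<times> (nat \<Rightarrow> 'a)) set \<Rightarrow> bool" where
  "finitely_satisfiable N p \<longleftrightarrow> (\<forall>q\<subseteq>p. finite q \<longrightarrow> (\<exists>b\<in>Univ N. realizes N b q))"

lemma finitely_satisfiable_insert:
  assumes "finitely_satisfiable N q" "\<not> finitely_satisfiable N (insert x q)"
  shows "\<exists>q0\<subseteq>q. finite q0 \<and> (\<forall>b\<in>Univ N. realizes N b q0 \<longrightarrow> \<not> realizes N b {x})"
proof -
  obtain r where r: "r \<subseteq> insert x q" "finite r" "\<not> (\<exists>b\<in>Univ N. realizes N b r)"
    using assms(2) by (auto simp: finitely_satisfiable_def)
  have "realizes N b r" if "realizes N b (r - {x})" "realizes N b {x}" for b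
    using that by (auto simp: realizes_def)
  then show ?thesis
    using r by (intro exI[of _ "r - {x}"]) auto
qed

lemma complete_type_exists:
  assumes p: "finitely_satisfiable N p" "p \<subseteq> param_formulas n A"
  obtains q where "p \<subseteq> q" "q \<subseteq> param_formulas n A" "finitely_satisfiable N q"
    "\<And>\<phi> e. (\<phi>, e) \<in> param_formulas n A \<Longrightarrow> (\<phi>, e) \<in> q \<or> (FNeg \<phi>, e) \<in> q"
proof -
  let ?Q = "{q. p \<subseteq> q \<and> q \<subseteq> param_formulas n A \<and> finitely_satisfiable N q}"
  have "\<exists>q\<in>?Q. \<forall>X\<in>?Q. q \<subseteq> X \<longrightarrow> X = q"
  proof (rule subset_Zorn_nonempty)
    show "?Q \<noteq> {}"
      using p by blast
    fix \<C> assume c: "\<C> \<noteq> {}" "subset.chain ?Q \<C>"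
    have "finitely_satisfiable N (\<Union>\<C>)"
      unfolding finitely_satisfiable_def
    proof (intro allI impI)
      fix r assume r: "r \<subseteq> \<Union>\<C>" "finite r"
      obtain X where X: "X \<in> \<C>" "r \<subseteq> X"
        using finite_subset_Union_chain[OF r(2,1) c] by blast
      then have "finitely_satisfiable N X"
        using c(2) by (auto simp: subset.chain_def)
      then show "\<exists>b\<in>Univ N. realizes N b r"
        using X(2) r(2) by (auto simp: finitely_satisfiable_def)
    qed
    then show "\<Union>\<C> \<in> ?Q"
      using c by (auto simp: subset.chain_def)
  qed
  then obtain q where qQ: "q \<in> ?Q" and max: "\<forall>X\<in>?Q. q \<subseteq> X \<longrightarrow> X = q"
    by (elim bexE)
  then have q: "p \<subseteq> q" "q \<subseteq> param_formulas n A" "finitely_satisfiable N q"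
    by simp_all
  have mem: "x \<in> q" if "x \<in> param_formulas n A" "finitely_satisfiable N (insert x q)" for x
  proof -
    have "insert x q \<in> ?Q"
      using q(1,2) that by auto
    then have "insert x q = q"
      by (rule mp[OF bspec[OF max]]) blast
    then show ?thesis
      by blast
  qed
  have "(\<phi>, e) \<in> q \<or> (FNeg \<phi>, e) \<in> q" if \<phi>: "(\<phi>, e) \<in> param_formulas n A" for \<phi> e
  proof (rule ccontr)
    assume no: "\<not> ((\<phi>, e) \<in> q \<or> (FNeg \<phi>, e) \<in> q)"
    have \<phi>': "(FNeg \<phi>, e) \<in> param_formulas n A"
      using \<phi> by (simp add: param_formulas_def)
    obtain q1 where q1: "q1 \<subseteq> q" "finite q1" "\<And>b. b \<in> Univ N \<Longrightarrow> realizes N b q1 \<Longrightarrow> \<not> realizes N b {(\<phi>, e)}"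
      using finitely_satisfiable_insert[OF q(3), of "(\<phi>, e)"] mem[OF \<phi>] no by blast
    obtain q2 where q2: "q2 \<subseteq> q" "finite q2" "\<And>b. b \<in> Univ N \<Longrightarrow> realizes N b q2 \<Longrightarrow> \<not> realizes N b {(FNeg \<phi>, e)}"
      using finitely_satisfiable_insert[OF q(3), of "(FNeg \<phi>, e)"] mem[OF \<phi>'] no by blast
    have "q1 \<union> q2 \<subseteq> q" "finite (q1 \<union> q2)"
      using q1 q2 by auto
    then obtain b where b: "b \<in> Univ N" "realizes N b (q1 \<union> q2)"
      using q(3) unfolding finitely_satisfiable_def by blast
    then have "realizes N b q1" "realizes N b q2"
      by (auto simp: realizes_def)
    then show False
      using q1(3)[OF b(1)] q2(3)[OF b(1)] by (auto simp: realizes_def)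
  qed
  then show ?thesis
    using that q by blast
qed

text \<open>A complete type either names a parameter or is governed by the k-sets of parameters
  joined to x. In the second case a vertex \<open>b\<close> outside \<open>A\<close> that realizes
  the edge part realizes everything: for a formula with finitely many parameters, some vertex
  satisfies it, avoids these parameters and has the same edges over them as \<open>b\<close>, and
  exchanging the two is a partial isomorphism.\<close>

theorem type_realized:
  assumes N: "extension_property k N" and k: "k > 0" and A: "A \<subseteq> Univ N" "A \<noteq> {}"
    and real: "edge_types_realized k N A"
    and p: "p \<subseteq> param_formulas (k+1) A" "finitely_satisfiable N p"
  shows "\<exists>b\<in>Univ N. realizes N b p"
proof -
  have hyp: "hypergraph k N"
    using N by (simp add: extension_property_def)
  obtain q where q: "p \<subseteq> q" "q \<subseteq> param_formulas (k+1) A" "finitely_satisfiable N q"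
    "\<And>\<phi> e. (\<phi>, e) \<in> param_formulas (k+1) A \<Longrightarrow> (\<phi>, e) \<in> q \<or> (FNeg \<phi>, e) \<in> q"
    using complete_type_exists[OF p(2,1)] by metis
  have fin: "\<exists>b\<in>Univ N. realizes N b q0" if "q0 \<subseteq> q" "finite q0" for q0
    using q(3) that unfolding finitely_satisfiable_def by blast
  obtain a0 where a0: "a0 \<in> A"
    using A(2) by blast
  show ?thesis
  proof (cases "\<exists>a\<in>A. (FEq 0 1, \<lambda>_. a) \<in> q")
    case True
    then obtain a where a: "a \<in> A" "(FEq 0 1, \<lambda>_. a) \<in> q"
      by blast
    have "sat N (e(0 := a)) \<phi>" if \<phi>: "(\<phi>, e) \<in> p" for \<phi> e
    proof -
      obtain b where "b \<in> Univ N" "realizes N b {(FEq 0 1, \<lambda>_. a), (\<phi>, e)}"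
        using fin[of "{(FEq 0 1, \<lambda>_. a), (\<phi>, e)}"] a(2) \<phi> q(1) by blast
      then show ?thesis
        by (auto simp: realizes_def)
    qed
    then show ?thesis
      using a(1) A(1) by (auto simp: realizes_def)
  next
    case False
    have neq: "(FNeg (FEq 0 1), \<lambda>_. a) \<in> q" if "a \<in> A" for a
      using False q(4)[of "FEq 0 1" "\<lambda>_. a"] that by (auto simp: param_formulas_def)
    define lst where "lst w = (SOME ws. set ws = w \<and> length ws = k)" for w :: "'a set"
    have lst: "set (lst w) = w \<and> length (lst w) = k" if "card w = k" for w
    proof -
      have "finite w"
        using that k card.infinite by fastforce
      then have "\<exists>ws. set ws = w \<and> length ws = k"
        using that finite_distinct_list distinct_card by metis
      then show ?thesis
        unfolding lst_def by (rule someI_ex)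
    qed
    \<comment> \<open>The variables 1 to k enumerate \<open>w\<close>; the default \<open>a0\<close>
      keeps the values inside \<open>A\<close> also when \<open>w\<close> has the wrong
      size.\<close>
    define env where "env w i = (if i - 1 < k \<and> card w = k then lst w ! (i - 1) else a0)" for w i
    define R where "R = FRel [0..<k+1]"
    have envA: "env w i \<in> A" if "w \<subseteq> A" for w i
      using lst[of w] that a0 nth_mem[of "i - 1" "lst w"] unfolding env_def by (metis subsetD)
    have Rparam: "(R, env w) \<in> param_formulas (k+1) A" if "w \<subseteq> A" for w
      using envA[OF that] by (auto simp: param_formulas_def R_def)
    have satR: "sat N ((env w)(0 := b)) R \<longleftrightarrow> insert b w \<in> edges N" if w: "card w = k" for w b
    proof -
      have "map ((env w)(0 := b)) [0..<k+1] = b # lst w"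
      proof (rule nth_equalityI)
        fix i assume "i < length (map ((env w)(0 := b)) [0..<k+1])"
        then show "map ((env w)(0 := b)) [0..<k+1] ! i = (b # lst w) ! i"
          using w by (cases i) (auto simp: env_def simp del: upt_Suc)
      qed (use lst[OF w] in simp)
      then show ?thesis
        using lst[OF w] by (simp add: R_def hypergraph_Rel[OF hyp] del: upt_Suc)
    qed
    define P where "P = {w. (R, env w) \<in> q}"
    \<comment> \<open>A single vertex meets finitely many demands of three kinds at once: edges as
      in the type, distinctness from parameters, and further formulas of the type.\<close>
    have cons: "\<exists>b\<in>Univ N. (\<forall>w\<in>u. insert b w \<in> edges N \<longleftrightarrow> w \<in> P) \<and> b \<notin> F \<and> realizes N b q0"
      if u: "finite u" "\<And>w. w \<in> u \<Longrightarrow> w \<subseteq> A \<and> card w = k" and F: "finite F" "F \<subseteq> A" and q0: "finite q0" "q0 \<subseteq> q"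
      for u F q0
    proof -
      let ?q = "(\<lambda>w. (if w \<in> P then R else FNeg R, env w)) ` u \<union> (\<lambda>a. (FNeg (FEq 0 1), \<lambda>_. a)) ` F \<union> q0"
      have "?q \<subseteq> q"
      proof -
        have "(if w \<in> P then R else FNeg R, env w) \<in> q" if "w \<in> u" for w
          using q(4)[OF Rparam[of w]] u(2)[OF that] by (auto simp: P_def)
        moreover have "(FNeg (FEq 0 1), \<lambda>_. a) \<in> q" if "a \<in> F" for a
          using neq F(2) that by blast
        ultimately show ?thesis
          using q0(2) by blast
      qed
      then obtain b where b: "b \<in> Univ N" "realizes N b ?q"
        using fin[of ?q] u(1) F(1) q0(1) by blast
      have "insert b w \<in> edges N \<longleftrightarrow> w \<in> P" if w: "w \<in> u" for w
      proof -
        have "sat N ((env w)(0 := b)) (if w \<in> P then R else FNeg R)"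
          using b(2) w unfolding realizes_def by blast
        then show ?thesis
          using satR[of w b] u(2)[OF w] by (auto split: if_splits)
      qed
      moreover have "b \<notin> F"
      proof
        assume "b \<in> F"
        then have "sat N ((\<lambda>_. b)(0 := b)) (FNeg (FEq 0 1))"
          using b(2) unfolding realizes_def by blast
        then show False
          by simp
      qed
      moreover have "realizes N b q0"
        using b(2) unfolding realizes_def by blast
      ultimately show ?thesis
        using b(1) by blast
    qed
    have ex: "\<exists>b\<in>Univ N. \<forall>w\<in>u. insert b w \<in> edges N \<longleftrightarrow> w \<in> P"
      if "finite u" "\<forall>w\<in>u. w \<subseteq> A \<and> card w = k" for u
      using cons[of u "{}" "{}"] that by auto
    have "\<exists>b\<in>Univ N - A. \<forall>w\<subseteq>A. card w = k \<longrightarrow> (insert b w \<in> edges N \<longleftrightarrow> w \<in> P)"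
      by (rule mp[OF spec[OF real[unfolded edge_types_realized_def]]]) (use ex in blast)
    then obtain b where "b \<in> Univ N - A" "\<forall>w\<subseteq>A. card w = k \<longrightarrow> (insert b w \<in> edges N \<longleftrightarrow> w \<in> P)"
      by (elim bexE)
    then have b: "b \<in> Univ N - A" "\<And>w. w \<subseteq> A \<Longrightarrow> card w = k \<Longrightarrow> insert b w \<in> edges N \<longleftrightarrow> w \<in> P"
      by blast+
    have "sat N (e(0 := b)) \<phi>" if \<phi>: "(\<phi>, e) \<in> p" for \<phi> e
    proof -
      define S where "S = e ` (fv \<phi> - {0})"
      have S: "finite S" "S \<subseteq> A" and lang: "in_language (k+1) \<phi>"
        using \<phi> p(1) by (auto simp: S_def param_formulas_def)
      have "\<exists>b\<in>Univ N. (\<forall>w\<in>{w. w \<subseteq> S \<and> card w = k}. insert b w \<in> edges N \<longleftrightarrow> w \<in> P) \<and> b \<notin> S \<and>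
          realizes N b {(\<phi>, e)}"
      proof (rule cons)
        show "finite {w. w \<subseteq> S \<and> card w = k}"
          by (rule finite_subset[of _ "Pow S"]) (use S(1) in auto)
      qed (use S \<phi> q(1) in auto)
      then obtain b' where b': "b' \<in> Univ N" "\<forall>w\<in>{w. w \<subseteq> S \<and> card w = k}. insert b' w \<in> edges N \<longleftrightarrow> w \<in> P"
        "b' \<notin> S" "realizes N b' {(\<phi>, e)}"
        by (elim bexE conjE)
      \<comment> \<open>Fixes the parameters and exchanges \<open>b'\<close> for
        \<open>b\<close>.\<close>
      let ?f = "(\<lambda>x. x)(b' := b)"
      have sat': "sat N (e(0 := b')) \<phi>"
        using b'(4) by (simp add: realizes_def)
      have "sat N (e(0 := b')) \<phi> \<longleftrightarrow> sat N (?f \<circ> e(0 := b')) \<phi>"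
      proof (rule partial_isomorphism_sat[OF N lang, of "insert b' S"])
        show "finite (insert b' S)" "insert b' S \<subseteq> Univ N" "?f ` insert b' S \<subseteq> Univ N"
          using S A(1) b(1) b'(1) by auto
        show "inj_on ?f (insert b' S)"
          using b(1) S(2) b'(3) by (auto simp: inj_on_def)
        show "\<forall>x\<in>fv \<phi>. (e(0 := b')) x \<in> insert b' S"
          by (auto simp: S_def)
        fix v assume v: "v \<subseteq> insert b' S" "card v = k+1"
        show "v \<in> edges N \<longleftrightarrow> ?f ` v \<in> edges N"
        proof (rule partial_isomorphism_insert[OF hyp S(1) b'(3) _ _ v])
          show "\<forall>w\<subseteq>S. card w = k \<longrightarrow> (insert b' w \<in> edges N \<longleftrightarrow> insert b ((\<lambda>x. x) ` w) \<in> edges N)"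
            using b'(2) b(2) S(2) by auto
        qed simp
      qed
      also have "\<dots> \<longleftrightarrow> sat N (e(0 := b)) \<phi>"
        using b'(3) by (intro sat_cong) (auto simp: S_def)
      finally show ?thesis
        using sat' by blast
    qed
    then show ?thesis
      using b(1) by (auto simp: realizes_def)
  qed
qed

section \<open>Transfer between the index set and the Boolean algebra\<close>

locale built =
  fixes D D\<^sub>0 :: "'i filter" and U :: "('d, 'm) B1 set" and j :: "'i set \<Rightarrow> ('d, 'm) B1"
  assumes D: "ultrafilter D" and reg: "regular_filter D\<^sub>0" and exc: "excellent_filter D\<^sub>0"
    and U: "ba_ultrafilter U" and hom: "ba_hom j" and surj: "surj j"
    and D\<^sub>0_iff: "\<And>A. eventually (\<lambda>t. t \<in> A) D\<^sub>0 \<longleftrightarrow> j A = top"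
    and D_iff: "\<And>A. eventually (\<lambda>t. t \<in> A) D \<longleftrightarrow> j A \<in> U"
begin

lemma j_simps [simp]:
  "j {} = bot" "j UNIV = top" "j (- A) = - j A" "j (A \<inter> B) = j A \<sqinter> j B" "j (A \<union> B) = j A \<squnion> j B"
  using hom by (auto simp: ba_hom_def)

lemma j_mono: "A \<subseteq> B \<Longrightarrow> j A \<le> j B"
proof -
  assume "A \<subseteq> B"
  then have "j A = j A \<sqinter> j B"
    by (simp add: Int_absorb2 flip: j_simps(4))
  then show "j A \<le> j B"
    by (simp add: inf.absorb_iff1)
qed

lemma U_compl: "- x \<in> U \<longleftrightarrow> x \<notin> U"
proof -
  have "x \<sqinter> - x \<notin> U" "x \<in> U \<or> - x \<in> U"
    using U by (simp_all add: ba_ultrafilter_def)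
  moreover have "\<forall>x y. x \<in> U \<and> y \<in> U \<longrightarrow> x \<sqinter> y \<in> U"
    using U unfolding ba_ultrafilter_def by (elim conjE)
  ultimately show ?thesis
    by blast
qed

lemma U_top: "top \<in> U" and U_bot: "bot \<notin> U"
  and U_mono: "x \<in> U \<Longrightarrow> x \<le> y \<Longrightarrow> y \<in> U" and U_inf: "x \<in> U \<Longrightarrow> y \<in> U \<Longrightarrow> x \<sqinter> y \<in> U"
  using U by (auto simp: ba_ultrafilter_def)

lemma D\<^sub>0_imp_D: "eventually P D\<^sub>0 \<Longrightarrow> eventually P D"
  using D\<^sub>0_iff[of "Collect P"] D_iff[of "Collect P"] U_top by simp

lemma j_INT_Rep:
  assumes "finite I" "\<And>i. i \<in> I \<Longrightarrow> p \<in> Rep_B1 (j (A i))"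
  shows "p \<in> Rep_B1 (j (\<Inter>i\<in>I. A i))"
  using assms by (induction I rule: finite_induct) auto

lemma j_INT_U:
  assumes "finite I" "\<And>i. i \<in> I \<Longrightarrow> j (A i) \<in> U"
  shows "j (\<Inter>i\<in>I. A i) \<in> U"
  using assms by (induction I rule: finite_induct) (auto simp: U_top U_inf)

text \<open>The passage from forcing to an actual index: the empty set has value bottom, which no
  condition forces.\<close>

lemma Rep_j_nonempty: "p \<in> Rep_B1 (j A) \<Longrightarrow> \<exists>t. t \<in> A"
  by (cases "A = {}") auto

lemma regular_family:
  obtains X :: "'i \<Rightarrow> 'i set" where "\<And>i. eventually (\<lambda>t. t \<in> X i) D\<^sub>0" "\<And>t. finite {i. t \<in> X i}"
proof -
  obtain X :: "'i \<Rightarrow> 'i set" where X: "\<And>i. eventually (\<lambda>t. t \<in> X i) D\<^sub>0"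
    "\<And>S. infinite S \<Longrightarrow> (\<Inter>i\<in>S. X i) = {}"
    using reg unfolding regular_filter_def by blast
  have "finite {i. t \<in> X i}" for t
    using X(2)[of "{i. t \<in> X i}"] by blast
  then show ?thesis
    using that X(1) by blast
qed

end

lemma built_fromE:
  assumes "built_from D D\<^sub>0 U"
  obtains j where "built D D\<^sub>0 U j"
proof -
  from assms have 1: "ultrafilter D" "regular_filter D\<^sub>0" "excellent_filter D\<^sub>0" "ba_ultrafilter U"
    and "\<exists>j. ba_hom j \<and> surj j \<and> (\<forall>A. eventually (\<lambda>t. t \<in> A) D\<^sub>0 \<longleftrightarrow> j A = top) \<and>
        (\<forall>A. eventually (\<lambda>t. t \<in> A) D \<longleftrightarrow> j A \<in> U)"
    by (simp_all add: built_from_def)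
  then obtain j where "ba_hom j" "surj j" "\<forall>A. eventually (\<lambda>t. t \<in> A) D\<^sub>0 \<longleftrightarrow> j A = top"
    "\<forall>A. eventually (\<lambda>t. t \<in> A) D \<longleftrightarrow> j A \<in> U"
    by (elim exE conjE)
  with 1 show ?thesis
    by (intro that[of j]) (simp add: built_def)
qed

section \<open>Non-saturation\<close>

text \<open>Vertices of the partite hypergraphs below are pairs \<open>(i, c)\<close> with colour \<open>c \<le> k\<close>; a list
  \<open>xs\<close> of length \<open>k + 1\<close> stands for the rainbow edge \<open>transversal xs\<close>, and \<open>face c ys\<close> is
  the rainbow set of size \<open>k\<close> that avoids colour \<open>c\<close>.\<close>

definition transversal :: "'v list \<Rightarrow> ('v \<times> nat) set" where
  "transversal xs = (\<lambda>c. (xs ! c, c)) ` {..<length xs}"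

definition skip :: "nat \<Rightarrow> nat \<Rightarrow> nat" where
  "skip c i = (if i < c then i else Suc i)"

definition face :: "nat \<Rightarrow> 'v list \<Rightarrow> ('v \<times> nat) set" where
  "face c ys = (\<lambda>i. (ys ! i, skip c i)) ` {..<length ys}"

lemma card_transversal: "card (transversal xs) = length xs"
  by (simp add: transversal_def card_image inj_on_def)

lemma inj_skip: "inj (skip c)"
  by (auto simp: skip_def inj_on_def split: if_splits)

lemma card_face: "card (face c ys) = length ys"
proof -
  have "inj_on (\<lambda>i. (ys ! i, skip c i)) {..<length ys}"
    using inj_skip[of c] by (auto simp: inj_on_def)
  then show ?thesis
    by (simp add: face_def card_image)
qed

lemma finite_face [simp]: "finite (face c ys)" and finite_transversal [simp]: "finite (transversal xs)"
  by (simp_all add: face_def transversal_def)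

lemma transversal_eq_iff:
  assumes "length xs = length ys"
  shows "transversal xs = transversal ys \<longleftrightarrow> xs = ys"
proof
  assume eq: "transversal xs = transversal ys"
  show "xs = ys"
  proof (rule nth_equalityI)
    fix i assume "i < length xs"
    then have "(xs ! i, i) \<in> transversal ys"
      unfolding eq[symmetric] by (auto simp: transversal_def)
    then show "xs ! i = ys ! i"
      by (auto simp: transversal_def)
  qed (rule assms)
qed simp

lemma transversal_remove:
  assumes c: "c < length xs"
  shows "transversal xs - {(xs ! c, c)} = face c (take c xs @ drop (Suc c) xs)"
proof -
  let ?ys = "take c xs @ drop (Suc c) xs"
  have len: "length ?ys = length xs - 1"
    using c by simp
  have nth: "?ys ! i = xs ! skip c i" if "i < length xs - 1" for i
    using that c by (auto simp: skip_def nth_append min_def)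
  have "skip c ` {..<length xs - 1} = {..<length xs} - {c}"
  proof (intro equalityI subsetI)
    fix i assume "i \<in> skip c ` {..<length xs - 1}"
    then show "i \<in> {..<length xs} - {c}"
      by (auto simp: skip_def split: if_splits)
  next
    fix i assume i: "i \<in> {..<length xs} - {c}"
    show "i \<in> skip c ` {..<length xs - 1}"
    proof (cases "i < c")
      case True
      then show ?thesis
        using i c by (intro image_eqI[of _ _ i]) (auto simp: skip_def)
    next
      case False
      then show ?thesis
        using i by (intro image_eqI[of _ _ "i - 1"]) (auto simp: skip_def)
    qed
  qed
  moreover have "face c ?ys = (\<lambda>i. (xs ! i, i)) ` skip c ` {..<length xs - 1}"
    unfolding face_def image_image len using nth by (intro image_cong) auto
  moreover have "transversal xs - {(xs ! c, c)} = (\<lambda>i. (xs ! i, i)) ` ({..<length xs} - {c})"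
    by (auto simp: transversal_def)
  ultimately show ?thesis
    by metis
qed

text \<open>Pigeonhole: among k+2 vertices in k+1 colours two share a colour, and a (k+1)-set
  containing both is not rainbow. Hence every choice of rainbow edges is free of cliques, which is
  why their truth values can be prescribed at will.\<close>

lemma partite_no_clique:
  assumes k: "k > 0" and y: "card y = k+2" "y \<subseteq> UNIV \<times> {..k}"
  shows "\<exists>e\<subseteq>y. card e = k+1 \<and> (\<forall>xs. length xs = k+1 \<longrightarrow> e \<noteq> transversal xs)"
proof -
  have fin: "finite y"
    using y(1) card.infinite by fastforce
  have "\<not> inj_on snd y"
  proof
    assume "inj_on snd y"
    then have "card y \<le> card {..k}"
      using y(2) by (intro card_inj_on_le[of snd]) auto
    then show False
      using y(1) by simp
  qed
  then obtain u v where uv: "u \<in> y" "v \<in> y" "u \<noteq> v" "snd u = snd v"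
    by (auto simp: inj_on_def)
  have "card (y - {u, v}) = k"
    using uv fin y(1) by (subst card_Diff_subset) auto
  then obtain z where z: "z \<in> y" "z \<noteq> u" "z \<noteq> v"
    using k card_gt_0_iff[of "y - {u, v}"] by auto
  have "y - {z} \<noteq> transversal xs" for xs :: "'a list"
  proof
    assume "y - {z} = transversal xs"
    then have "u \<in> transversal xs" "v \<in> transversal xs"
      using uv z by auto
    then show False
      using uv(3,4) by (auto simp: transversal_def)
  qed
  moreover have "card (y - {z}) = k+1"
    using z(1) y(1) fin by simp
  ultimately show ?thesis
    by blast
qed

text \<open>Coordinates are subsets of the index set, and singletons already provide one for every
  finite list.\<close>

lemma list_coordinates:
  assumes inf: "infinite (UNIV :: 'i set)"
  obtains \<pi> :: "'i list \<Rightarrow> 'i set" where "inj \<pi>"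
proof -
  have "|UNIV :: 'i list set| \<le>o |UNIV :: 'i set|"
    using card_of_lists_ordLeq[OF inf] by (simp add: lists_UNIV)
  then obtain f :: "'i list \<Rightarrow> 'i" where "inj f"
    using card_of_ordLeq[of "UNIV :: 'i list set" "UNIV :: 'i set"] by auto
  then have "inj (\<lambda>xs. {f xs})"
    by (auto simp: inj_on_def)
  then show ?thesis
    using that by blast
qed

text \<open>Conditions with different values at \<open>x\<close> are incompatible, so the
  ultrafilter omits the generator of one of them.\<close>

lemma small_coordinate:
  fixes U :: "('d, 'm) B1 set"
  assumes U: "ba_ultrafilter U" and m: "infinite (UNIV :: 'm set)"
  obtains g :: "('d, 'm) fmap" where "fmdom' g = {x}" "gen g \<notin> U"
proof -
  obtain m0 :: 'm where True
    by blast
  obtain m1 :: 'm where "m1 \<noteq> m0"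
    using m by (metis (full_types) UNIV_eq_I finite.emptyI finite.insertI insertI1)
  let ?g = "\<lambda>m. fmupd x m fmempty"
  have "\<not> compatible (?g m0) (?g m1)"
    using \<open>m1 \<noteq> m0\<close> by (auto simp: compatible_iff)
  then have "gen (?g m0) \<sqinter> gen (?g m1) = bot"
    using gen_inf_nonzero_iff by blast
  then have "gen (?g m0) \<notin> U \<or> gen (?g m1) \<notin> U"
    using U unfolding ba_ultrafilter_def by metis
  then show ?thesis
    using that[of "?g m0"] that[of "?g m1"] by auto
qed

text \<open>The functions \<open>a v\<close> realise prescribed elements of the Boolean algebra as the truth values
  of the rainbow edges: at \<open>t\<close> only finitely many vertices are relevant, by regularity.\<close>

lemma (in built) prescribed_edges:
  fixes M :: "'a rstruct" and A :: "'i list \<Rightarrow> 'i set"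
  assumes k: "k > 0" and M: "extension_property k M"
  shows "\<exists>a :: 'i \<times> nat \<Rightarrow> 'i \<Rightarrow> 'a. (\<forall>v t. a v t \<in> Univ M) \<and>
    (\<forall>u\<in>UNIV \<times> {..k}. \<forall>v\<in>UNIV \<times> {..k}. u \<noteq> v \<longrightarrow> eventually (\<lambda>t. a u t \<noteq> a v t) D\<^sub>0) \<and>
    (\<forall>e. e \<subseteq> UNIV \<times> {..k} \<longrightarrow> card e = k+1 \<longrightarrow>
      eventually (\<lambda>t. (\<lambda>v. a v t) ` e \<in> edges M \<longleftrightarrow> (\<exists>xs. length xs = k+1 \<and> e = transversal xs \<and> t \<in> A xs)) D\<^sub>0)"
proof -
  obtain X :: "'i \<Rightarrow> 'i set" where X: "\<And>i. eventually (\<lambda>t. t \<in> X i) D\<^sub>0" "\<And>t. finite {i. t \<in> X i}"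
    using regular_family by metis
  obtain z where z: "z \<in> Univ M"
    using M by (auto simp: extension_property_def hypergraph_def is_struct_def)
  define V where "V t = {i. t \<in> X i} \<times> {..k}" for t
  define E where "E t = {transversal xs | xs. length xs = k+1 \<and> t \<in> A xs}" for t
  have "\<exists>f. inj_on f (V t) \<and> f ` V t \<subseteq> Univ M \<and> (\<forall>e\<subseteq>V t. card e = k+1 \<longrightarrow> (f ` e \<in> edges M \<longleftrightarrow> e \<in> E t))" for t
  proof (rule finite_hypergraph_embeds[OF M])
    show "finite (V t)"
      using X(2) by (simp add: V_def)
    fix y assume y: "y \<subseteq> V t" "card y = k+2"
    then have "y \<subseteq> UNIV \<times> {..k}"
      by (auto simp: V_def)
    then show "\<exists>e\<subseteq>y. card e = k+1 \<and> e \<notin> E t"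
      using partite_no_clique[OF k y(2)] by (auto simp: E_def)
  qed
  then obtain f where f: "\<And>t. inj_on (f t) (V t)" "\<And>t. f t ` V t \<subseteq> Univ M"
    "\<And>t e. e \<subseteq> V t \<Longrightarrow> card e = k+1 \<Longrightarrow> f t ` e \<in> edges M \<longleftrightarrow> e \<in> E t"
    by metis
  \<comment> \<open>The default \<open>z\<close> is used where \<open>v\<close> is not yet among the
    relevant vertices; this happens only on a null set for each \<open>v\<close>.\<close>
  define a where "a v t = (if v \<in> V t then f t v else z)" for v t
  have evV: "eventually (\<lambda>t. v \<in> V t) D\<^sub>0" if "v \<in> UNIV \<times> {..k}" for v
    using X(1)[of "fst v"] by (rule eventually_mono) (use that in \<open>auto simp: V_def\<close>)
  show ?thesis
  proof (intro exI[of _ a] conjI allI impI ballI)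
    show "a v t \<in> Univ M" for v t
      using f(2) z by (auto simp: a_def)
    show "eventually (\<lambda>t. a u t \<noteq> a v t) D\<^sub>0" if "u \<in> UNIV \<times> {..k}" "v \<in> UNIV \<times> {..k}" "u \<noteq> v" for u v
      using evV[OF that(1)] evV[OF that(2)]
    proof (rule eventually_elim2)
      fix t assume "u \<in> V t" "v \<in> V t"
      then show "a u t \<noteq> a v t"
        using that(3) f(1)[of t] by (auto simp: a_def inj_on_def)
    qed
    fix e :: "('i \<times> nat) set" assume e: "e \<subseteq> UNIV \<times> {..k}" "card e = k+1"
    have "finite e"
      using e(2) card.infinite by fastforce
    then have "eventually (\<lambda>t. \<forall>v\<in>e. v \<in> V t) D\<^sub>0"
      using evV e(1) by (intro eventually_ball_finite) auto
    then show "eventually (\<lambda>t. (\<lambda>v. a v t) ` e \<in> edges M \<longleftrightarrow>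
        (\<exists>xs. length xs = k+1 \<and> e = transversal xs \<and> t \<in> A xs)) D\<^sub>0"
    proof (rule eventually_mono)
      fix t assume t: "\<forall>v\<in>e. v \<in> V t"
      then have "(\<lambda>v. a v t) ` e = f t ` e"
        by (intro image_cong) (auto simp: a_def)
      then show "(\<lambda>v. a v t) ` e \<in> edges M \<longleftrightarrow> (\<exists>xs. length xs = k+1 \<and> e = transversal xs \<and> t \<in> A xs)"
        using f(3)[of e t] t e(2) by (auto simp: E_def)
    qed
  qed
qed

text \<open>Colours make every (k+1)-set of interest the transversal of a unique list
  \<open>xs\<close>, which can thus own the coordinate \<open>\<pi> xs\<close>, and they turn its
  k-subsets into faces indexed by the missing colour. What the free tuple has to achieve is that
  \<open>\<pi> xs\<close> avoids the supports attached to the faces of \<open>xs\<close>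
  itself.\<close>

theorem not_saturated_ultrapower:
  fixes D D\<^sub>0 :: "'i filter" and M :: "'a rstruct" and U :: "('i set, 'm) B1 set" and lam :: "'i rel"
  assumes built: "built D D\<^sub>0 U j" and inf: "infinite (UNIV :: 'm set)" "infinite (UNIV :: 'i set)"
    and large: "beyond_aleph k (UNIV :: 'm set) (UNIV :: 'i set)" and lam: "card_order lam"
    and k: "k > 0" and M: "extension_property k M"
  shows "\<not> saturated (k+1) (cardSuc lam) (ultrapower D M)"
proof
  interpret built D D\<^sub>0 U j
    by (rule built)
  let ?N = "ultrapower D M"
  have hypM: "hypergraph k M"
    using M by (simp add: extension_property_def)
  have N: "extension_property k ?N"
    using ultrapower_extension_property[OF D k M] .
  then have hypN: "hypergraph k ?N"
    by (simp add: extension_property_def)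
  obtain \<pi> :: "'i list \<Rightarrow> 'i set" where \<pi>: "inj \<pi>"
    using list_coordinates[OF inf(2)] .
  have "\<exists>g :: ('i set, 'm) fmap. fmdom' g = {\<pi> xs} \<and> gen g \<notin> U" for xs
    using small_coordinate[OF U inf(1)] by metis
  \<comment> \<open>The value of the edge \<open>xs\<close> is nonzero but outside the ultrafilter.
    So no transversal is an edge of the ultrapower, which makes the type consistent, while a
    condition may still force one to be an edge.\<close>
  then obtain g :: "'i list \<Rightarrow> ('i set, 'm) fmap" where g: "\<And>xs. fmdom' (g xs) = {\<pi> xs}" "\<And>xs. gen (g xs) \<notin> U"
    by metis
  have "\<exists>B. j B = gen (g xs)" for xs
    using surj by (metis surjD)
  then obtain A where A: "\<And>xs. j (A xs) = gen (g xs)"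
    by metis
  obtain a :: "'i \<times> nat \<Rightarrow> 'i \<Rightarrow> 'a" where "\<forall>v t. a v t \<in> Univ M"
    "\<forall>u\<in>UNIV \<times> {..k}. \<forall>v\<in>UNIV \<times> {..k}. u \<noteq> v \<longrightarrow> eventually (\<lambda>t. a u t \<noteq> a v t) D\<^sub>0"
    "\<forall>e. e \<subseteq> UNIV \<times> {..k} \<longrightarrow> card e = k+1 \<longrightarrow>
      eventually (\<lambda>t. (\<lambda>v. a v t) ` e \<in> edges M \<longleftrightarrow> (\<exists>xs. length xs = k+1 \<and> e = transversal xs \<and> t \<in> A xs)) D\<^sub>0"
    using prescribed_edges[OF k M, of A] by (elim exE conjE)
  note a = this[rule_format]
  let ?V = "UNIV \<times> {..k} :: ('i \<times> nat) set"
  define b where "b v = ultra_class D M (a v)" for v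
  have injb: "inj_on b ?V"
  proof (rule inj_onI, rule ccontr)
    fix u v assume uv: "u \<in> ?V" "v \<in> ?V" "b u = b v" "u \<noteq> v"
    have "eventually (\<lambda>t. a u t = a v t) D"
      using uv(3) ultra_class_eq_iff[of "a u" M "a v" D] a(1) by (simp add: b_def)
    moreover have "\<not> eventually (\<lambda>t. a u t = a v t) D"
      using D\<^sub>0_imp_D[OF a(2)[OF uv(1,2,4)]] by (simp add: ultrafilter_not[OF D])
    ultimately show False
      by blast
  qed
  have noedge: "b ` e \<notin> edges ?N" if e: "e \<subseteq> ?V" "card e = k+1" for e
  proof
    assume "b ` e \<in> edges ?N"
    then have "eventually (\<lambda>t. (\<lambda>v. a v t) ` e \<in> edges M) D"
      unfolding b_def using ultrapower_edges_iff[OF D hypM a(1) e(2)] by simp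
    then have ev: "eventually (\<lambda>t. \<exists>xs. length xs = k+1 \<and> e = transversal xs \<and> t \<in> A xs) D"
      using D\<^sub>0_imp_D[OF a(3)[OF e]] by (rule eventually_elim2) simp
    have "D \<noteq> bot"
      using D by (simp add: ultrafilter_def)
    then obtain xs where xs: "length xs = k+1" "e = transversal xs"
      using eventually_happens'[OF _ ev] by blast
    have "eventually (\<lambda>t. t \<in> A xs) D"
      using ev
    proof (rule eventually_mono)
      fix t assume "\<exists>zs. length zs = k+1 \<and> e = transversal zs \<and> t \<in> A zs"
      then obtain zs where "length zs = k+1" "transversal xs = transversal zs" "t \<in> A zs"
        using xs(2) by blast
      then show "t \<in> A xs"
        using transversal_eq_iff[of xs zs] xs(1) by simp
    qed
    then have "gen (g xs) \<in> U"
      using D_iff[of "A xs"] A[of xs] by simp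
    then show False
      using g(2) by blast
  qed
  define env where "env c ys i = b (ys ! (i - 1), skip c (i - 1))" for c ys and i :: nat
  define R where "R = FRel [0..<k+1]"
  define p where "p = {(R, env c ys) | c ys. c \<le> k \<and> length ys = k}"
  have faceV: "face c ys \<subseteq> ?V" if "c \<le> k" "length ys = k" for c ys
    using that by (auto simp: face_def skip_def)
  have satR: "sat ?N ((env c ys)(0 := x)) R \<longleftrightarrow> insert x (b ` face c ys) \<in> edges ?N"
    if "length ys = k" for c ys x
  proof -
    have "map ((env c ys)(0 := x)) [0..<k+1] = x # map (\<lambda>i. b (ys ! i, skip c i)) [0..<k]"
      by (rule nth_equalityI) (auto simp: env_def nth_Cons split: nat.splits simp del: upt_Suc)
    moreover have "b ` face c ys = set (map (\<lambda>i. b (ys ! i, skip c i)) [0..<k])"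
      using that by (auto simp: face_def image_image lessThan_atLeast0)
    ultimately show ?thesis
      by (simp add: R_def hypergraph_Rel[OF hypN] del: upt_Suc)
  qed
  assume sat: "saturated (k+1) (cardSuc lam) ?N"
  have "\<exists>x\<in>Univ ?N. realizes ?N x p"
  proof (rule sat[unfolded saturated_def, THEN spec[of _ "b ` ?V"], THEN spec[of _ p], THEN mp], intro conjI allI impI)
    show "b ` ?V \<subseteq> Univ ?N"
      using a(1) by (auto simp: b_def ultrapower_simps)
    have "|b ` ?V| \<le>o |?V|"
      by (rule card_of_image)
    also have "|?V| \<le>o |UNIV :: 'i set|"
      using inf(2) by (intro card_Times_ordLeq) (auto simp: finite_card_ordLeq intro: ordLeq_refl card_of_Card_order)
    also have "|UNIV :: 'i set| \<le>o lam"
      using lam card_of_least by (metis card_order_on_well_order_on)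
    finally have "|b ` ?V| \<le>o lam" .
    then show "|b ` ?V| <o cardSuc lam"
      using cardSuc_ordLeq_ordLess[of lam "|b ` ?V|"] lam card_order_on_Card_order card_of_Card_order by blast
    show "p \<subseteq> param_formulas (k+1) (b ` ?V)"
    proof
      fix x assume "x \<in> p"
      then obtain c ys where x: "x = (R, env c ys)" "c \<le> k" "length ys = k"
        by (auto simp: p_def)
      have "env c ys i \<in> b ` ?V" if "i \<in> fv R - {0}" for i
        using that x(2) by (auto simp: env_def skip_def R_def simp del: upt_Suc)
      then show "x \<in> param_formulas (k+1) (b ` ?V)"
        by (simp add: x(1) param_formulas_def) (simp add: R_def)
    qed
    fix q assume q: "q \<subseteq> p" "finite q"
    then obtain Q where Q: "finite Q" "Q \<subseteq> {(c, ys). c \<le> k \<and> length ys = k}" "q = (\<lambda>(c, ys). (R, env c ys)) ` Q"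
    proof -
      have "p = (\<lambda>(c, ys). (R, env c ys)) ` {(c, ys). c \<le> k \<and> length ys = k}"
        by (auto simp: p_def image_def)
      then show ?thesis
        using q that finite_subset_image[of q "\<lambda>(c, ys). (R, env c ys)"] by metis
    qed
    define S where "S = (\<Union>(c, ys)\<in>Q. face c ys)"
    have S: "finite S" "S \<subseteq> ?V"
      using Q faceV by (auto simp: S_def)
    have SU: "b ` S \<subseteq> Univ ?N"
      using a(1) by (auto simp: b_def ultrapower_simps)
    have "\<exists>x\<in>Univ ?N - b ` S. \<forall>w\<subseteq>b ` S. card w = k \<longrightarrow> (insert x w \<in> edges ?N \<longleftrightarrow> w \<in> UNIV)"
    proof (rule extension_propertyD[OF N])
      show "finite (b ` S)" "b ` S \<subseteq> Univ ?N"
        using S SU by auto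
      fix e assume e: "e \<in> edges ?N" "e \<subseteq> b ` S"
      then obtain e0 where e0: "e0 \<subseteq> S" "e = b ` e0"
        by (meson subset_imageE)
      have "card e0 = k+1"
        using hypergraph_edges(2)[OF hypN e(1)] e0 S(2) injb by (metis card_image inj_on_subset subset_trans)
      then have False
        using noedge[of e0] e0 S(2) e(1) by blast
      then show "\<exists>w\<subseteq>e. card w = k \<and> w \<notin> UNIV"
        by blast
    qed
    then obtain x where x: "x \<in> Univ ?N" "\<And>w. w \<subseteq> b ` S \<Longrightarrow> card w = k \<Longrightarrow> insert x w \<in> edges ?N"
      by blast
    have "sat ?N (e(0 := x)) \<phi>" if mem: "(\<phi>, e) \<in> q" for \<phi> e
    proof -
      obtain c ys where cys: "(c, ys) \<in> Q" "\<phi> = R" "e = env c ys"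
        using mem Q(3) by auto
      then have l: "c \<le> k" "length ys = k"
        using Q(2) by auto
      have "face c ys \<subseteq> S"
        using cys(1) by (auto simp: S_def)
      moreover have "card (b ` face c ys) = k"
        using injb faceV[OF l] card_face[of c ys] l by (metis card_image inj_on_subset)
      ultimately show ?thesis
        unfolding cys using satR[OF l(2)] x(2)[of "b ` face c ys"] by blast
    qed
    then show "\<exists>x\<in>Univ ?N. realizes ?N x q"
      using x(1) by (auto simp: realizes_def)
  qed
  then obtain h where h: "\<And>t. h t \<in> Univ M" "realizes ?N (ultra_class D M h) p"
    by (auto simp: ultrapower_simps)
  define B where "B c ys = {t. insert (h t) ((\<lambda>v. a v t) ` face c ys) \<in> edges M}" for c ys
  have BU: "j (B c ys) \<in> U" if cys: "c \<le> k" "length ys = k" for c ys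
  proof -
    have "sat ?N ((env c ys)(0 := ultra_class D M h)) R"
      using h(2) cys unfolding realizes_def p_def by blast
    then have e: "insert (ultra_class D M h) (b ` face c ys) \<in> edges ?N"
      using satR[OF cys(2)] by blast
    let ?a = "case_option h a"
    let ?w = "insert None (Some ` face c ys)"
    have "card ?w = k+1"
      using card_face[of c ys] cys(2) by (simp add: card_image)
    moreover have "?a v t \<in> Univ M" for v t
      using a(1) h(1) by (cases v) auto
    moreover have "(\<lambda>v. ultra_class D M (?a v)) ` ?w = insert (ultra_class D M h) (b ` face c ys)"
      by (simp add: image_image b_def)
    ultimately have "eventually (\<lambda>t. (\<lambda>v. ?a v t) ` ?w \<in> edges M) D"
      using ultrapower_edges_iff[OF D hypM, of ?a ?w] e by simp
    moreover have "(\<lambda>v. ?a v t) ` ?w = insert (h t) ((\<lambda>v. a v t) ` face c ys)" for t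
      by (simp add: image_image)
    ultimately have "eventually (\<lambda>t. t \<in> B c ys) D"
      by (simp add: B_def)
    then show ?thesis
      using D_iff by blast
  qed
  have "\<exists>S. |S| \<le>o |UNIV :: 'm set| \<and> supported S (Rep_B1 (j (B c ys)))" for c ys
    using small_support[OF inf(1)] by metis
  then obtain S where S: "\<And>c ys. |S c ys| \<le>o |UNIV :: 'm set|" "\<And>c ys. supported (S c ys) (Rep_B1 (j (B c ys)))"
    by metis
  \<comment> \<open>All indices used by lists whose coordinate occurs in the support of the face. If
    \<open>\<pi> xs\<close> occurred in the support of the face of \<open>xs\<close> missing
    \<open>c\<close>, then \<open>xs ! c\<close> would be among them; a free tuple excludes
    this.\<close>
  define F where "F c ys = (\<Union>xs\<in>{xs. \<pi> xs \<in> S c ys}. set xs)" for c ys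
  have "|F c ys| \<le>o |UNIV :: 'm set|" for c ys
    unfolding F_def
  proof (rule card_of_UNION_ordLeq_infinite[OF inf(1)])
    have "|{xs. \<pi> xs \<in> S c ys}| \<le>o |S c ys|"
      using \<pi> by (intro card_of_ordLeqI[of \<pi>]) (auto intro: inj_on_subset)
    then show "|{xs. \<pi> xs \<in> S c ys}| \<le>o |UNIV :: 'm set|"
      using S(1) ordLeq_transitive by blast
    show "\<forall>xs\<in>{xs. \<pi> xs \<in> S c ys}. |set xs| \<le>o |UNIV :: 'm set|"
      using inf(1) by (simp add: finite_card_ordLeq)
  qed
  then obtain xs where xs: "length xs = Suc k" "\<forall>c\<le>k. xs ! c \<notin> F c (take c xs @ drop (Suc c) xs)"
    using kuratowski_free_tuple[OF inf(1) large, of F] by blast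
  define ys where "ys c = take c xs @ drop (Suc c) xs" for c
  have ys: "length (ys c) = k" if "c \<le> k" for c
    using xs(1) that by (simp add: ys_def)
  have face: "transversal xs - {(xs ! c, c)} = face c (ys c)" if "c \<le> k" for c
    using transversal_remove[of c xs] xs(1) that by (simp add: ys_def)
  have free: "\<pi> xs \<notin> S c (ys c)" if "c \<le> k" for c
  proof
    assume "\<pi> xs \<in> S c (ys c)"
    then have "set xs \<subseteq> F c (ys c)"
      by (auto simp: F_def)
    moreover have "xs ! c \<in> set xs"
      using xs(1) that by simp
    ultimately show False
      using xs(2) that by (auto simp: ys_def)
  qed
  have "j (\<Inter>c\<in>{..k}. B c (ys c)) \<in> U"
    using BU ys by (intro j_INT_U) auto
  then have "j (\<Inter>c\<in>{..k}. B c (ys c)) \<noteq> bot"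
    using U_bot by metis
  then obtain r where r0: "r \<in> Rep_B1 (j (\<Inter>c\<in>{..k}. B c (ys c)))"
    using Rep_B1_nonempty by blast
  have r: "r \<in> Rep_B1 (j (B c (ys c)))" if "c \<le> k" for c
  proof -
    have "j (\<Inter>c\<in>{..k}. B c (ys c)) \<le> j (B c (ys c))"
      using that by (intro j_mono INT_lower) simp
    then have "Rep_B1 (j (\<Inter>c\<in>{..k}. B c (ys c))) \<subseteq> Rep_B1 (j (B c (ys c)))"
      by (simp only: less_eq_B1_def)
    then show ?thesis
      using r0 by (rule subsetD)
  qed
  \<comment> \<open>Deleting the coordinate \<open>\<pi> xs\<close> does not disturb the faces,
    whose supports avoid it, and makes room for \<open>g xs\<close>.\<close>
  let ?r = "fmrestrict_set (- {\<pi> xs}) r"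
  have r': "?r \<in> Rep_B1 (j (B c (ys c)))" if "c \<le> k" for c
  proof -
    have "supported (- {\<pi> xs}) (Rep_B1 (j (B c (ys c))))"
      by (rule supported_mono[OF S(2)[of c "ys c"]]) (use free[OF that] in simp)
    then show ?thesis
      using r[OF that] by (simp add: supported_def)
  qed
  have "compatible ?r (g xs)"
    using g(1)[of xs] by (auto simp: compatible_iff dest: fmdom'I)
  then obtain s where s: "?r \<subseteq>\<^sub>f s" "g xs \<subseteq>\<^sub>f s"
    by (auto simp: compatible_def)
  have "g xs \<in> Rep_B1 (j (A xs))"
    using A[of xs] gen_le_iff[of "g xs" "j (A xs)"] by simp
  then have sA: "s \<in> Rep_B1 (j (A xs))"
    using s(2) Rep_B1_upward by blast
  have sB: "s \<in> Rep_B1 (j (\<Inter>c\<in>{..k}. B c (ys c)))"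
    using r' s(1) Rep_B1_upward by (intro j_INT_Rep) auto
  \<comment> \<open>The indices at which the prescription for this transversal is obeyed. The set
    has value top, so every condition forces it.\<close>
  let ?G = "{t. (\<lambda>v. a v t) ` transversal xs \<in> edges M \<longleftrightarrow>
      (\<exists>zs. length zs = k+1 \<and> transversal xs = transversal zs \<and> t \<in> A zs)}"
  have "transversal xs \<subseteq> ?V"
    using xs(1) by (auto simp: transversal_def)
  then have "eventually (\<lambda>t. t \<in> ?G) D\<^sub>0"
    using a(3)[of "transversal xs"] card_transversal[of xs] xs(1) by simp
  then have "j ?G = top"
    using D\<^sub>0_iff[of ?G] by blast
  then have "s \<in> Rep_B1 (j (A xs \<inter> (\<Inter>c\<in>{..k}. B c (ys c)) \<inter> ?G))"
    using sA sB by simp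
  then obtain t where t: "t \<in> A xs \<inter> (\<Inter>c\<in>{..k}. B c (ys c)) \<inter> ?G"
    using Rep_j_nonempty by blast
  let ?e = "(\<lambda>v. a v t) ` transversal xs"
  have e: "?e \<in> edges M"
    using t xs(1) by auto
  have B: "insert (h t) ((\<lambda>v. a v t) ` face c (ys c)) \<in> edges M" if "c \<le> k" for c
    using t that by (auto simp: B_def)
  have inj: "inj_on (\<lambda>v. a v t) (transversal xs)"
    using hypergraph_edges(2)[OF hypM e] card_transversal[of xs] xs(1) by (intro eq_card_imp_inj_on) auto
  have notin: "h t \<notin> (\<lambda>v. a v t) ` face c (ys c)" if "c \<le> k" for c
  proof
    assume "h t \<in> (\<lambda>v. a v t) ` face c (ys c)"
    then have "card ((\<lambda>v. a v t) ` face c (ys c)) = k+1"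
      using hypergraph_edges(2)[OF hypM B[OF that]] by (simp add: insert_absorb)
    moreover have "card ((\<lambda>v. a v t) ` face c (ys c)) \<le> k"
      using card_image_le[of "face c (ys c)" "\<lambda>v. a v t"] card_face[of c "ys c"] ys[OF that] by simp
    ultimately show False
      by simp
  qed
  have "h t \<notin> ?e"
  proof
    assume "h t \<in> ?e"
    then obtain c where c: "c \<le> k" "h t = a (xs ! c, c) t"
      using xs(1) less_Suc_eq_le unfolding transversal_def by (metis (no_types, lifting) imageE lessThan_iff)
    \<comment> \<open>Since k > 0 there is a second colour, and the face missing it still contains
      the vertex of colour \<open>c\<close>.\<close>
    obtain c' where c': "c' \<le> k" "c' \<noteq> c"
      using k by (metis le0 less_or_eq_imp_le neq0_conv)
    have "(xs ! c, c) \<in> face c' (ys c')"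
      using c c' xs(1) by (auto simp flip: face simp: transversal_def)
    then show False
      using notin[OF c'(1)] c(2) by blast
  qed
  \<comment> \<open>Every k-subset of a transversal is one of its faces, and all faces are joined to
    \<open>h t\<close>; the cone lemma says that one of them is not.\<close>
  then obtain w where w: "w \<subseteq> ?e" "card w = k" "insert (h t) w \<notin> edges M"
    using hypergraph_cone[OF hypM e h(1)] by blast
  obtain w0 where w0: "w0 \<subseteq> transversal xs" "w = (\<lambda>v. a v t) ` w0"
    using w(1) by (meson subset_imageE)
  have cw0: "card w0 = k"
    using w(2) w0 inj by (metis card_image inj_on_subset)
  have "\<not> transversal xs \<subseteq> w0"
    using cw0 w0(1) card_transversal[of xs] xs(1) by (metis n_not_Suc_n subset_antisym)
  then obtain v where v: "v \<in> transversal xs" "v \<notin> w0"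
    by blast
  then obtain c where c: "c \<le> k" "v = (xs ! c, c)"
    using xs(1) less_Suc_eq_le unfolding transversal_def by (metis (no_types, lifting) imageE lessThan_iff)
  have "w0 \<subseteq> face c (ys c)"
    using w0(1) v(2) c face[OF c(1)] by blast
  then have "w0 = face c (ys c)"
    using cw0 card_face[of c "ys c"] ys[OF c(1)] by (intro card_subset_eq) auto
  then show False
    using w(3) w0(2) B[OF c(1)] by simp
qed

section \<open>Saturation\<close>

lemma finite_fmap_of:
  assumes "finite A"
  obtains g where "fmlookup g = (\<lambda>x. if x \<in> A then Some (h x) else None)"
proof -
  have "finite (dom (\<lambda>x. if x \<in> A then Some (h x) else None))"
    using assms by (rule rev_finite_subset) (auto split: if_splits)
  then obtain g where "fmlookup g = (\<lambda>x. if x \<in> A then Some (h x) else None)"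
    by (rule finite_map_fmap)
  then show ?thesis
    by (rule that)
qed

text \<open>An index \<open>i\<close> stands for the formula about the k-set
  \<open>\<sigma> i\<close> of names, and \<open>a\<close> lists the parameters, possibly with
  repetitions. The coordinates in \<open>S\<close> govern equalities and edges between names; those
  of the form \<open>\<nu> w\<close> are fresh. A value at \<open>\<nu> z\<close> is read through
  \<open>dec z\<close> as a finite set, and every finite subset of \<open>F z\<close> occurs in this
  way; \<open>m0\<close> and \<open>m1\<close> serve as truth values, and \<open>less\<close>
  selects representatives.\<close>

locale edge_type = built D D\<^sub>0 U j
  for D D\<^sub>0 :: "'i filter" and U :: "('d, 'm) B1 set" and j +
  fixes k :: nat and M :: "'a rstruct" and a :: "'i \<Rightarrow> 'i \<Rightarrow> 'a" and \<sigma> :: "'i \<Rightarrow> 'i set"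
    and P :: "('i \<Rightarrow> 'a) set set set" and S :: "'d set" and \<nu> :: "'i set \<Rightarrow> 'd"
    and F :: "'i set \<Rightarrow> 'i set" and dec :: "'i set \<Rightarrow> 'm \<Rightarrow> 'i set" and m0 m1 :: 'm and less :: "'i rel"
  assumes k: "k > 0" and M: "extension_property k M" and a: "\<And>v t. a v t \<in> Univ M"
    and \<sigma>: "range \<sigma> = {w. card w = k}"
    and \<nu>: "inj_on \<nu> {w. finite w}" "\<And>w. finite w \<Longrightarrow> \<nu> w \<notin> S"
    and F: "\<And>v. finite v \<Longrightarrow> card v = k+1 \<Longrightarrow> \<exists>z\<subseteq>v. card z = k-1 \<and> v - z \<subseteq> F z"
    and dec: "\<And>z m. finite (dec z m)" "\<And>z s. finite s \<Longrightarrow> s \<subseteq> F z \<Longrightarrow> \<exists>m. dec z m = s"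
    and m01: "m0 \<noteq> m1"
    and less: "wf less" "\<And>x y. x \<noteq> y \<Longrightarrow> (x, y) \<in> less \<or> (y, x) \<in> less"
    and sup_eq: "\<And>x y. supported S (Rep_B1 (j {t. a x t = a y t}))"
    and sup_ed: "\<And>v. finite v \<Longrightarrow> supported S (Rep_B1 (j {t. (\<lambda>y. a y t) ` v \<in> edges M}))"
    and cons: "\<And>u. finite u \<Longrightarrow> \<exists>b\<in>Univ (ultrapower D M). \<forall>i\<in>u.
      insert b ((\<lambda>y. ultra_class D M (a y)) ` \<sigma> i) \<in> edges (ultrapower D M) \<longleftrightarrow>
      (\<lambda>y. ultra_class D M (a y)) ` \<sigma> i \<in> P \<and> card ((\<lambda>y. ultra_class D M (a y)) ` \<sigma> i) = k"
begin

abbreviation "N \<equiv> ultrapower D M"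

definition "cl y = ultra_class D M (a y)"
definition "pos i \<longleftrightarrow> cl ` \<sigma> i \<in> P \<and> card (cl ` \<sigma> i) = k"
definition "eq x y = j {t. a x t = a y t}"
definition "ed v = j {t. (\<lambda>y. a y t) ` v \<in> edges M}"
text \<open>The values under \<open>j\<close> of the sets of such \<open>t\<close> form the sequence
  to be refined.\<close>

definition "solvable t u \<longleftrightarrow> (\<exists>x\<in>Univ M. \<forall>i\<in>u. insert x ((\<lambda>y. a y t) ` \<sigma> i) \<in> edges M \<longleftrightarrow> pos i)"

text \<open>Distinct indices may denote the same vertex at some \<open>t\<close>. Replacing each index by its least
  representative, which a condition can force, is what makes the construction independent of any
  bound on \<open>\<lambda>\<close> in terms of \<open>2\<^sup>\<mu>\<close>.\<close>

definition "rep y r p \<longleftrightarrow> p \<in> Rep_B1 (eq y r) \<and> (\<forall>r'. (r', r) \<in> less \<longrightarrow> p \<in> Rep_B1 (- eq y r'))"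

text \<open>The coordinate \<open>\<nu> w\<close> of a \<open>k\<close>-set \<open>w\<close> says whether \<open>w\<close> belongs to the generic positive part
  of the type; the coordinate \<open>\<nu> z\<close> of a \<open>(k-1)\<close>-set \<open>z\<close> bounds the \<open>y \<in> F z\<close> for which
  \<open>insert y z\<close> may be positive by a finite set.\<close>

definition "safe p w \<longleftrightarrow> fmlookup p (\<nu> w) = Some m1 \<and>
  (\<forall>z\<subseteq>w. card z = k-1 \<longrightarrow> w - z \<subseteq> F z \<longrightarrow> (\<exists>m. fmlookup p (\<nu> z) = Some m \<and> w - z \<subseteq> dec z m \<and>
     (\<forall>y\<in>dec z m - w. p \<in> Rep_B1 (- ed (insert y w)) \<or>
        (\<exists>w'\<subseteq>insert y w. card w' = k \<and> fmlookup p (\<nu> w') = Some m0))))"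

text \<open>The conditions that promise the truth value required by formula \<open>i\<close>. A
  negative formula whose names collapse needs no promise, because a vertex and fewer than k others
  never form an edge; a positive one must have its names kept distinct.\<close>

definition "Q i = {p. \<exists>\<rho>. (\<forall>y\<in>\<sigma> i. rep y (\<rho> y) p) \<and>
  (if pos i then inj_on \<rho> (\<sigma> i) \<and> safe p (\<rho> ` \<sigma> i)
   else inj_on \<rho> (\<sigma> i) \<longrightarrow> fmlookup p (\<nu> (\<rho> ` \<sigma> i)) = Some m0)}"

section \<open>Conditions in Q solve the type\<close>

lemma hypM: "hypergraph k M" and N: "extension_property k N" and hypN: "hypergraph k N"
  using M ultrapower_extension_property[OF D k M] by (simp_all add: extension_property_def)

lemma card_\<sigma>: "card (\<sigma> i) = k"
  using \<sigma> by auto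

lemma finite_\<sigma> [simp]: "finite (\<sigma> i)"
  using card_\<sigma>[of i] k card.infinite by fastforce

lemma eq_U: "eq x y \<in> U \<longleftrightarrow> cl x = cl y"
  using D_iff[of "{t. a x t = a y t}"] ultra_class_eq_iff[of "a x" M "a y" D] a by (simp add: eq_def cl_def)

lemma ed_U: "card v = k+1 \<Longrightarrow> ed v \<in> U \<longleftrightarrow> cl ` v \<in> edges N"
  using D_iff[of "{t. (\<lambda>y. a y t) ` v \<in> edges M}"] ultrapower_edges_iff[OF D hypM a, of v] by (simp add: ed_def cl_def)

lemma rep_upward: "rep y r p \<Longrightarrow> p \<subseteq>\<^sub>f q \<Longrightarrow> rep y r q"
  unfolding rep_def using Rep_B1_upward by blast

lemma safe_upward: "safe p w \<Longrightarrow> p \<subseteq>\<^sub>f q \<Longrightarrow> safe q w"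
proof -
  assume p: "safe p w" and pq: "p \<subseteq>\<^sub>f q"
  have lk: "fmlookup q x = Some m" if "fmlookup p x = Some m" for x m
    using fmsubset_lookup[OF pq that] .
  have up: "q \<in> Rep_B1 x" if "p \<in> Rep_B1 x" for x
    using Rep_B1_upward[OF that pq] .
  show "safe q w"
    unfolding safe_def
  proof (intro conjI allI impI)
    show "fmlookup q (\<nu> w) = Some m1"
      using p lk by (simp add: safe_def)
    fix z assume z: "z \<subseteq> w" "card z = k-1" "w - z \<subseteq> F z"
    then obtain m where m: "fmlookup p (\<nu> z) = Some m" "w - z \<subseteq> dec z m"
      "\<forall>y\<in>dec z m - w. p \<in> Rep_B1 (- ed (insert y w)) \<or>
        (\<exists>w'\<subseteq>insert y w. card w' = k \<and> fmlookup p (\<nu> w') = Some m0)"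
      using p unfolding safe_def by blast
    show "\<exists>m. fmlookup q (\<nu> z) = Some m \<and> w - z \<subseteq> dec z m \<and>
     (\<forall>y\<in>dec z m - w. q \<in> Rep_B1 (- ed (insert y w)) \<or>
        (\<exists>w'\<subseteq>insert y w. card w' = k \<and> fmlookup q (\<nu> w') = Some m0))"
    proof (intro exI[of _ m] conjI ballI)
      show "fmlookup q (\<nu> z) = Some m" "w - z \<subseteq> dec z m"
        using m lk by auto
      fix y assume "y \<in> dec z m - w"
      with m(3) have "p \<in> Rep_B1 (- ed (insert y w)) \<or>
        (\<exists>w'\<subseteq>insert y w. card w' = k \<and> fmlookup p (\<nu> w') = Some m0)"
        by (rule bspec)
      then show "q \<in> Rep_B1 (- ed (insert y w)) \<or>
        (\<exists>w'\<subseteq>insert y w. card w' = k \<and> fmlookup q (\<nu> w') = Some m0)"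
        using up lk by blast
    qed
  qed
qed

lemma Q_upward:
  assumes "p \<in> Q i" "p \<subseteq>\<^sub>f q"
  shows "q \<in> Q i"
proof -
  obtain \<rho> where \<rho>: "\<forall>y\<in>\<sigma> i. rep y (\<rho> y) p"
    "if pos i then inj_on \<rho> (\<sigma> i) \<and> safe p (\<rho> ` \<sigma> i)
     else inj_on \<rho> (\<sigma> i) \<longrightarrow> fmlookup p (\<nu> (\<rho> ` \<sigma> i)) = Some m0"
    using assms(1) by (auto simp: Q_def)
  have "\<forall>y\<in>\<sigma> i. rep y (\<rho> y) q"
    using \<rho>(1) rep_upward assms(2) by blast
  moreover have "if pos i then inj_on \<rho> (\<sigma> i) \<and> safe q (\<rho> ` \<sigma> i)
     else inj_on \<rho> (\<sigma> i) \<longrightarrow> fmlookup q (\<nu> (\<rho> ` \<sigma> i)) = Some m0"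
    using \<rho>(2) safe_upward[OF _ assms(2)] fmsubset_lookup[OF assms(2)] by (auto split: if_splits)
  ultimately show ?thesis
    unfolding Q_def by blast
qed

lemma Rep_eq_trans:
  assumes "p \<in> Rep_B1 (eq x y)" "p \<in> Rep_B1 (eq x z)"
  shows "p \<in> Rep_B1 (eq y z)"
proof -
  have "p \<in> Rep_B1 (j ({t. a x t = a y t} \<inter> {t. a x t = a z t}))"
    using assms by (simp add: eq_def)
  moreover have "j ({t. a x t = a y t} \<inter> {t. a x t = a z t}) \<le> j {t. a y t = a z t}"
    by (rule j_mono) auto
  ultimately show ?thesis
    unfolding eq_def less_eq_B1_def by blast
qed

lemma eq_sym: "eq x y = eq y x"
  by (simp add: eq_def eq_commute)

text \<open>Of two different representatives one is smaller. The condition would force the name with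
  the larger representative to differ from the smaller one and, by transitivity, to equal
  it.\<close>

lemma rep_unique:
  assumes "rep y r p" "rep y' r' p" "p \<in> Rep_B1 (eq y y')"
  shows "r = r'"
proof (rule ccontr)
  have *: False if "rep y r p" "rep y' r' p" "p \<in> Rep_B1 (eq y y')" "(r, r') \<in> less" for y r y' r'
  proof -
    have "p \<in> Rep_B1 (eq y' r)"
      using that(1,3) Rep_eq_trans[of p y y' r] by (simp add: rep_def)
    then show False
      using that(2,4) Rep_B1_not_both unfolding rep_def by blast
  qed
  assume "r \<noteq> r'"
  then show False
    using less(2) *[OF assms] *[OF assms(2,1)] assms(3) eq_sym by metis
qed

lemma Rep_eq_refl: "p \<in> Rep_B1 (eq y y)"
  by (simp add: eq_def)

lemma cons_cl:
  assumes "finite u"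
  shows "\<exists>b\<in>Univ N. \<forall>i\<in>u. insert b (cl ` \<sigma> i) \<in> edges N \<longleftrightarrow> pos i"
  using cons[OF assms] by (simp add: pos_def cl_def[abs_def])

text \<open>Finite satisfiability provides a vertex satisfying the formulas over the k-subsets of
  \<open>v\<close>; all of them being positive, it would complete the edge to a clique on k+2
  vertices.\<close>

lemma consistent:
  assumes v: "finite v" "card v = k+1" "\<And>w. w \<subseteq> v \<Longrightarrow> card w = k \<Longrightarrow> cl ` w \<in> P \<and> card (cl ` w) = k"
  shows "cl ` v \<notin> edges N"
proof
  assume e: "cl ` v \<in> edges N"
  define ix where "ix w = (SOME i. \<sigma> i = w)" for w
  have ix: "\<sigma> (ix w) = w" if "card w = k" for w
  proof -
    have "w \<in> range \<sigma>"
      using \<sigma> that by simp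
    then have "\<exists>i. \<sigma> i = w"
      by blast
    then show ?thesis
      unfolding ix_def by (rule someI_ex)
  qed
  have "finite {w. w \<subseteq> v \<and> card w = k}"
    by (rule finite_subset[of _ "Pow v"]) (use v(1) in auto)
  then have "finite (ix ` {w. w \<subseteq> v \<and> card w = k})"
    by (rule finite_imageI)
  then obtain b where b: "b \<in> Univ N"
    "\<forall>i\<in>ix ` {w. w \<subseteq> v \<and> card w = k}. insert b (cl ` \<sigma> i) \<in> edges N \<longleftrightarrow> pos i"
    by (rule bexE[OF cons_cl])
  have ins: "insert b (cl ` w) \<in> edges N" if "w \<subseteq> v" "card w = k" for w
    using b(2) ix[OF that(2)] v(3)[OF that] that by (auto simp: pos_def)
  have inj: "inj_on cl v"
    using hypergraph_edges(2)[OF hypN e] v by (intro eq_card_imp_inj_on) auto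
  have "b \<notin> cl ` v"
  proof
    assume "b \<in> cl ` v"
    then obtain y where y: "y \<in> v" "b = cl y"
      by blast
    have "card (v - {y}) = k"
      using y(1) v(1,2) by simp
    then obtain y' where y': "y' \<in> v - {y}"
      using k by (metis card.empty equals0I less_irrefl)
    have c: "card (v - {y'}) = k"
      using y' v(1,2) by simp
    have "card (insert b (cl ` (v - {y'}))) = k+1"
      using hypergraph_edges(2)[OF hypN ins[OF _ c]] by blast
    moreover have "insert b (cl ` (v - {y'})) = cl ` (v - {y'})"
      using y y' by auto
    moreover have "card (cl ` (v - {y'})) \<le> k"
      using card_image_le[of "v - {y'}" cl] v(1) c by simp
    ultimately show False
      by simp
  qed
  then obtain w where w: "w \<subseteq> cl ` v" "card w = k" "insert b w \<notin> edges N"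
    using hypergraph_cone[OF hypN e b(1)] by blast
  then obtain w0 where "w0 \<subseteq> v" "w = cl ` w0"
    by (meson subset_imageE)
  moreover from this have "card w0 = k"
    using w(2) inj by (metis card_image inj_on_subset)
  ultimately show False
    using ins w(3) by blast
qed

text \<open>A condition that also forced unsolvability would provide an index \<open>t\<close> at
  which its promises hold but no solution exists. Yet the extension property of \<open>M\<close>
  gives a solution at \<open>t\<close>, unless some edge there has all its k-subsets positive; the
  safety of these k-subsets is what prevents this.\<close>

lemma sound:
  assumes u: "finite u" and p: "\<And>i. i \<in> u \<Longrightarrow> p \<in> Q i"
  shows "p \<notin> Rep_B1 (- j {t. solvable t u})"
proof
  assume notsol: "p \<in> Rep_B1 (- j {t. solvable t u})"
  let ?I = "\<Union>(\<sigma> ` u)"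
  define \<rho> where "\<rho> y = (SOME r. rep y r p)" for y
  have uniq: "\<rho> y = r" if "rep y r p" for y r
    unfolding \<rho>_def using that rep_unique[OF _ _ Rep_eq_refl] by (intro some_equality) auto
  have Qi: "(\<forall>y\<in>\<sigma> i. rep y (\<rho> y) p) \<and> (if pos i then inj_on \<rho> (\<sigma> i) \<and> safe p (\<rho> ` \<sigma> i)
     else inj_on \<rho> (\<sigma> i) \<longrightarrow> fmlookup p (\<nu> (\<rho> ` \<sigma> i)) = Some m0)" if i: "i \<in> u" for i
  proof -
    obtain \<rho>' where \<rho>': "\<forall>y\<in>\<sigma> i. rep y (\<rho>' y) p"
      "if pos i then inj_on \<rho>' (\<sigma> i) \<and> safe p (\<rho>' ` \<sigma> i)
       else inj_on \<rho>' (\<sigma> i) \<longrightarrow> fmlookup p (\<nu> (\<rho>' ` \<sigma> i)) = Some m0"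
      using p[OF i] unfolding Q_def by blast
    have eq: "\<rho>' y = \<rho> y" if "y \<in> \<sigma> i" for y
      using \<rho>'(1) uniq that by metis
    have "\<rho>' ` \<sigma> i = \<rho> ` \<sigma> i" "inj_on \<rho>' (\<sigma> i) \<longleftrightarrow> inj_on \<rho> (\<sigma> i)"
      using eq by (auto intro: image_cong) (metis inj_on_cong)+
    then show ?thesis
      using \<rho>' eq by auto
  qed
  have finI: "finite ?I"
    using u by auto
  have rep: "rep y (\<rho> y) p" if "y \<in> ?I" for y
    using Qi that by blast
  let ?J = "\<rho> ` ?I"
  \<comment> \<open>At an index in all three sets the names agree with their representatives,
    distinct representatives are distinct vertices, and forced non-edges are non-edges.\<close>
  define T1 where "T1 = (\<Inter>y\<in>?I. {t. a y t = a (\<rho> y) t})"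
  define T2 where "T2 = (\<Inter>(r, r')\<in>{(r, r'). r \<in> ?J \<and> r' \<in> ?J \<and> r \<noteq> r'}. {t. a r t \<noteq> a r' t})"
  define T3 where "T3 = (\<Inter>v\<in>{v. v \<subseteq> ?J \<and> p \<in> Rep_B1 (- ed v)}. {t. (\<lambda>y. a y t) ` v \<notin> edges M})"
  have same: "p \<in> Rep_B1 (j T1)"
    unfolding T1_def using finI rep by (intro j_INT_Rep) (auto simp: rep_def eq_def)
  have "p \<in> Rep_B1 (j T2)"
    unfolding T2_def
  proof (rule j_INT_Rep)
    show "finite {(r, r'). r \<in> ?J \<and> r' \<in> ?J \<and> r \<noteq> r'}"
      by (rule finite_subset[of _ "?J \<times> ?J"]) (use finI in auto)
    have *: "p \<in> Rep_B1 (- eq r r')" if r: "r \<in> ?J" "(r', r) \<in> less" for r r'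
    proof -
      obtain y where y: "y \<in> ?I" "r = \<rho> y"
        using r(1) by blast
      have ry: "rep y r p"
        using rep[OF y(1)] y(2) by simp
      have "p \<in> Rep_B1 (j ({t. a y t = a r t} \<inter> - {t. a y t = a r' t}))"
        using ry r(2) by (simp add: rep_def eq_def)
      moreover have "j ({t. a y t = a r t} \<inter> - {t. a y t = a r' t}) \<le> j (- {t. a r t = a r' t})"
        by (rule j_mono) auto
      ultimately show ?thesis
        unfolding eq_def j_simps(3) less_eq_B1_def by blast
    qed
    fix x assume "x \<in> {(r, r'). r \<in> ?J \<and> r' \<in> ?J \<and> r \<noteq> r'}"
    then obtain r r' where x: "x = (r, r')" "r \<in> ?J" "r' \<in> ?J" "r \<noteq> r'"
      by blast
    have "p \<in> Rep_B1 (- eq r r')"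
      using less(2)[OF x(4)] *[OF x(2)] *[OF x(3)] eq_sym[of r r'] by metis
    moreover have "- {t. a r t = a r' t} = {t. a r t \<noteq> a r' t}"
      by blast
    ultimately show "p \<in> Rep_B1 (j (case x of (r, r') \<Rightarrow> {t. a r t \<noteq> a r' t}))"
      unfolding eq_def x(1) j_simps(3)[symmetric] by simp
  qed
  moreover have "p \<in> Rep_B1 (j T3)"
    unfolding T3_def
  proof (rule j_INT_Rep)
    show "finite {v. v \<subseteq> ?J \<and> p \<in> Rep_B1 (- ed v)}"
      by (rule finite_subset[of _ "Pow ?J"]) (use finI in auto)
    fix v assume "v \<in> {v. v \<subseteq> ?J \<and> p \<in> Rep_B1 (- ed v)}"
    moreover have eqn: "{t. (\<lambda>y. a y t) ` v \<notin> edges M} = - {t. (\<lambda>y. a y t) ` v \<in> edges M}"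
      by blast
    ultimately show "p \<in> Rep_B1 (j {t. (\<lambda>y. a y t) ` v \<notin> edges M})"
      unfolding eqn j_simps(3) by (simp add: ed_def)
  qed
  ultimately have "p \<in> Rep_B1 (j (T1 \<inter>
      T2 \<inter>
      T3 \<inter> - {t. solvable t u}))"
    using same notsol by (simp only: j_simps(3,4) Rep_B1_simps(3) Int_iff)
  then obtain t where t: "t \<in> T1 \<inter>
      T2 \<inter>
      T3 \<inter> - {t. solvable t u}"
    by (rule exE[OF Rep_j_nonempty])
  let ?f = "\<lambda>y. a y t"
  have t1: "?f y = ?f (\<rho> y)" if "y \<in> ?I" for y
    using t that unfolding T1_def by blast
  have inj: "inj_on ?f ?J"
    using t unfolding inj_on_def T2_def by blast
  have t3: "?f ` v \<notin> edges M" if "v \<subseteq> ?J" "p \<in> Rep_B1 (- ed v)" for v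
    using t that unfolding T3_def by blast
  have nosol: "\<not> solvable t u"
    using t by blast
  define W where "W = {?f ` \<rho> ` \<sigma> i | i. i \<in> u \<and> pos i}"
  have im: "?f ` \<rho> ` w = ?f ` w" if "w \<subseteq> ?I" for w
    unfolding image_image by (rule image_cong[OF refl], rule t1[symmetric]) (use that in blast)
  have cardf: "card (?f ` v) = card v" if "v \<subseteq> ?J" for v
    using inj that by (metis card_image inj_on_subset)
  have memW: "\<exists>i\<in>u. pos i \<and> \<rho> ` \<sigma> i = w" if w: "w \<subseteq> ?J" "?f ` w \<in> W" for w
  proof -
    obtain i where i: "i \<in> u" "pos i" "?f ` w = ?f ` \<rho> ` \<sigma> i"
      using w(2) unfolding W_def by blast
    have "\<rho> ` \<sigma> i \<subseteq> ?J"
      using i(1) by blast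
    then have "w = \<rho> ` \<sigma> i"
      by (rule iffD1[OF inj_on_image_eq_iff[OF inj w(1)] i(3)])
    then show ?thesis
      using i by blast
  qed
  have key: "\<exists>w\<subseteq>e. card w = k \<and> w \<notin> W" if e: "e \<in> edges M" "e \<subseteq> ?f ` ?J" for e
  proof (rule ccontr)
    assume "\<not> ?thesis"
    then have allW: "w \<in> W" if "w \<subseteq> e" "card w = k" for w
      using that by blast
    obtain v where v: "v \<subseteq> ?J" "e = ?f ` v"
      using e(2) by (meson subset_imageE)
    have "card v = k+1"
      using hypergraph_edges(2)[OF hypM e(1)] v cardf[of v] by simp
    then have cv: "card v = k+1" "finite v"
      by (cases "finite v", auto)+
    have safe: "safe p w" if w: "w \<subseteq> v" "card w = k" for w
    proof -
      have "?f ` w \<in> W"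
      proof (rule allW)
        show "?f ` w \<subseteq> e"
          unfolding v(2) using w(1) by (rule image_mono)
        show "card (?f ` w) = k"
          using cardf[of w] w v(1) by simp
      qed
      then obtain i where i: "i \<in> u" "pos i" "\<rho> ` \<sigma> i = w"
        using memW[of w] w(1) v(1) by blast
      then show ?thesis
        using Qi[OF i(1)] by auto
    qed
    \<comment> \<open>With v = z \<union> {x, y}, safety of \<open>insert y z\<close> puts
      \<open>y\<close> into the finite set coded at \<open>\<nu> z\<close>. Safety of
      \<open>insert x z\<close> deals with every such \<open>y\<close>: either \<open>v\<close> is
      forced to be no edge, or some k-subset of \<open>v\<close> is declared negative, against the
      safety of all of them.\<close>
    obtain z where z: "z \<subseteq> v" "card z = k-1" "v - z \<subseteq> F z"
      using F[OF cv(2,1)] by blast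
    have "card (v - z) = 2"
      using z cv k by (subst card_Diff_subset) (auto intro: finite_subset)
    then obtain x y where xy: "v - z = {x, y}" "x \<noteq> y"
      by (meson card_2_iff)
    have finz: "finite z"
      using z(1) cv(2) finite_subset by blast
    have xyz: "x \<notin> z" "y \<notin> z" "x \<in> v" "y \<in> v"
      using xy by auto
    have wx: "insert x z \<subseteq> v" "card (insert x z) = k" and wy: "insert y z \<subseteq> v" "card (insert y z) = k"
      using xyz z finz k by auto
    have v': "insert y (insert x z) = v"
      using xy z(1) by auto
    have "\<exists>m. fmlookup p (\<nu> z) = Some m \<and> insert x z - z \<subseteq> dec z m \<and>
       (\<forall>y\<in>dec z m - insert x z. p \<in> Rep_B1 (- ed (insert y (insert x z))) \<or>
        (\<exists>w'\<subseteq>insert y (insert x z). card w' = k \<and> fmlookup p (\<nu> w') = Some m0))"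
      using safe[OF wx] z(2,3) xyz(3) unfolding safe_def by blast
    then obtain m where m: "fmlookup p (\<nu> z) = Some m"
       "\<forall>y\<in>dec z m - insert x z. p \<in> Rep_B1 (- ed (insert y (insert x z))) \<or>
        (\<exists>w'\<subseteq>insert y (insert x z). card w' = k \<and> fmlookup p (\<nu> w') = Some m0)"
      by blast
    have "insert y z - z \<subseteq> F z"
      using z(3) xyz(4) by blast
    then have "\<exists>m. fmlookup p (\<nu> z) = Some m \<and> insert y z - z \<subseteq> dec z m"
      using safe[OF wy, unfolded safe_def, THEN conjunct2, THEN spec, THEN mp, OF subset_insertI, THEN mp, OF z(2)]
      by blast
    then have "y \<in> dec z m"
      using m(1) xyz(2) by auto
    then consider "p \<in> Rep_B1 (- ed v)" | w' where "w' \<subseteq> v" "card w' = k" "fmlookup p (\<nu> w') = Some m0"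
      using m(2) xyz(2) xy(2) v' by blast
    then show False
    proof cases
      case 1
      then show False
        using t3[OF v(1)] v(2) e(1) by blast
    next
      case 2
      then show False
        using safe[OF 2(1,2)] m01 unfolding safe_def by simp
    qed
  qed
  have "\<exists>x\<in>Univ M - ?f ` ?J. \<forall>w\<subseteq>?f ` ?J. card w = k \<longrightarrow> (insert x w \<in> edges M \<longleftrightarrow> w \<in> W)"
  proof (rule extension_propertyD[OF M _ _ key])
    show "finite (?f ` ?J)" "?f ` ?J \<subseteq> Univ M"
      using finI a by auto
  qed
  then obtain x where x: "x \<in> Univ M" "x \<notin> ?f ` ?J"
    "\<forall>w\<subseteq>?f ` ?J. card w = k \<longrightarrow> (insert x w \<in> edges M \<longleftrightarrow> w \<in> W)"
    by (elim bexE) blast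
  have "insert x (?f ` \<sigma> i) \<in> edges M \<longleftrightarrow> pos i" if i: "i \<in> u" for i
  proof -
    have sub: "\<rho> ` \<sigma> i \<subseteq> ?J" and im': "?f ` \<sigma> i = ?f ` \<rho> ` \<sigma> i"
      using im[of "\<sigma> i"] i by blast+
    show ?thesis
    proof (cases "inj_on \<rho> (\<sigma> i)")
      case True
      then have "card (?f ` \<sigma> i) = k"
        using im' cardf[OF sub] card_\<sigma>[of i] by (simp add: card_image)
      then have "insert x (?f ` \<sigma> i) \<in> edges M \<longleftrightarrow> ?f ` \<sigma> i \<in> W"
        using x(3) im' sub by (metis image_mono)
      also have "\<dots> \<longleftrightarrow> pos i"
      proof
        assume "pos i"
        then show "?f ` \<sigma> i \<in> W"
          using i im' unfolding W_def by blast
      next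
        assume "?f ` \<sigma> i \<in> W"
        then obtain i' where i': "i' \<in> u" "pos i'" "\<rho> ` \<sigma> i' = \<rho> ` \<sigma> i"
          using memW[OF sub] im' by auto
        then have "fmlookup p (\<nu> (\<rho> ` \<sigma> i)) = Some m1"
          using Qi[OF i'(1)] unfolding safe_def by auto
        then show "pos i"
          using Qi[OF i] True m01 by (auto split: if_splits)
      qed
      finally show ?thesis .
    next
      case False
      then have "\<not> pos i"
        using Qi[OF i] by auto
      have "card (\<rho> ` \<sigma> i) < k"
        using False card_\<sigma>[of i] card_image_le[of "\<sigma> i" \<rho>] eq_card_imp_inj_on[of "\<sigma> i" \<rho>] by fastforce
      then have "card (?f ` \<sigma> i) < k"
        using im' cardf[OF sub] by simp
      then have "card (insert x (?f ` \<sigma> i)) < k+1"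
        by (simp add: card_insert_if)
      then have "insert x (?f ` \<sigma> i) \<notin> edges M"
        using hypergraph_edges(2)[OF hypM] by fastforce
      then show ?thesis
        using \<open>\<not> pos i\<close> by blast
    qed
  qed
  then have "solvable t u"
    using x(1) unfolding solvable_def by blast
  then show False
    using nosol by blast
qed

section \<open>Density of the conditions in Q\<close>

lemma supported_eq: "supported S (Rep_B1 (eq x y))"
  using sup_eq by (simp add: eq_def)

text \<open>\<open>r\<close> is the least name not yet forced to differ from \<open>y\<close>. An
  extension forces the two equal, and all smaller names are already forced to differ; restricting
  the extension to \<open>S\<close> is harmless because equalities depend on \<open>S\<close>
  only.\<close>

lemma rep_extend:
  assumes p: "fmdom' p \<subseteq> S"
  shows "\<exists>q r. p \<subseteq>\<^sub>f q \<and> fmdom' q \<subseteq> S \<and> rep y r q"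
proof -
  have "y \<in> {r. p \<notin> Rep_B1 (- eq y r)}"
    using Rep_eq_refl Rep_B1_not_both by blast
  then obtain r where r: "r \<in> {r. p \<notin> Rep_B1 (- eq y r)}"
    "\<And>r'. (r', r) \<in> less \<Longrightarrow> r' \<notin> {r. p \<notin> Rep_B1 (- eq y r)}"
    using wfE_min[OF less(1), of y "{r. p \<notin> Rep_B1 (- eq y r)}"] by blast
  obtain q where q: "p \<subseteq>\<^sub>f q" "q \<in> Rep_B1 (- (- eq y r))"
    using Rep_B1_extend_compl[of p "- eq y r"] r(1) by blast
  let ?q = "fmrestrict_set S q"
  have "?q \<in> Rep_B1 (eq y r)"
    using q(2) supported_eq[of y r] by (simp add: supported_def)
  moreover have "p \<subseteq>\<^sub>f ?q"
  proof -
    have "fmlookup ?q x = Some m" if "fmlookup p x = Some m" for x m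
      using fmsubset_lookup[OF q(1) that] p fmdom'I[OF that] by auto
    then show ?thesis
      by (auto simp: fmsubset_alt_def fmpred_iff)
  qed
  moreover have "fmdom' ?q \<subseteq> S"
    by (rule fmdom'_restrict_set)
  ultimately show ?thesis
    using r(2) Rep_B1_upward unfolding rep_def by blast
qed

lemma rep_extend_finite:
  assumes "finite I" "fmdom' p \<subseteq> S"
  shows "\<exists>q. p \<subseteq>\<^sub>f q \<and> fmdom' q \<subseteq> S \<and> (\<forall>y\<in>I. \<exists>r. rep y r q)"
  using assms
proof (induction I arbitrary: p rule: finite_induct)
  case empty
  then show ?case
    using fmsubset_refl by blast
next
  case (insert y I)
  obtain q r where q: "p \<subseteq>\<^sub>f q" "fmdom' q \<subseteq> S" "rep y r q"
    using rep_extend[OF insert.prems] by blast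
  obtain q' where q': "q \<subseteq>\<^sub>f q'" "fmdom' q' \<subseteq> S" "\<forall>y\<in>I. \<exists>r. rep y r q'"
    using insert.IH[OF q(2)] by blast
  have "\<forall>y\<in>insert y I. \<exists>r. rep y r q'"
    using q'(3) rep_upward[OF q(3) q'(1)] by blast
  then show ?case
    using q'(2) fmsubset_trans[OF q(1) q'(1)] by blast
qed

text \<open>Since \<open>c\<close> and all facts about names live on \<open>S\<close>, a condition
  with domain in \<open>S\<close> can settle these facts as they are in the ultrapower, and the
  fresh coordinates are then filled at will. Finitely many formulas involve finitely many
  representatives, so finite codes suffice.\<close>

lemma dense:
  assumes c: "c \<in> U" "supported S (Rep_B1 c)" and u: "finite u"
  shows "\<exists>p\<in>Rep_B1 c. \<forall>i\<in>u. p \<in> Q i"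
proof -
  let ?I = "\<Union>(\<sigma> ` u)"
  have finI: "finite ?I"
    using u by auto
  \<comment> \<open>The equalities, inequalities and non-edges that hold in the ultrapower among the
    names involved.\<close>
  define T1 where "T1 = (\<Inter>x\<in>?I \<times> ?I. if cl (fst x) = cl (snd x) then {t. a (fst x) t = a (snd x) t}
    else - {t. a (fst x) t = a (snd x) t})"
  define T2 where "T2 = (\<Inter>v\<in>{v. v \<subseteq> ?I \<and> card v = k+1 \<and> cl ` v \<notin> edges N}. - {t. (\<lambda>y. a y t) ` v \<in> edges M})"
  have "j T1 \<in> U"
    unfolding T1_def
  proof (rule j_INT_U)
    fix x assume "x \<in> ?I \<times> ?I"
    show "j (if cl (fst x) = cl (snd x) then {t. a (fst x) t = a (snd x) t} else - {t. a (fst x) t = a (snd x) t}) \<in> U"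
      using eq_U[of "fst x" "snd x"] by (simp add: eq_def U_compl)
  qed (use finI in simp)
  moreover have "j T2 \<in> U"
    unfolding T2_def
  proof (rule j_INT_U)
    show "finite {v. v \<subseteq> ?I \<and> card v = k+1 \<and> cl ` v \<notin> edges N}"
      by (rule finite_subset[of _ "Pow ?I"]) (use finI in auto)
    fix v assume "v \<in> {v. v \<subseteq> ?I \<and> card v = k+1 \<and> cl ` v \<notin> edges N}"
    then show "j (- {t. (\<lambda>y. a y t) ` v \<in> edges M}) \<in> U"
      using ed_U[of v] by (simp add: ed_def U_compl)
  qed
  ultimately have "c \<sqinter> (j T1 \<sqinter> j T2) \<in> U"
    using c(1) U_inf by blast
  then have "c \<sqinter> (j T1 \<sqinter> j T2) \<noteq> bot"
    using U_bot by metis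
  then obtain p where "p \<in> Rep_B1 (c \<sqinter> (j T1 \<sqinter> j T2))"
    using Rep_B1_nonempty by blast
  then have p: "p \<in> Rep_B1 c" "p \<in> Rep_B1 (j T1)" "p \<in> Rep_B1 (j T2)"
    by simp_all
  let ?p = "fmrestrict_set S p"
  have pc: "?p \<in> Rep_B1 c"
    using p(1) c(2) by (simp add: supported_def)
  have peq: "?p \<in> Rep_B1 (if cl x = cl y then eq x y else - eq x y)" if xy: "x \<in> ?I" "y \<in> ?I" for x y
  proof -
    have "T1 \<subseteq> (if cl x = cl y then {t. a x t = a y t} else - {t. a x t = a y t})"
      unfolding T1_def by (rule INF_lower2[of "(x, y)"]) (use xy in auto)
    then have "j T1 \<le> j (if cl x = cl y then {t. a x t = a y t} else - {t. a x t = a y t})"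
      by (rule j_mono)
    also have "\<dots> = (if cl x = cl y then eq x y else - eq x y)"
      by (simp add: eq_def)
    finally have "p \<in> Rep_B1 (if cl x = cl y then eq x y else - eq x y)"
      using p(2) unfolding less_eq_B1_def by (rule subsetD)
    moreover have "supported S (Rep_B1 (if cl x = cl y then eq x y else - eq x y))"
      using supported_eq[of x y] by (simp add: supported_perp)
    ultimately show ?thesis
      unfolding supported_def by blast
  qed
  have ped: "?p \<in> Rep_B1 (- ed v)" if v: "v \<subseteq> ?I" "card v = k+1" "cl ` v \<notin> edges N" for v
  proof -
    have "T2 \<subseteq> - {t. (\<lambda>y. a y t) ` v \<in> edges M}"
      unfolding T2_def by (rule INF_lower) (use v in simp)
    then have "j T2 \<le> j (- {t. (\<lambda>y. a y t) ` v \<in> edges M})"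
      by (rule j_mono)
    also have "\<dots> = - ed v"
      by (simp add: ed_def)
    finally have "p \<in> Rep_B1 (- ed v)"
      using p(3) unfolding less_eq_B1_def by (rule subsetD)
    moreover have "supported S (Rep_B1 (- ed v))"
      using sup_ed[of v] v(1) finI finite_subset by (auto simp: ed_def intro!: supported_perp)
    ultimately show ?thesis
      unfolding supported_def by blast
  qed
  have "fmdom' ?p \<subseteq> S"
    by (rule fmdom'_restrict_set)
  then obtain q where q: "?p \<subseteq>\<^sub>f q" "fmdom' q \<subseteq> S" "\<forall>y\<in>?I. \<exists>r. rep y r q"
    using rep_extend_finite[OF finI] by blast
  then obtain \<rho> where \<rho>: "\<And>y. y \<in> ?I \<Longrightarrow> rep y (\<rho> y) q"
    by metis
  \<comment> \<open>Equality of names was settled according to the ultrapower, so equal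
    representatives mean equal parameters.\<close>
  have \<rho>cl: "\<rho> x = \<rho> y \<longleftrightarrow> cl x = cl y" if xy: "x \<in> ?I" "y \<in> ?I" for x y
  proof
    assume eq: "\<rho> x = \<rho> y"
    have "q \<in> Rep_B1 (eq (\<rho> x) x)" "q \<in> Rep_B1 (eq (\<rho> x) y)"
      using \<rho>[OF xy(1)] \<rho>[OF xy(2)] eq eq_sym unfolding rep_def by metis+
    then have "q \<notin> Rep_B1 (- eq x y)"
      using Rep_eq_trans Rep_B1_not_both by blast
    then show "cl x = cl y"
      using peq[OF xy] Rep_B1_upward[OF _ q(1)] by (metis (full_types))
  next
    assume "cl x = cl y"
    then have "q \<in> Rep_B1 (eq x y)"
      using peq[OF xy] Rep_B1_upward[OF _ q(1)] by simp
    then show "\<rho> x = \<rho> y"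
      using rep_unique[OF \<rho>[OF xy(1)] \<rho>[OF xy(2)]] by blast
  qed
  have im\<rho>: "cl ` w = cl ` w'" if w: "w \<subseteq> ?I" "w' \<subseteq> ?I" "\<rho> ` w = \<rho> ` w'" for w w'
  proof -
    have sub: "cl ` w \<subseteq> cl ` w'" if w: "w \<subseteq> ?I" "w' \<subseteq> ?I" "\<rho> ` w \<subseteq> \<rho> ` w'" for w w'
    proof
      fix x assume "x \<in> cl ` w"
      then obtain y where y: "y \<in> w" "x = cl y"
        by blast
      then obtain y' where y': "y' \<in> w'" "\<rho> y = \<rho> y'"
        using w(3) by (meson image_iff imageI subsetD)
      then have "cl y = cl y'"
        using \<rho>cl[of y y'] y(1) w(1,2) by blast
      then show "x \<in> cl ` w'"
        using y(2) y'(1) by blast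
    qed
    show ?thesis
      using sub[OF w(1,2)] sub[OF w(2,1)] w(3) by (intro subset_antisym) simp_all
  qed
  have inj\<rho>: "inj_on \<rho> w \<longleftrightarrow> inj_on cl w" if w: "w \<subseteq> ?I" for w
    unfolding inj_on_def
  proof (intro ball_cong refl)
    fix x y assume "x \<in> w" "y \<in> w"
    then have "\<rho> x = \<rho> y \<longleftrightarrow> cl x = cl y"
      using w by (intro \<rho>cl) auto
    then show "(\<rho> x = \<rho> y \<longrightarrow> x = y) \<longleftrightarrow> (cl x = cl y \<longrightarrow> x = y)"
      by simp
  qed
  define H where "H = {\<rho> ` \<sigma> i | i. i \<in> u \<and> pos i}"
  let ?J = "\<rho> ` ?I"
  have finJ: "finite ?J"
    using finI by simp
  have "\<exists>m. dec z m = F z \<inter> ?J" for z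
    using dec(2)[of "F z \<inter> ?J" z] finJ by auto
  \<comment> \<open>All points of \<open>F z\<close> among the representatives go into the code, so
    that every positive k-set is covered along each of its subsets \<open>z\<close> that
    matter.\<close>
  then obtain code where code: "\<And>z. dec z (code z) = F z \<inter> ?J"
    by metis
  \<comment> \<open>A k-set outside \<open>H\<close> is declared negative even if no formula in
    \<open>u\<close> mentions it; so only (k+1)-sets with all k-subsets in \<open>H\<close> remain
    to be excluded as edges.\<close>
  define val where "val w = (if card w = k then if w \<in> H then m1 else m0 else code w)" for w
  define \<nu>i where "\<nu>i = inv_into {w. finite w} \<nu>"
  have \<nu>i: "\<nu>i (\<nu> w) = w" if "finite w" for w
    unfolding \<nu>i_def using \<nu>(1) that by (intro inv_into_f_f) auto
  have "finite (\<nu> ` Pow ?J)"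
    using finJ by simp
  then obtain g where "fmlookup g = (\<lambda>x. if x \<in> \<nu> ` Pow ?J then Some (val (\<nu>i x)) else None)"
    by (rule finite_fmap_of[of _ "\<lambda>x. val (\<nu>i x)"])
  then have g: "fmlookup g x = (if x \<in> \<nu> ` Pow ?J then Some (val (\<nu>i x)) else None)" for x
    by (rule fun_cong)
  let ?q = "q ++\<^sub>f g"
  have finsub: "finite w" if "w \<subseteq> ?J" for w
    using finJ that finite_subset by blast
  have lookup: "fmlookup ?q (\<nu> w) = Some (val w)" if "w \<subseteq> ?J" for w
    using g[of "\<nu> w"] that \<nu>i[OF finsub[OF that]] by (auto simp: fmlookup_dom_iff)
  have qq: "q \<subseteq>\<^sub>f ?q"
  proof -
    have "x \<notin> \<nu> ` Pow ?J" if "fmlookup q x = Some m" for x m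
      using \<nu>(2) finsub q(2) fmdom'I[OF that] by blast
    then have "fmlookup ?q x = Some m" if "fmlookup q x = Some m" for x m
      using that g[of x] by (auto simp: fmlookup_dom_iff)
    then show ?thesis
      by (auto simp: fmsubset_alt_def fmpred_iff)
  qed
  have pq: "?p \<subseteq>\<^sub>f ?q"
    using fmsubset_trans[OF q(1) qq] .
  have edq: "?q \<in> Rep_B1 (- ed (\<rho> ` v))" if v: "v \<subseteq> ?I" "card v = k+1" "cl ` v \<notin> edges N" for v
  proof -
    have finv: "finite v"
      using v(1) finI finite_subset by blast
    have "?q \<in> Rep_B1 (j (\<Inter>y\<in>v. {t. a y t = a (\<rho> y) t}))"
    proof (rule j_INT_Rep[OF finv])
      fix y assume "y \<in> v"
      then have "rep y (\<rho> y) ?q"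
        using \<rho> v(1) rep_upward[OF _ qq] by blast
      then show "?q \<in> Rep_B1 (j {t. a y t = a (\<rho> y) t})"
        by (simp add: rep_def eq_def)
    qed
    moreover have "?q \<in> Rep_B1 (j (- {t. (\<lambda>y. a y t) ` v \<in> edges M}))"
      using Rep_B1_upward[OF ped[OF v] pq] by (simp add: ed_def)
    ultimately have "?q \<in> Rep_B1 (j ((\<Inter>y\<in>v. {t. a y t = a (\<rho> y) t}) \<inter> - {t. (\<lambda>y. a y t) ` v \<in> edges M}))"
      by (simp only: j_simps(4) Rep_B1_simps(3) Int_iff)
    moreover have "(\<Inter>y\<in>v. {t. a y t = a (\<rho> y) t}) \<inter> - {t. (\<lambda>y. a y t) ` v \<in> edges M} \<subseteq>
        - {t. (\<lambda>y. a y t) ` \<rho> ` v \<in> edges M}"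
    proof
      fix t assume t: "t \<in> (\<Inter>y\<in>v. {t. a y t = a (\<rho> y) t}) \<inter> - {t. (\<lambda>y. a y t) ` v \<in> edges M}"
      have im: "(\<lambda>y. a y t) ` \<rho> ` v = (\<lambda>y. a y t) ` v"
        unfolding image_image using t by (intro image_cong) auto
      show "t \<in> - {t. (\<lambda>y. a y t) ` \<rho> ` v \<in> edges M}"
        unfolding Compl_iff mem_Collect_eq im using t by blast
    qed
    then have "j ((\<Inter>y\<in>v. {t. a y t = a (\<rho> y) t}) \<inter> - {t. (\<lambda>y. a y t) ` v \<in> edges M}) \<le>
        j (- {t. (\<lambda>y. a y t) ` \<rho> ` v \<in> edges M})"
      by (rule j_mono)
    ultimately have "?q \<in> Rep_B1 (j (- {t. (\<lambda>y. a y t) ` \<rho> ` v \<in> edges M}))"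
      unfolding less_eq_B1_def by blast
    then show ?thesis
      by (simp add: ed_def)
  qed
  have safe: "safe ?q w" if w: "w \<in> H" "card w = k" "w \<subseteq> ?J" for w
    unfolding safe_def
  proof (intro conjI allI impI)
    show "fmlookup ?q (\<nu> w) = Some m1"
      using lookup[OF w(3)] w by (simp add: val_def)
    fix z assume z: "z \<subseteq> w" "card z = k-1" "w - z \<subseteq> F z"
    have zJ: "z \<subseteq> ?J"
      using z(1) w(3) by blast
    have val: "fmlookup ?q (\<nu> z) = Some (code z)"
    proof -
      have "card z \<noteq> k"
        using z(2) k by simp
      then show ?thesis
        using lookup[OF zJ] by (simp add: val_def)
    qed
    show "\<exists>m. fmlookup ?q (\<nu> z) = Some m \<and> w - z \<subseteq> dec z m \<and>
     (\<forall>y\<in>dec z m - w. ?q \<in> Rep_B1 (- ed (insert y w)) \<or>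
        (\<exists>w'\<subseteq>insert y w. card w' = k \<and> fmlookup ?q (\<nu> w') = Some m0))"
    proof (intro exI[of _ "code z"] conjI ballI)
      show "fmlookup ?q (\<nu> z) = Some (code z)"
        by (rule val)
      show "w - z \<subseteq> dec z (code z)"
        using z(3) w(3) code by blast
      fix y assume y: "y \<in> dec z (code z) - w"
      have vJ: "insert y w \<subseteq> ?J"
        using y w(3) code[of z] by blast
      show "?q \<in> Rep_B1 (- ed (insert y w)) \<or> (\<exists>w'\<subseteq>insert y w. card w' = k \<and> fmlookup ?q (\<nu> w') = Some m0)"
      proof (rule disjCI)
        assume no: "\<not> (\<exists>w'\<subseteq>insert y w. card w' = k \<and> fmlookup ?q (\<nu> w') = Some m0)"
        \<comment> \<open>Without a negative k-subset, all k-subsets of the candidate come from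
          positive formulas. By \<open>consistent\<close> the candidate is then no edge of the
          ultrapower, and this is among the facts already forced.\<close>
        have allH: "w' \<in> H" if w': "w' \<subseteq> insert y w" "card w' = k" for w'
        proof (rule ccontr)
          assume "w' \<notin> H"
          then have "fmlookup ?q (\<nu> w') = Some m0"
            using lookup[OF subset_trans[OF w'(1) vJ]] w'(2) by (simp add: val_def)
          then show False
            using no w' by blast
        qed
        obtain v where v: "v \<subseteq> ?I" "inj_on \<rho> v" "insert y w = \<rho> ` v"
          using vJ by (metis subset_image_inj)
        have "card (insert y w) = k+1"
          using y w(2) finsub[OF w(3)] by simp
        then have cv: "card v = k+1"
          using v(2,3) card_image by metis
        have "cl ` v \<notin> edges N"
        proof (rule consistent[OF _ cv])
          show "finite v"
            using v(1) finI finite_subset by blast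
          fix x assume x: "x \<subseteq> v" "card x = k"
          have "card (\<rho> ` x) = k"
            using x v(2) by (metis card_image inj_on_subset)
          then have "\<rho> ` x \<in> H"
            using x(1) v(3) by (intro allH) auto
          then obtain i where i: "i \<in> u" "pos i" "\<rho> ` x = \<rho> ` \<sigma> i"
            unfolding H_def by blast
          have "cl ` x = cl ` \<sigma> i"
            using x(1) v(1) i(1) by (intro im\<rho>[OF _ _ i(3)]) auto
          then show "cl ` x \<in> P \<and> card (cl ` x) = k"
            using i(2) by (simp add: pos_def)
        qed
        then show "?q \<in> Rep_B1 (- ed (insert y w))"
          using edq[OF v(1) cv] v(3) by simp
      qed
    qed
  qed
  have "?q \<in> Q i" if i: "i \<in> u" for i
  proof -
    have sub: "\<sigma> i \<subseteq> ?I" "\<rho> ` \<sigma> i \<subseteq> ?J"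
      using i by auto
    have "\<forall>y\<in>\<sigma> i. rep y (\<rho> y) ?q"
      using \<rho> sub(1) rep_upward[OF _ qq] by blast
    moreover have "if pos i then inj_on \<rho> (\<sigma> i) \<and> safe ?q (\<rho> ` \<sigma> i)
      else inj_on \<rho> (\<sigma> i) \<longrightarrow> fmlookup ?q (\<nu> (\<rho> ` \<sigma> i)) = Some m0"
    proof (cases "pos i")
      case True
      then have "card (cl ` \<sigma> i) = card (\<sigma> i)"
        using card_\<sigma> by (simp add: pos_def)
      then have inj: "inj_on \<rho> (\<sigma> i)"
        using inj\<rho>[OF sub(1)] eq_card_imp_inj_on[of "\<sigma> i" cl] by simp
      then have "card (\<rho> ` \<sigma> i) = k"
        using card_\<sigma> by (simp add: card_image)
      moreover have "\<rho> ` \<sigma> i \<in> H"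
        using True i by (auto simp: H_def)
      ultimately show ?thesis
        using inj True safe[OF _ _ sub(2)] by simp
    next
      case False
      have "\<rho> ` \<sigma> i \<notin> H"
      proof
        assume "\<rho> ` \<sigma> i \<in> H"
        then obtain i' where i': "i' \<in> u" "pos i'" "\<rho> ` \<sigma> i = \<rho> ` \<sigma> i'"
          unfolding H_def by blast
        then have "cl ` \<sigma> i = cl ` \<sigma> i'"
          using sub(1) by (intro im\<rho>) auto
        then show False
          using i'(2) False by (simp add: pos_def)
      qed
      then show ?thesis
        using False lookup[OF sub(2)] card_\<sigma>[of i] by (simp add: val_def card_image)
    qed
    ultimately show ?thesis
      unfolding Q_def by blast
  qed
  moreover have "?q \<in> Rep_B1 c"
    using Rep_B1_upward[OF pc pq] .
  ultimately show ?thesis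
    by blast
qed

end

section \<open>Codes, fresh coordinates and copies of vertices\<close>

lemma card_surjection:
  assumes "|A| \<le>o |UNIV :: 'b set|" "A \<noteq> {}"
  obtains f :: "'b \<Rightarrow> 'a" where "range f = A"
  by (rule exE[OF iffD2[OF card_of_ordLeq2[OF assms(2)] assms(1)]])

lemma finite_subset_code:
  assumes m: "infinite (UNIV :: 'm set)" and F: "|F| \<le>o |UNIV :: 'm set|"
  shows "\<exists>d :: 'm \<Rightarrow> 'i set. range d = {s. finite s \<and> s \<subseteq> F}"
proof -
  have "|{s. finite s \<and> s \<subseteq> F}| \<le>o |UNIV :: 'm set|"
  proof (cases "finite F")
    case True
    have "finite {s. finite s \<and> s \<subseteq> F}"
      by (rule finite_subset[of _ "Pow F"]) (use True in auto)
    then show ?thesis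
      using m by (rule finite_card_ordLeq)
  next
    case False
    then show ?thesis
      using card_of_finite_subsets_ordLeq[OF False] F ordLeq_transitive by blast
  qed
  moreover have "{s. finite s \<and> s \<subseteq> F} \<noteq> {}"
    by blast
  ultimately obtain d :: "'m \<Rightarrow> 'i set" where "range d = {s. finite s \<and> s \<subseteq> F}"
    by (rule card_surjection)
  then show ?thesis
    by blast
qed

text \<open>An initial segment below \<open>2\<^sup>\<lambda>\<close> has smaller cardinality, so
  its complement has at least \<lambda> elements; otherwise both parts together would be too small.
  This is room enough for all finite sets of indices.\<close>

lemma fresh_coordinates:
  fixes \<alpha> :: "'i set"
  assumes "infinite (UNIV :: 'i set)"
  obtains \<nu> :: "'i set \<Rightarrow> 'i set" where "inj_on \<nu> {w. finite w}"
    "\<And>w. finite w \<Longrightarrow> \<nu> w \<notin> underS |UNIV :: 'i set set| \<alpha>"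
proof -
  let ?S = "underS |UNIV :: 'i set set| \<alpha>"
  have inf: "infinite (UNIV :: 'i set set)"
    using assms by (simp add: Finite_Set.finite_set)
  have S: "|?S| <o |UNIV :: 'i set set|"
    using card_of_underS[OF card_of_Card_order, of \<alpha> "UNIV :: 'i set set"] by (simp add: Field_card_of)
  have pow: "|UNIV :: 'i set| <o |UNIV :: 'i set set|"
    using card_of_Pow[of "UNIV :: 'i set"] by simp
  have "|{w :: 'i set. finite w}| \<le>o |UNIV :: 'i set|"
    using card_of_finite_subsets_ordLeq[OF assms] by simp
  moreover have "|UNIV :: 'i set| \<le>o |- ?S|"
  proof (rule ccontr)
    assume "\<not> ?thesis"
    then have "|- ?S| \<le>o |UNIV :: 'i set|"
      using ordLeq_total[OF card_of_Well_order card_of_Well_order] by blast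
    then have "|- ?S| <o |UNIV :: 'i set set|"
      using pow ordLeq_ordLess_trans by blast
    then have "|?S \<union> - ?S| <o |UNIV :: 'i set set|"
      using card_of_Un_ordLess_infinite[OF inf S] by blast
    moreover have "?S \<union> - ?S = UNIV"
      by simp
    ultimately show False
      using ordLess_irreflexive by metis
  qed
  ultimately have "|{w :: 'i set. finite w}| \<le>o |- ?S|"
    by (rule ordLeq_transitive)
  then obtain \<nu> :: "'i set \<Rightarrow> 'i set" where "inj_on \<nu> {w. finite w}" "\<nu> ` {w. finite w} \<subseteq> - ?S"
    using card_of_ordLeq[of "{w :: 'i set. finite w}" "- ?S"] by blast
  then show ?thesis
    by (intro that[of \<nu>]) auto
qed

text \<open>Moves a solution away from finitely many vertices. The pattern of \<open>x\<close> is
  admissible: for an edge not containing \<open>x\<close> by the cone lemma; for an edge containing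
  \<open>x\<close>, omit another of its vertices, and the remaining k-set already contains
  \<open>x\<close>, so adding \<open>x\<close> gives too small a set for an edge.\<close>

lemma extension_property_copy:
  assumes M: "extension_property k M" and k: "k > 0" and S: "finite S" "S \<subseteq> Univ M" and x: "x \<in> Univ M"
  shows "\<exists>x'\<in>Univ M - S. \<forall>w\<subseteq>S. card w = k \<longrightarrow> (insert x' w \<in> edges M \<longleftrightarrow> insert x w \<in> edges M)"
proof -
  have hyp: "hypergraph k M"
    using M by (simp add: extension_property_def)
  have "\<exists>w\<subseteq>e. card w = k \<and> w \<notin> {w. insert x w \<in> edges M}" if e: "e \<in> edges M" "e \<subseteq> S" for e
  proof (cases "x \<in> e")
    case False
    then show ?thesis
      using hypergraph_cone[OF hyp e(1) x False] by simp
  next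
    case True
    have ce: "card e = k+1" "finite e"
      using hypergraph_edges[OF hyp e(1)] by auto
    then have "card (e - {x}) = k"
      using True by simp
    then obtain y where y: "y \<in> e" "y \<noteq> x"
      using k by (metis Diff_iff card.empty equals0I less_irrefl singletonI)
    have c: "card (e - {y}) = k"
      using y(1) ce by simp
    have "insert x (e - {y}) = e - {y}"
      using True y(2) by auto
    then have "insert x (e - {y}) \<notin> edges M"
      using hypergraph_edges(2)[OF hyp, of "e - {y}"] c by auto
    then show ?thesis
      using c by (intro exI[of _ "e - {y}"]) auto
  qed
  then show ?thesis
    using extension_propertyD[OF M S, of "{w. insert x w \<in> edges M}"] by simp
qed

section \<open>The multiplicative refinement\<close>

context edge_type
begin

text \<open>An infimum over the members of \<open>u\<close> is multiplicative by construction. The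
  double perp turns \<open>Q i\<close>, of which only upward closure is known, into an element of
  the algebra.\<close>

definition "refinement u = (INF i\<in>u. Abs_B1 (perp (perp (Q i))))"

lemma Rep_refinement: "p \<in> Rep_B1 (refinement u) \<longleftrightarrow> (\<forall>i\<in>u. p \<in> perp (perp (Q i)))"
  by (simp add: refinement_def Rep_Abs_B1)

lemma Q_refinement: "(\<And>i. i \<in> u \<Longrightarrow> p \<in> Q i) \<Longrightarrow> p \<in> Rep_B1 (refinement u)"
  using perp_perp_ge by (auto simp: Rep_refinement)

lemma refinement_extend:
  assumes "finite u" "p \<in> Rep_B1 (refinement u)"
  shows "\<exists>q. p \<subseteq>\<^sub>f q \<and> (\<forall>i\<in>u. q \<in> Q i)"
  using assms
proof (induction u rule: finite_induct)
  case empty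
  then show ?case
    using fmsubset_refl by blast
next
  case (insert i u)
  then obtain q where q: "p \<subseteq>\<^sub>f q" "\<forall>i\<in>u. q \<in> Q i"
    by (auto simp: Rep_refinement)
  have "q \<in> perp (perp (Q i))"
    using insert.prems q(1) perp_upward by (auto simp: Rep_refinement)
  then obtain q' where q': "q' \<in> Q i" "q \<subseteq>\<^sub>f q'"
    using perp_perp_extend[of q "Q i"] Q_upward by blast
  have "\<forall>i\<in>insert i u. q' \<in> Q i"
    using q' q(2) Q_upward by blast
  then show ?case
    using fmsubset_trans[OF q(1) q'(2)] by blast
qed

lemma refinement_le:
  assumes u: "finite u"
  shows "refinement u \<le> j {t. solvable t u}"
proof (rule ccontr)
  assume "\<not> ?thesis"
  then obtain p where p: "p \<in> Rep_B1 (refinement u)" "p \<notin> Rep_B1 (j {t. solvable t u})"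
    by (auto simp: less_eq_B1_def)
  obtain q where q: "p \<subseteq>\<^sub>f q" "q \<in> Rep_B1 (- j {t. solvable t u})"
    using Rep_B1_extend_compl[OF p(2)] by blast
  have "q \<in> Rep_B1 (refinement u)"
    using Rep_B1_upward[OF p(1) q(1)] .
  then obtain r where r: "q \<subseteq>\<^sub>f r" "\<forall>i\<in>u. r \<in> Q i"
    using refinement_extend[OF u] by blast
  then show False
    using sound[OF u, of r] Rep_B1_upward[OF q(2) r(1)] by blast
qed

lemma refinement_multiplicative: "multiplicative refinement"
  by (simp add: multiplicative_def refinement_def INF_union)

lemma refinement_nonzero:
  assumes "finite u"
  shows "refinement u \<noteq> bot"
proof -
  obtain p where "\<forall>i\<in>u. p \<in> Q i"
    using dense[OF U_top _ assms] by (auto simp: supported_def)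
  then have "p \<in> Rep_B1 (refinement u)"
    by (intro Q_refinement) blast
  then show ?thesis
    by auto
qed

lemma refinement_meets:
  assumes c: "c \<in> U" "supported S (Rep_B1 c)" and u: "finite u"
  shows "(INF i\<in>u. refinement {i} \<squnion> b i) \<sqinter> c \<noteq> bot"
proof -
  obtain p where p: "p \<in> Rep_B1 c" "\<forall>i\<in>u. p \<in> Q i"
    using dense[OF c u] by blast
  have "p \<in> Rep_B1 (refinement {i} \<squnion> b i)" if "i \<in> u" for i
  proof -
    have "p \<in> Rep_B1 (refinement {i})"
      using p(2) that by (intro Q_refinement) simp
    moreover have "Rep_B1 (refinement {i}) \<subseteq> Rep_B1 (refinement {i} \<squnion> b i)"
      using sup_ge1 less_eq_B1_def by blast
    ultimately show ?thesis
      by blast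
  qed
  then have "p \<in> Rep_B1 ((INF i\<in>u. refinement {i} \<squnion> b i) \<sqinter> c)"
    unfolding Rep_B1_simps(3) Rep_B1_Inf_Sup(1) using p(1) by blast
  then show ?thesis
    by (metis Rep_B1_simps(1) empty_iff)
qed

end

text \<open>Preimages under \<open>j\<close> satisfy the required inclusions only modulo
  \<open>D\<^sub>0\<close>. Goodness of \<open>D\<^sub>0\<close>, which follows from excellence,
  turns these errors into a multiplicative correction, and regularity makes each index belong to
  finitely many sets.\<close>

lemma (in built) multiplicative_lift:
  fixes b :: "'i set \<Rightarrow> ('d, 'm) B1" and C :: "'i set \<Rightarrow> 'i set"
  assumes b: "multiplicative b" "\<And>u. finite u \<Longrightarrow> b u \<in> U \<and> b u \<le> j (C u)"
  obtains Y where "\<And>i. eventually (\<lambda>t. t \<in> Y i) D" "\<And>t. finite {i. t \<in> Y i}"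
    "\<And>t. {i. t \<in> Y i} \<noteq> {} \<Longrightarrow> t \<in> C {i. t \<in> Y i}"
proof -
  define A where "A i = inv j (b {i})" for i
  have A: "j (A i) = b {i}" for i
    unfolding A_def using surj by (rule surj_f_inv_f)
  have bu: "j (\<Inter>i\<in>u. A i) = b u" if "finite u" "u \<noteq> {}" for u
    using that
  proof (induction u rule: finite_ne_induct)
    case (insert i u)
    have "b ({i} \<union> u) = b {i} \<sqinter> b u"
      using b(1) insert.hyps(1) unfolding multiplicative_def by blast
    moreover have "j (\<Inter>i\<in>insert i u. A i) = j (A i) \<sqinter> j (\<Inter>i\<in>u. A i)"
      by (simp flip: j_simps(4))
    ultimately show ?case
      unfolding A insert.IH by simp
  qed (simp add: A)
  \<comment> \<open>Outside \<open>E v\<close> the lifted sets intersect beyond \<open>C v\<close>;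
    this is null for \<open>D\<^sub>0\<close> because \<open>b v\<close> lies below
    \<open>j (C v)\<close>. The empty \<open>v\<close> is excluded throughout: its intersection is
    everything, although \<open>b {}\<close> may be smaller than top.\<close>
  define E where "E v = - (\<Inter>i\<in>v. A i) \<union> C v" for v
  define G where "G u = {t. \<forall>v\<subseteq>u. v \<noteq> {} \<longrightarrow> t \<in> E v}" for u
  have E: "eventually (\<lambda>t. t \<in> E v) D\<^sub>0" if v: "finite v" "v \<noteq> {}" for v
  proof -
    have "j (E v) = - b v \<squnion> j (C v)"
      unfolding E_def using bu[OF v] by (simp only: j_simps)
    moreover have "- b v \<squnion> b v \<le> - b v \<squnion> j (C v)"
      using b(2)[OF v(1)] by (intro sup_mono order_refl) blast
    ultimately have "j (E v) = top"
      by (simp add: top_unique)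
    then show ?thesis
      using D\<^sub>0_iff by blast
  qed
  have "eventually (\<lambda>t. t \<in> G u) D\<^sub>0" if "finite u" for u
  proof -
    have "eventually (\<lambda>t. \<forall>v\<in>Pow u - {{}}. t \<in> E v) D\<^sub>0"
    proof (rule eventually_ball_finite)
      show "finite (Pow u - {{}})"
        using that by simp
      show "\<forall>v\<in>Pow u - {{}}. eventually (\<lambda>t. t \<in> E v) D\<^sub>0"
      proof
        fix v assume "v \<in> Pow u - {{}}"
        then show "eventually (\<lambda>t. t \<in> E v) D\<^sub>0"
          using that by (intro E) (auto intro: finite_subset)
      qed
    qed
    then show ?thesis
    proof (rule eventually_mono)
      fix t assume "\<forall>v\<in>Pow u - {{}}. t \<in> E v"
      then show "t \<in> G u"
        unfolding G_def by blast
    qed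
  qed
  then have G: "\<forall>u. finite u \<longrightarrow> eventually (\<lambda>t. t \<in> G u) D\<^sub>0"
    by blast
  have "monotonic G"
    unfolding monotonic_def G_def by blast
  have "good_filter D\<^sub>0"
    using exc by (rule excellent_imp_good)
  then have "\<exists>B. multiplicative B \<and> (\<forall>u. finite u \<longrightarrow> B u \<subseteq> G u \<and> eventually (\<lambda>t. t \<in> B u) D\<^sub>0)"
    using \<open>monotonic G\<close> G unfolding good_filter_def by simp
  then obtain B where B: "multiplicative B" "\<forall>u. finite u \<longrightarrow> B u \<subseteq> G u \<and> eventually (\<lambda>t. t \<in> B u) D\<^sub>0"
    by (elim exE conjE)
  obtain X :: "'i \<Rightarrow> 'i set" where X: "\<And>i. eventually (\<lambda>t. t \<in> X i) D\<^sub>0" "\<And>t. finite {i. t \<in> X i}"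
    using regular_family by metis
  have Bu: "t \<in> B u" if "finite u" "u \<noteq> {}" "\<And>i. i \<in> u \<Longrightarrow> t \<in> B {i}" for u t
    using that
  proof (induction u rule: finite_ne_induct)
    case (insert i u)
    have "B ({i} \<union> u) = B {i} \<inter> B u"
      using B(1) insert.hyps(1) unfolding multiplicative_def by blast
    moreover have "t \<in> B u" "t \<in> B {i}"
      using insert.IH insert.prems by blast+
    ultimately show ?case
      by simp
  qed simp
  \<comment> \<open>\<open>A\<close> lifts the given sequence, \<open>B\<close> corrects it by
    goodness, and \<open>X\<close> contributes finiteness by regularity.\<close>
  let ?Y = "\<lambda>i. A i \<inter> B {i} \<inter> X i"
  show ?thesis
  proof (rule that[of ?Y])
    fix i
    have "eventually (\<lambda>t. t \<in> A i) D"
      using D_iff[of "A i"] A[of i] b(2)[of "{i}"] by simp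
    moreover have "eventually (\<lambda>t. t \<in> B {i}) D" "eventually (\<lambda>t. t \<in> X i) D"
      using B(2) X(1)[of i] by (auto intro: D\<^sub>0_imp_D)
    ultimately show "eventually (\<lambda>t. t \<in> ?Y i) D"
      by (simp add: eventually_conj_iff)
  next
    show fin: "finite {i. t \<in> ?Y i}" for t
      by (rule finite_subset[OF _ X(2)[of t]]) auto
    fix t assume ne: "{i. t \<in> ?Y i} \<noteq> {}"
    have "t \<in> G {i. t \<in> ?Y i}"
      using Bu[OF fin ne, of t] B(2) fin[of t] by blast
    then have "t \<in> E {i. t \<in> ?Y i}"
      using ne by (auto simp: G_def)
    then show "t \<in> C {i. t \<in> ?Y i}"
      by (auto simp: E_def)
  qed
qed

section \<open>Realization of types and the conclusion\<close>

lemma beyond_aleph_le: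
  assumes "m \<le> n" "beyond_aleph n \<mu> X"
  shows "beyond_aleph m \<mu> (X :: 'i set)"
  using assms
proof (induction n rule: dec_induct)
  case (step n)
  then obtain Y :: "'i set" where "beyond_aleph n \<mu> Y" "|Y| <o |X|"
    by auto
  then show ?case
    using step.IH beyond_aleph_mono ordLess_imp_ordLeq by blast
qed

text \<open>Perfection moves the refinement into the ultrafilter, and its lift assigns to each index
  finitely many formulas that are jointly solvable there; solving them index by index gives the
  realization.\<close>

theorem ultrapower_edge_types_realized:
  fixes D D\<^sub>0 :: "'i filter" and U :: "('i set, 'm) B1 set" and M :: "'a rstruct"
  assumes built: "built D D\<^sub>0 U j" and perf: "perfect U"
    and inf: "infinite (UNIV :: 'm set)" "infinite (UNIV :: 'i set)" "|UNIV :: 'm set| \<le>o |UNIV :: 'i set|"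
    and small: "at_most_aleph (k-1) (UNIV :: 'm set) (UNIV :: 'i set)"
    and k: "k > 0" and M: "extension_property k M"
    and A: "A \<subseteq> Univ (ultrapower D M)" "A \<noteq> {}" "|A| \<le>o |UNIV :: 'i set|"
  shows "edge_types_realized k (ultrapower D M) A"
  unfolding edge_types_realized_def
proof (intro allI impI)
  interpret built D D\<^sub>0 U j
    by (rule built)
  let ?N = "ultrapower D M"
  fix P assume P: "\<forall>u. finite u \<and> (\<forall>w\<in>u. w \<subseteq> A \<and> card w = k) \<longrightarrow>
      (\<exists>b\<in>Univ ?N. \<forall>w\<in>u. insert b w \<in> edges ?N \<longleftrightarrow> w \<in> P)"
  have hypM: "hypergraph k M"
    using M by (simp add: extension_property_def)
  have N: "extension_property k ?N"
    using ultrapower_extension_property[OF D k M] .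
  then have hypN: "hypergraph k ?N"
    by (simp add: extension_property_def)
  have neM: "Univ M \<noteq> {}"
    using hypM by (auto simp: hypergraph_def is_struct_def)
  have bot: "D \<noteq> bot"
    using D by (simp add: ultrafilter_def)
  have kfin: "finite w" if "card w = k" for w :: "'i set"
    using that k by (cases "finite w") auto
  \<comment> \<open>Parameters are named by elements of the index set. Names may repeat, since
    \<open>A\<close> may be smaller than the index set.\<close>
  obtain f :: "'i \<Rightarrow> ('i \<Rightarrow> 'a) set" where f: "range f = A"
    using A(3,2) by (rule card_surjection)
  obtain a0 where a0: "\<And>v t. a0 v t \<in> Univ M" "\<And>v. v \<in> A \<Longrightarrow> ultra_class D M (a0 v) = v"
    using ultrapower_reps[OF A(1) neM] by metis
  define a where "a i = a0 (f i)" for i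
  have a: "a i t \<in> Univ M" for i t
    using a0(1) by (simp add: a_def)
  define kl where "kl i = ultra_class D M (a i)" for i
  have kl: "kl i = f i" for i
    using a0(2)[of "f i"] f by (auto simp: kl_def a_def)
  have klA: "kl ` v \<subseteq> A" for v
    using f by (auto simp: kl)
  obtain w0 :: "'i set" where "card w0 = k" "finite w0"
    using infinite_arbitrarily_large[OF inf(2)] by metis
  then have "{w :: 'i set. card w = k} \<noteq> {}"
    by blast
  moreover have "|{w :: 'i set. card w = k}| \<le>o |UNIV :: 'i set|"
  proof -
    have "{w :: 'i set. card w = k} \<subseteq> {w. finite w \<and> w \<subseteq> UNIV}"
      using kfin by blast
    then show ?thesis
      using card_of_finite_subsets_ordLeq[OF inf(2)] card_of_mono1 ordLeq_transitive by blast
  qed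
  ultimately obtain \<sigma> :: "'i \<Rightarrow> 'i set" where \<sigma>: "range \<sigma> = {w. card w = k}"
    using card_surjection by metis
  have c\<sigma>: "card (\<sigma> i) = k" for i
    using \<sigma> by auto
  have f\<sigma>: "finite (\<sigma> i)" for i
    using kfin c\<sigma> by blast
  \<comment> \<open>A formula whose names collapse in the ultrapower counts as negative, in
    accordance with the fact that x forms no edge with fewer than k vertices.\<close>
  define ps where "ps i \<longleftrightarrow> kl ` \<sigma> i \<in> P \<and> card (kl ` \<sigma> i) = k" for i
  define solv where "solv t u \<longleftrightarrow> (\<exists>x\<in>Univ M. \<forall>i\<in>u. insert x ((\<lambda>y. a y t) ` \<sigma> i) \<in> edges M \<longleftrightarrow> ps i)" for t u
  have cons: "\<exists>b\<in>Univ ?N. \<forall>i\<in>u. insert b (kl ` \<sigma> i) \<in> edges ?N \<longleftrightarrow> ps i" if u: "finite u" for u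
  proof -
    let ?u = "{kl ` \<sigma> i | i. i \<in> u \<and> card (kl ` \<sigma> i) = k}"
    have "finite ?u \<and> (\<forall>w\<in>?u. w \<subseteq> A \<and> card w = k)"
      using u klA by auto
    then obtain b where b: "b \<in> Univ ?N" "\<forall>w\<in>?u. insert b w \<in> edges ?N \<longleftrightarrow> w \<in> P"
      using P by meson
    have "insert b (kl ` \<sigma> i) \<in> edges ?N \<longleftrightarrow> ps i" if i: "i \<in> u" for i
    proof (cases "card (kl ` \<sigma> i) = k")
      case True
      then show ?thesis
        using b(2) i unfolding ps_def by blast
    next
      case False
      then have "card (kl ` \<sigma> i) < k"
        using card_image_le[OF f\<sigma>[of i], of kl] c\<sigma>[of i] by simp
      then have "card (insert b (kl ` \<sigma> i)) < k+1"
        using f\<sigma>[of i] by (simp add: card_insert_if)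
      then show ?thesis
        using hypergraph_edges(2)[OF hypN, of "insert b (kl ` \<sigma> i)"] False by (auto simp: ps_def)
    qed
    then show ?thesis
      using b(1) by blast
  qed
  have los: "insert (ultra_class D M h) (kl ` v) \<in> edges ?N \<longleftrightarrow>
      eventually (\<lambda>t. insert (h t) ((\<lambda>y. a y t) ` v) \<in> edges M) D"
    if h: "\<And>t. h t \<in> Univ M" and v: "card v = k" for h v
  proof -
    let ?a = "case_option h a" and ?w = "insert None (Some ` v)"
    have "card ?w = k+1"
      using v kfin[OF v] by (simp add: card_image)
    moreover have "?a y t \<in> Univ M" for y t
      using a h by (cases y) auto
    ultimately have "(\<lambda>y. ultra_class D M (?a y)) ` ?w \<in> edges ?N \<longleftrightarrow>
        eventually (\<lambda>t. (\<lambda>y. ?a y t) ` ?w \<in> edges M) D"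
      using ultrapower_edges_iff[OF D hypM, of ?a ?w] by simp
    then show ?thesis
      by (simp add: image_image kl_def)
  qed
  define bb where "bb u = j {t. solv t u}" for u
  have mono: "monotonic bb"
    unfolding monotonic_def bb_def solv_def by (intro allI impI j_mono) blast
  have bbU: "bb u \<in> U" if u: "finite u" for u
  proof -
    obtain b where b: "b \<in> Univ ?N" "\<forall>i\<in>u. insert b (kl ` \<sigma> i) \<in> edges ?N \<longleftrightarrow> ps i"
      using cons[OF u] by blast
    obtain h where h: "\<And>t. h t \<in> Univ M" "b = ultra_class D M h"
      using b(1) by (auto simp: ultrapower_simps)
    have "eventually (\<lambda>t. insert (h t) ((\<lambda>y. a y t) ` \<sigma> i) \<in> edges M \<longleftrightarrow> ps i) D" if i: "i \<in> u" for i
    proof (cases "ps i")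
      case True
      then show ?thesis
        using los[of h "\<sigma> i", OF h(1) c\<sigma>] b(2) i h(2) by simp
    next
      case False
      then have "\<not> eventually (\<lambda>t. insert (h t) ((\<lambda>y. a y t) ` \<sigma> i) \<in> edges M) D"
        using los[of h "\<sigma> i", OF h(1) c\<sigma>] b(2) i h(2) by simp
      then show ?thesis
        using False by (simp add: ultrafilter_not[OF D])
    qed
    then have "eventually (\<lambda>t. \<forall>i\<in>u. insert (h t) ((\<lambda>y. a y t) ` \<sigma> i) \<in> edges M \<longleftrightarrow> ps i) D"
      using u by (intro eventually_ball_finite) auto
    then have "eventually (\<lambda>t. t \<in> {t. solv t u}) D"
    proof (rule eventually_mono)
      fix t assume "\<forall>i\<in>u. insert (h t) ((\<lambda>y. a y t) ` \<sigma> i) \<in> edges M \<longleftrightarrow> ps i"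
      then show "t \<in> {t. solv t u}"
        using h(1) unfolding solv_def by blast
    qed
    then show ?thesis
      unfolding bb_def using D_iff by blast
  qed
  \<comment> \<open>The support offered to perfection also covers equalities and edges between
    names. Whenever \<alpha> contains it, these facts live below \<alpha> as well and are
    independent of coordinates beyond \<alpha>.\<close>
  define EE where "EE = bb ` {u. finite u} \<union> (\<lambda>(x, y). j {t. a x t = a y t}) ` UNIV \<union>
      (\<lambda>v. j {t. (\<lambda>y. a y t) ` v \<in> edges M}) ` {v. finite v}"
  have cardfin: "|{u :: 'i set. finite u}| \<le>o |UNIV :: 'i set|"
    using card_of_finite_subsets_ordLeq[OF inf(2)] by simp
  have "|UNIV :: ('i \<times> 'i) set| \<le>o |UNIV :: 'i set|"
    using card_Times_ordLeq[OF inf(2), of "UNIV :: 'i set" "UNIV :: 'i set"]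
      ordLeq_refl[OF card_of_Card_order[of "UNIV :: 'i set"]] by simp
  then have cardEE: "|EE| \<le>o |UNIV :: 'i set|"
    unfolding EE_def using cardfin
    by (intro card_Un_ordLeq inf(2)) (blast intro: ordLeq_transitive[OF card_of_image])+
  define C where "C e = (SOME C. decides C e)" for e :: "('i set, 'm) B1"
  have C: "decides (C e) e" for e
    unfolding C_def by (rule someI_ex) (rule decides_exists[of e], blast)
  define X where "X = gen ` (\<Union>e\<in>EE. C e)"
  have "is_support X bb"
    unfolding is_support_def
  proof (intro conjI allI impI)
    show "X \<subseteq> range gen"
      by (auto simp: X_def)
    fix u :: "'i set" assume "finite u"
    then have "bb u \<in> EE"
      by (auto simp: EE_def)
    then have "gen ` C (bb u) \<subseteq> X"
      by (auto simp: X_def)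
    then show "\<exists>Ca\<subseteq>X. maximal_antichain Ca \<and> (\<forall>a\<in>Ca. a \<le> bb u \<or> a \<le> - bb u)"
      using decides_maximal_antichain[OF C[of "bb u"]] by blast
  qed
  moreover have "|X| \<le>o |UNIV :: 'i set|"
  proof -
    have "|C e| \<le>o |UNIV :: 'i set|" for e
      using card_of_incompatible[OF inf(1)] C[of e] inf(3) ordLeq_transitive by (metis decides_def)
    then have "|\<Union>e\<in>EE. C e| \<le>o |UNIV :: 'i set|"
      by (intro card_of_UNION_ordLeq_infinite[OF inf(2) cardEE]) blast
    then show ?thesis
      unfolding X_def using card_of_image ordLeq_transitive by blast
  qed
  moreover have "\<exists>b'. multiplicative b' \<and> (\<forall>u. finite u \<longrightarrow> b' u \<noteq> bot \<and> b' u \<le> bb u) \<and>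
      (\<forall>c \<in> subalgebra_on (underS |UNIV :: 'i set set| \<alpha>) \<inter> U. c \<noteq> bot \<longrightarrow>
         (\<forall>J. finite J \<longrightarrow> (INF i\<in>J. b' {i} \<squnion> - bb {i}) \<sqinter> c \<noteq> bot))"
    if \<alpha>: "(\<Union>{fmdom' f | f. gen f \<in> X}) \<subseteq> underS |UNIV :: 'i set set| \<alpha>" for \<alpha>
  proof -
    let ?S = "underS |UNIV :: 'i set set| \<alpha>"
    have sup: "supported ?S (Rep_B1 e)" if "e \<in> EE" for e
    proof (rule decides_supported[OF C])
      fix g assume "g \<in> C e"
      then have "gen g \<in> X"
        using that by (auto simp: X_def)
      then show "fmdom' g \<subseteq> ?S"
        using \<alpha> by blast
    qed
    \<comment> \<open>Coordinates outside the segment of \<alpha> cannot be constrained by an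
      element \<open>c\<close> of the subalgebra below \<alpha>.\<close>
    obtain \<nu> :: "'i set \<Rightarrow> 'i set" where \<nu>: "inj_on \<nu> {w. finite w}" "\<And>w. finite w \<Longrightarrow> \<nu> w \<notin> ?S"
      using fresh_coordinates[OF inf(2), of \<alpha>] by metis
    obtain F :: "'i set \<Rightarrow> 'i set" where F: "\<forall>z. |F z| \<le>o |UNIV :: 'm set|"
      "\<forall>v\<subseteq>UNIV. finite v \<and> k-1 \<le> card v \<longrightarrow> (\<exists>z\<subseteq>v. card z = k-1 \<and> v - z \<subseteq> F z)"
      using sierpinski_set_mapping[OF small] by (elim exE conjE)
    have "\<forall>z. \<exists>d :: 'm \<Rightarrow> 'i set. range d = {s. finite s \<and> s \<subseteq> F z}"
      using finite_subset_code[OF inf(1)] F(1) by blast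
    then obtain dec :: "'i set \<Rightarrow> 'm \<Rightarrow> 'i set" where dec: "\<forall>z. range (dec z) = {s. finite s \<and> s \<subseteq> F z}"
      by (rule choice[THEN exE])
    obtain m0 m1 :: 'm where m01: "m0 \<noteq> m1"
      using inf(1) by (metis (full_types) UNIV_eq_I finite.emptyI finite.insertI insertI1)
    let ?less = "|UNIV :: 'i set| - Id"
    have wo: "Well_order |UNIV :: 'i set|"
      by (rule card_of_Well_order)
    interpret edge_type D D\<^sub>0 U j k M a \<sigma> P ?S \<nu> F dec m0 m1 ?less
    proof unfold_locales
      show "0 < k" "extension_property k M" "\<And>v t. a v t \<in> Univ M" "range \<sigma> = {w. card w = k}"
        "inj_on \<nu> {w. finite w}" "\<And>w. finite w \<Longrightarrow> \<nu> w \<notin> ?S" "m0 \<noteq> m1"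
        by (fact k M a \<sigma> \<nu> m01)+
      show "\<exists>z\<subseteq>v. card z = k-1 \<and> v - z \<subseteq> F z" if "finite v" "card v = k+1" for v
        using F(2) that by simp
      show "finite (dec z m)" for z m
        using dec by blast
      show "\<exists>m. dec z m = s" if "finite s" "s \<subseteq> F z" for z s
      proof -
        have "s \<in> range (dec z)"
          using dec that by blast
        then show ?thesis
          by blast
      qed
      show "wf ?less"
        using wo by (simp add: well_order_on_def)
      have "Total |UNIV :: 'i set|"
        using wo by (simp add: order_on_defs)
      then show "(x, y) \<in> ?less \<or> (y, x) \<in> ?less" if "x \<noteq> y" for x y
        using that by (auto simp: total_on_def Field_card_of)
      show "supported ?S (Rep_B1 (j {t. a x t = a y t}))" for x y
        by (rule sup) (auto simp: EE_def)
      show "supported ?S (Rep_B1 (j {t. (\<lambda>y. a y t) ` v \<in> edges M}))" if "finite v" for v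
        by (rule sup) (use that in \<open>auto simp: EE_def\<close>)
      show "\<exists>b\<in>Univ ?N. \<forall>i\<in>u. insert b ((\<lambda>y. ultra_class D M (a y)) ` \<sigma> i) \<in> edges ?N \<longleftrightarrow>
          (\<lambda>y. ultra_class D M (a y)) ` \<sigma> i \<in> P \<and> card ((\<lambda>y. ultra_class D M (a y)) ` \<sigma> i) = k"
        if "finite u" for u
        using cons[OF that] unfolding ps_def kl_def .
    qed
    have sol: "solvable t u \<longleftrightarrow> solv t u" for t u
      unfolding solvable_def solv_def pos_def ps_def cl_def kl_def ..
    show ?thesis
    proof (intro exI[of _ refinement] conjI allI impI ballI)
      show "multiplicative refinement"
        by (rule refinement_multiplicative)
      fix u :: "'i set" assume u: "finite u"
      show "refinement u \<noteq> bot"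
        using u by (rule refinement_nonzero)
      show "refinement u \<le> bb u"
        using refinement_le[OF u] unfolding bb_def sol .
    next
      fix c and J :: "'i set" assume "c \<in> subalgebra_on ?S \<inter> U" "finite J"
      then show "(INF i\<in>J. refinement {i} \<squnion> - bb {i}) \<sqinter> c \<noteq> bot"
        using subalgebra_on_supported by (intro refinement_meets) auto
    qed
  qed
  ultimately have "\<exists>b'. multiplicative b' \<and> (\<forall>u. finite u \<longrightarrow> b' u \<in> U \<and> b' u \<le> bb u)"
    using perf[unfolded perfect_def, THEN conjunct2, THEN spec[of _ bb], THEN mp] mono bbU by blast
  then obtain b' where b': "multiplicative b'" "\<And>u. finite u \<Longrightarrow> b' u \<in> U \<and> b' u \<le> j {t. solv t u}"
    unfolding bb_def by blast
  obtain Y where Y: "\<And>i. eventually (\<lambda>t. t \<in> Y i) D" "\<And>t. finite {i. t \<in> Y i}"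
    "\<And>t. {i. t \<in> Y i} \<noteq> {} \<Longrightarrow> t \<in> {s. solv s {i. t \<in> Y i}}"
    using multiplicative_lift[OF b'(1), of "\<lambda>u. {t. solv t u}"] b'(2) by metis
  \<comment> \<open>A regular family for the names: at each index finitely many of them are avoided,
    so that the realization differs from every parameter.\<close>
  obtain X' :: "'i \<Rightarrow> 'i set" where X': "\<And>i. eventually (\<lambda>t. t \<in> X' i) D\<^sub>0" "\<And>t. finite {i. t \<in> X' i}"
    using regular_family by metis
  have "\<exists>x\<in>Univ M. (\<forall>i. t \<in> Y i \<longrightarrow> (insert x ((\<lambda>y. a y t) ` \<sigma> i) \<in> edges M \<longleftrightarrow> ps i)) \<and>
      (\<forall>i. t \<in> X' i \<longrightarrow> x \<noteq> a i t)" for t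
  proof -
    let ?u = "{i. t \<in> Y i}"
    have "solv t ?u"
    proof (cases "?u = {}")
      case True
      then show ?thesis
        using neM by (auto simp: solv_def)
    next
      case False
      then show ?thesis
        using Y(3) by simp
    qed
    then obtain x where x: "x \<in> Univ M" "\<forall>i\<in>?u. insert x ((\<lambda>y. a y t) ` \<sigma> i) \<in> edges M \<longleftrightarrow> ps i"
      unfolding solv_def by (elim bexE)
    define S where "S = (\<lambda>y. a y t) ` (\<Union>(\<sigma> ` ?u) \<union> {i. t \<in> X' i})"
    have S: "finite S" "S \<subseteq> Univ M"
      using Y(2)[of t] X'(2)[of t] f\<sigma> a by (auto simp: S_def)
    obtain x' where x': "x' \<in> Univ M - S"
      "\<forall>w\<subseteq>S. card w = k \<longrightarrow> (insert x' w \<in> edges M \<longleftrightarrow> insert x w \<in> edges M)"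
      using extension_property_copy[OF M k S x(1)] by (elim bexE)
    have "insert x' ((\<lambda>y. a y t) ` \<sigma> i) \<in> edges M \<longleftrightarrow> ps i" if i: "t \<in> Y i" for i
    proof -
      let ?w = "(\<lambda>y. a y t) ` \<sigma> i"
      have "insert x' ?w \<in> edges M \<longleftrightarrow> insert x ?w \<in> edges M"
      proof (cases "card ?w = k")
        case True
        have "?w \<subseteq> S"
          unfolding S_def using i by (intro image_mono) auto
        then show ?thesis
          using x'(2) True by blast
      next
        case False
        then have "card ?w < k"
          using card_image_le[OF f\<sigma>[of i], of "\<lambda>y. a y t"] c\<sigma>[of i] by simp
        then have "card (insert y ?w) \<noteq> k+1" for y
          using f\<sigma>[of i] by (simp add: card_insert_if)
        then show ?thesis
          using hypergraph_edges(2)[OF hypM] by metis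
      qed
      then show ?thesis
        using x(2) i by simp
    qed
    moreover have "x' \<noteq> a i t" if "t \<in> X' i" for i
      using x'(1) that by (auto simp: S_def)
    ultimately show ?thesis
      using x'(1) by blast
  qed
  then obtain h where h: "\<And>t. h t \<in> Univ M"
    "\<And>t i. t \<in> Y i \<Longrightarrow> insert (h t) ((\<lambda>y. a y t) ` \<sigma> i) \<in> edges M \<longleftrightarrow> ps i"
    "\<And>t i. t \<in> X' i \<Longrightarrow> h t \<noteq> a i t"
    by metis
  let ?b = "ultra_class D M h"
  have "?b \<in> Univ ?N"
    using h(1) by (auto simp: ultrapower_simps)
  moreover have "?b \<notin> A"
  proof
    assume "?b \<in> A"
    then obtain i where "?b = kl i"
      using f kl by (metis imageE)
    then have "eventually (\<lambda>t. h t = a i t) D"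
      using ultra_class_eq_iff[of h M "a i" D] h(1) a by (simp add: kl_def)
    then have "eventually (\<lambda>t. h t = a i t \<and> t \<in> X' i) D"
      using D\<^sub>0_imp_D[OF X'(1)] by (rule eventually_conj)
    then obtain t where "h t = a i t" "t \<in> X' i"
      using eventually_happens'[OF bot] by blast
    then show False
      using h(3) by blast
  qed
  moreover have "insert ?b w \<in> edges ?N \<longleftrightarrow> w \<in> P" if w: "w \<subseteq> A" "card w = k" for w
  proof -
    obtain v where v: "inj_on kl v" "w = kl ` v"
      using w(1) f kl subset_image_inj[of w kl UNIV] by (metis (no_types, lifting) image_cong)
    then have "card v = k"
      using w(2) by (simp add: card_image)
    then obtain i where i: "\<sigma> i = v"
      using \<sigma> by (metis (mono_tags, lifting) imageE mem_Collect_eq)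
    have "insert ?b w \<in> edges ?N \<longleftrightarrow> eventually (\<lambda>t. insert (h t) ((\<lambda>y. a y t) ` v) \<in> edges M) D"
      unfolding v(2) using los[of h v, OF h(1) \<open>card v = k\<close>] .
    also have "\<dots> \<longleftrightarrow> eventually (\<lambda>t. ps i) D"
    proof (rule eventually_subst, rule eventually_mono[OF Y(1)[of i]])
      fix t assume "t \<in> Y i"
      then show "insert (h t) ((\<lambda>y. a y t) ` v) \<in> edges M \<longleftrightarrow> ps i"
        using h(2) i by blast
    qed
    also have "\<dots> \<longleftrightarrow> w \<in> P"
      using bot w(2) by (simp add: eventually_const ps_def i v(2))
    finally show ?thesis .
  qed
  ultimately show "\<exists>b\<in>Univ ?N - A. \<forall>w\<subseteq>A. card w = k \<longrightarrow> (insert b w \<in> edges ?N \<longleftrightarrow> w \<in> P)"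
    by blast
qed

theorem saturated_ultrapower:
  fixes D D\<^sub>0 :: "'i filter" and U :: "('i set, 'm) B1 set" and M :: "'a rstruct" and lam :: "'i rel"
  assumes built: "built D D\<^sub>0 U j" and perf: "perfect U"
    and inf: "infinite (UNIV :: 'm set)" "infinite (UNIV :: 'i set)" "|UNIV :: 'm set| \<le>o |UNIV :: 'i set|"
    and small: "at_most_aleph (k-1) (UNIV :: 'm set) (UNIV :: 'i set)" and lam: "card_order lam"
    and k: "k > 0" and M: "extension_property k M"
  shows "saturated (k+1) (cardSuc lam) (ultrapower D M)"
  unfolding saturated_def
proof (intro allI impI, elim conjE)
  interpret built D D\<^sub>0 U j
    by (rule built)
  let ?N = "ultrapower D M"
  fix A p assume A: "A \<subseteq> Univ ?N" "|A| <o cardSuc lam" and p: "p \<subseteq> param_formulas (k+1) A"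
    "\<forall>q\<subseteq>p. finite q \<longrightarrow> (\<exists>b\<in>Univ ?N. realizes ?N b q)"
  have N: "extension_property k ?N"
    using ultrapower_extension_property[OF D k M] .
  obtain z where z: "z \<in> Univ ?N"
    using N by (auto simp: extension_property_def hypergraph_def is_struct_def)
  have "|A| \<le>o lam"
    using A(2) cardSuc_ordLeq_ordLess[of lam "|A|"] lam card_order_on_Card_order card_of_Card_order by blast
  also have "lam =o |UNIV :: 'i set|"
    using lam by (rule card_of_unique)
  finally have "|A| \<le>o |UNIV :: 'i set|" .
  \<comment> \<open>A vertex is added to the parameters because their enumeration requires a
    nonempty set; formulas over \<open>A\<close> are also formulas over the larger set.\<close>
  then have "|{z} \<union> A| \<le>o |UNIV :: 'i set|"
    using inf(2) by (intro card_Un_ordLeq) (auto simp: finite_card_ordLeq)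
  then have cA: "|insert z A| \<le>o |UNIV :: 'i set|"
    by simp
  have real: "edge_types_realized k ?N (insert z A)"
    by (rule ultrapower_edge_types_realized[OF built perf inf small k M _ _ cA]) (use A(1) z in auto)
  have "p \<subseteq> param_formulas (k+1) (insert z A)"
    using p(1) by (auto simp: param_formulas_def)
  moreover have "finitely_satisfiable ?N p"
    using p(2) by (simp add: finitely_satisfiable_def)
  ultimately show "\<exists>b\<in>Univ ?N. realizes ?N b p"
    using type_realized[OF N k _ _ real] A(1) z by auto
qed

theorem theorem6p1:
  fixes \<alpha> :: "'o rel" and \<mu> :: "'m rel" and lam :: "'i rel"
    and l k :: nat and D :: "'i filter" and T :: "fm set" and M :: "'a rstruct"
  assumes "Well_order \<alpha>" and "l > 0"
    and "card_order \<mu>" and "is_aleph \<alpha> \<mu>"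
    and "card_order lam" and "is_aleph (ord_plus_nat \<alpha> l) lam"
    and "perfected lam \<mu> D"
    and "2 \<le> k"
    and "axiomatizes_Tmk (k+1) k T"
    and "models (k+1) M T"
  shows "(k < l \<longrightarrow> \<not> saturated (k+1) (cardSuc lam) (ultrapower D M)) \<and>
         (l < k \<longrightarrow> saturated (k+1) (cardSuc lam) (ultrapower D M))"
proof (intro conjI impI)
  have k: "k > 0"
    using assms(8) by simp
  have M: "extension_property k M"
    using model_extension_property[OF k assms(9,10)] .
  note card = aleph_bounds[OF assms(1-6)]
  obtain D\<^sub>0 :: "'i filter" and U :: "('i set, 'm) B1 set" where U: "built_from D D\<^sub>0 U" "perfect U"
    using assms(7) unfolding perfected_def by blast
  obtain j where j: "built D D\<^sub>0 U j"
    using U(1) by (rule built_fromE)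
  show "\<not> saturated (k+1) (cardSuc lam) (ultrapower D M)" if "k < l"
  proof -
    \<comment> \<open>From k < l follows k \<le> l - 1, and \<open>lam\<close>, the l-th successor
      of \<mu>, reaches level l - 1 of \<open>beyond_aleph\<close>.\<close>
    have "beyond_aleph k (UNIV :: 'm set) (UNIV :: 'i set)"
      by (rule beyond_aleph_le[OF _ card(5)]) (use that in simp)
    then show ?thesis
      using not_saturated_ultrapower[OF j card(1,2) _ assms(5) k M] by blast
  qed
  show "saturated (k+1) (cardSuc lam) (ultrapower D M)" if "l < k"
  proof -
    \<comment> \<open>From l < k follows l \<le> k - 1; the level is k - 1 because Sierpinski's
      theorem is applied with (k-1)-sets \<open>z\<close>.\<close>
    have "at_most_aleph (k-1) (UNIV :: 'm set) (UNIV :: 'i set)"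
      by (rule at_most_aleph_le[OF _ card(4)]) (use that in simp)
    then show ?thesis
      using saturated_ultrapower[OF j U(2) card(1-3) _ assms(5) k M] by blast
  qed
qed

end
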